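(* Let $d_1,d_2\in\mathbb{N}$, let $k>1$ be an integer, and let $\Phi:\mathbb{M}_{d_1}\to\mathbb{M}_{d_2}$ be a $k$-positive linear map. Then the following conditions are equivalent: (i) $\Phi$ is $k$-entanglement breaking. (ii) $\Phi\circ\Psi$ is entanglement breaking for all CP-maps $\Psi:\mathbb{M}_k\to\mathbb{M}_{d_1}$. (iii) $\Phi\circ\Psi$ is entanglement breaking for all CP-maps $\Psi:\mathbb{M}_m\to\mathbb{M}_{d_1}$ and all $1\leq m\leq k$. (iv) $\Phi\circ\Psi$ is entanglement breaking for all $k$-PEB maps $\Psi:\mathbb{M}_{d_1}\to\mathbb{M}_{d_1}$. (v) $\Phi\circ\Psi$ is entanglement breaking for all $k$-PEB maps $\Psi:\mathbb{M}_m\to\mathbb{M}_{d_1}$ and all $m\geq 1$. (vi) $\Phi\circ Ad_P$ is entanglement breaking for all (orthogonal) projections $P\in\mathbb{M}_{d_1}$ with $\mathrm{rank}(P)=\min\{k,d_1\}$. (vii) $SN\big((\mathrm{id}_m\otimes\Phi)(X)\big)=1$ for all $m\geq 1$ and all $X\in(\mathbb{M}_m\otimes\mathbb{M}_{d_1})^+$ with $SN(X)\leq k$. (viii) $SN\big((\mathrm{id}_{d_1}\otimes\Phi)(X)\big)=1$ for all $X\in(\mathbb{M}_{d_1}\otimes\mathbb{M}_{d_1})^+$ with $SN(X)\leq k$. (ix) $\Gamma\circ\Phi$ is $k$-positive for all positive maps $\Gamma:\mathbb{M}_{d_2}\to\mathbb{M}_m$ and all $m\geq 1$. (x) $\Gamma\circ\Phi$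 is $k$-positive for all positive maps $\Gamma:\mathbb{M}_{d_2}\to\mathbb{M}_{d_1}$. (xi) $\mathrm{tr}(C_\Phi C_{\Gamma\circ\Psi})\geq 0$ for all $k$-PEB maps $\Psi:\mathbb{M}_{d_1}\to\mathbb{M}_{d_1}$ and all positive maps $\Gamma:\mathbb{M}_{d_1}\to\mathbb{M}_{d_2}$.
   Context: $\mathbb{M}_{d_1\times d_2}$ is the space of complex $d_1\times d_2$ matrices, $\mathbb{M}_d=\mathbb{M}_{d\times d}$, and a superscript $+$ denotes the cone of positive semidefinite matrices. $\mathrm{id}_k$ is the identity map of $\mathbb{M}_k$. A linear map $\Phi:\mathbb{M}_{d_1}\to\mathbb{M}_{d_2}$ is positive if it maps positive semidefinite matrices to positive semidefinite matrices, $k$-positive if $\mathrm{id}_k\otimes\Phi$ is positive, and completely positive (CP) if it is $k$-positive for all $k\ge1$. $X\in(\mathbb{M}_{d_1}\otimes\mathbb{M}_{d_2})^+$ is separable if $X=\sum_{i=1}^n A_i\otimes B_i$ with $A_i\in\mathbb{M}_{d_1}^+$, $B_i\in\mathbb{M}_{d_2}^+$. A linear map $\Phi$ is entanglement breaking (EB) if $(\mathrm{id}_m\otimes\Phi)(X)$ is separable for all $m\ge1$ and all $X\in(\mathbb{M}_m\otimes\mathbb{M}_{d_1})^+$. A linear map $\Phi$ is $k$-entanglement breaking ($k$-EB) if it is $k$-positive and $(\mathrm{id}_k\otimes\Phi)(X)$ is separable for every $X\in(\mathbb{M}_k\otimes\mathbb{M}_{d_1})^+$. The Schmidt rank $SR(\xi)$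 of $\xi\in\mathbb{C}^{d_1}\otimes\mathbb{C}^{d_2}$ is the number of nonzero coefficients in a Schmidt decomposition $\xi=\sum_i\lambda_i\,u_i\otimes v_i$ ($\{u_i\}$, $\{v_i\}$ orthonormal, $\lambda_i\geq 0$). With $|x\rangle\langle y|(z)=x\langle y,z\rangle$, the Schmidt number of $X\in(\mathbb{M}_{d_1}\otimes\mathbb{M}_{d_2})^+$ is $SN(X)=\min\max_i SR(\xi_i)$, the minimum being over all decompositions $X=\sum_{i=1}^n|\xi_i\rangle\langle\xi_i|$; $X$ is separable if and only if $SN(X)=1$ (in particular the zero matrix is counted as having Schmidt number $1$). For $V\in\mathbb{M}_{d_1\times d_2}$, $Ad_V:\mathbb{M}_{d_1}\to\mathbb{M}_{d_2}$ is $Ad_V(X)=V^*XV$. A CP-map is $k$-partially entanglement breaking ($k$-PEB) if it can be written as $\sum_i Ad_{V_i}$ with all $\mathrm{rank}(V_i)\leq k$. The Choi matrix of $\Phi$ is $C_\Phi=\sum_{i,j=1}^{d_1}E_{ij}\otimes\Phi(E_{ij})\in\mathbb{M}_{d_1}\otimes\mathbb{M}_{d_2}$, where $E_{ij}$ are the standard matrix units of $\mathbb{M}_{d_1}$. *)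

theory Defs
  imports "Jordan_Normal_Form.Schur_Decomposition" "Jordan_Normal_Form.DL_Rank"
begin

text \<open>
  The spaces of matrices are the carriers \<^term>\<open>carrier_mat n m\<close> of complex matrices; a linear map
  between them is a function on \<^typ>\<open>complex mat\<close> of which only the values on the carrier matter.
  The order on \<^typ>\<open>complex\<close> is the one where \<open>0 \<le> z\<close> means that \<open>z\<close> is real and nonnegative.
  The tensor product of spaces of dimensions \<open>d1\<close> and \<open>d2\<close> has dimension \<open>d1 * d2\<close>; the basis
  vector \<open>e\<^sub>i \<otimes> f\<^sub>j\<close> has index \<open>i * d2 + j\<close> (Kronecker product).
\<close>

definition mat_sum :: "nat \<Rightarrow> nat \<Rightarrow> ('i \<Rightarrow> complex mat) \<Rightarrow> 'i set \<Rightarrow> complex mat" where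
  "mat_sum nr nc A I = mat nr nc (\<lambda>(r, c). \<Sum>i\<in>I. A i $$ (r, c))"

definition mat_trace :: "complex mat \<Rightarrow> complex" where
  "mat_trace A = (\<Sum>i<dim_row A. A $$ (i, i))"

definition mat_unit :: "nat \<Rightarrow> nat \<Rightarrow> nat \<Rightarrow> complex mat" where
  "mat_unit d i j = mat d d (\<lambda>(r, c). if r = i \<and> c = j then 1 else 0)"

definition psd :: "nat \<Rightarrow> complex mat \<Rightarrow> bool" where
  "psd d A \<longleftrightarrow> A \<in> carrier_mat d d \<and> (\<forall>v\<in>carrier_vec d. 0 \<le> (A *\<^sub>v v) \<bullet>c v)"

definition kron :: "complex mat \<Rightarrow> complex mat \<Rightarrow> complex mat" where
  "kron A B = mat (dim_row A * dim_row B) (dim_col A * dim_col B)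
     (\<lambda>(r, c). A $$ (r div dim_row B, c div dim_col B) * B $$ (r mod dim_row B, c mod dim_col B))"

definition kron_vec :: "complex vec \<Rightarrow> complex vec \<Rightarrow> complex vec" where
  "kron_vec u v = vec (dim_vec u * dim_vec v) (\<lambda>i. u $ (i div dim_vec v) * v $ (i mod dim_vec v))"

definition outer :: "complex vec \<Rightarrow> complex vec \<Rightarrow> complex mat" where
  "outer x y = mat (dim_vec x) (dim_vec y) (\<lambda>(r, c). x $ r * cnj (y $ c))"

definition linear_map :: "nat \<Rightarrow> nat \<Rightarrow> (complex mat \<Rightarrow> complex mat) \<Rightarrow> bool" where
  "linear_map d1 d2 \<Phi> \<longleftrightarrow>
     (\<forall>X\<in>carrier_mat d1 d1. \<Phi> X \<in> carrier_mat d2 d2) \<and>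
     (\<forall>X\<in>carrier_mat d1 d1. \<forall>Y\<in>carrier_mat d1 d1. \<Phi> (X + Y) = \<Phi> X + \<Phi> Y) \<and>
     (\<forall>a. \<forall>X\<in>carrier_mat d1 d1. \<Phi> (a \<cdot>\<^sub>m X) = a \<cdot>\<^sub>m \<Phi> X)"

definition mat_block :: "nat \<Rightarrow> complex mat \<Rightarrow> nat \<Rightarrow> nat \<Rightarrow> complex mat" where
  "mat_block d X p q = mat d d (\<lambda>(r, c). X $$ (p * d + r, q * d + c))"

text \<open>
  \<open>id_tensor m d1 d2 \<Phi>\<close> is the map \<open>id\<^sub>m \<otimes> \<Phi>\<close>: it applies \<open>\<Phi>\<close> to each of the \<open>m * m\<close> blocks of
  size \<open>d1 * d1\<close>. The lemmas below show that for linear \<open>\<Phi>\<close> it is the linear map which sends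
  \<open>A \<otimes> B\<close> to \<open>A \<otimes> \<Phi> B\<close>.
\<close>

definition id_tensor ::
  "nat \<Rightarrow> nat \<Rightarrow> nat \<Rightarrow> (complex mat \<Rightarrow> complex mat) \<Rightarrow> complex mat \<Rightarrow> complex mat" where
  "id_tensor m d1 d2 \<Phi> X = mat (m * d2) (m * d2)
     (\<lambda>(r, c). \<Phi> (mat_block d1 X (r div d2) (c div d2)) $$ (r mod d2, c mod d2))"

lemma block_index_less:
  fixes p m r d :: nat
  assumes "p < m" "r < d"
  shows "p * d + r < m * d"
proof -
  have "p * d + r < (p + 1) * d" using assms by simp
  also have "\<dots> \<le> m * d" using assms by (intro mult_le_mono1) simp
  finally show ?thesis .
qed

lemma id_tensor_kron:
  assumes "linear_map d1 d2 \<Phi>" "A \<in> carrier_mat m m" "B \<in> carrier_mat d1 d1"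
  shows "id_tensor m d1 d2 \<Phi> (kron A B) = kron A (\<Phi> B)"
proof -
  have FB: "\<Phi> B \<in> carrier_mat d2 d2" using assms by (auto simp: linear_map_def)
  have blk: "mat_block d1 (kron A B) p q = A $$ (p, q) \<cdot>\<^sub>m B" if "p < m" "q < m" for p q
    using that assms(2,3) block_index_less
    by (intro eq_matI) (auto simp: mat_block_def kron_def)
  show ?thesis
  proof (rule eq_matI)
    fix r c assume "r < dim_row (kron A (\<Phi> B))" "c < dim_col (kron A (\<Phi> B))"
    hence rc: "r < m * d2" "c < m * d2" using assms FB by (auto simp: kron_def)
    hence "r div d2 < m" "c div d2 < m" "0 < d2"
      by (auto simp: less_mult_imp_div_less intro: gr0I)
    moreover have L: "\<Phi> (a \<cdot>\<^sub>m B) = a \<cdot>\<^sub>m \<Phi> B" for a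
      using assms by (auto simp: linear_map_def)
    ultimately show "id_tensor m d1 d2 \<Phi> (kron A B) $$ (r, c) = kron A (\<Phi> B) $$ (r, c)"
      using rc FB L by (simp add: id_tensor_def blk) (simp add: kron_def assms(2)[THEN carrier_matD(1)] assms(2)[THEN carrier_matD(2)])
  qed (use assms FB in \<open>auto simp: id_tensor_def kron_def\<close>)
qed

lemma linear_map_id_tensor:
  assumes "linear_map d1 d2 \<Phi>"
  shows "linear_map (m * d1) (m * d2) (id_tensor m d1 d2 \<Phi>)"
proof -
  have carr: "mat_block d1 X p q \<in> carrier_mat d1 d1" for X p q by (simp add: mat_block_def)
  have carr': "\<Phi> (mat_block d1 X p q) \<in> carrier_mat d2 d2" for X p q
    using assms carr by (auto simp: linear_map_def)
  have bd: "r div d2 < m" "r mod d2 < d2" if "r < m * d2" for r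
    using that by (auto simp: less_mult_imp_div_less intro!: mod_less_divisor gr0I)
  have add: "mat_block d1 (X + Y) p q = mat_block d1 X p q + mat_block d1 Y p q"
    if "X \<in> carrier_mat (m * d1) (m * d1)" "Y \<in> carrier_mat (m * d1) (m * d1)" "p < m" "q < m"
    for X Y p q
    using that block_index_less by (intro eq_matI) (auto simp: mat_block_def)
  have smult: "mat_block d1 (a \<cdot>\<^sub>m X) p q = a \<cdot>\<^sub>m mat_block d1 X p q"
    if "X \<in> carrier_mat (m * d1) (m * d1)" "p < m" "q < m" for a X p q
    using that block_index_less by (intro eq_matI) (auto simp: mat_block_def)
  have c1: "id_tensor m d1 d2 \<Phi> X \<in> carrier_mat (m * d2) (m * d2)" for X
    by (simp add: id_tensor_def)
  have c2: "id_tensor m d1 d2 \<Phi> (X + Y) = id_tensor m d1 d2 \<Phi> X + id_tensor m d1 d2 \<Phi> Y"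
    if "X \<in> carrier_mat (m * d1) (m * d1)" "Y \<in> carrier_mat (m * d1) (m * d1)" for X Y
  proof (rule eq_matI)
    fix r c
    assume "r < dim_row (id_tensor m d1 d2 \<Phi> X + id_tensor m d1 d2 \<Phi> Y)"
      "c < dim_col (id_tensor m d1 d2 \<Phi> X + id_tensor m d1 d2 \<Phi> Y)"
    hence rc: "r < m * d2" "c < m * d2" by (auto simp: id_tensor_def)
    have L: "\<Phi> (mat_block d1 X p q + mat_block d1 Y p q)
      = \<Phi> (mat_block d1 X p q) + \<Phi> (mat_block d1 Y p q)" for p q
      using assms carr by (auto simp: linear_map_def)
    show "id_tensor m d1 d2 \<Phi> (X + Y) $$ (r, c)
      = (id_tensor m d1 d2 \<Phi> X + id_tensor m d1 d2 \<Phi> Y) $$ (r, c)"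
      using rc bd[OF rc(1)] bd[OF rc(2)] that carr'[THEN carrier_matD(1)] carr'[THEN carrier_matD(2)]
      by (simp add: id_tensor_def add L)
  qed (auto simp: id_tensor_def)
  have c3: "id_tensor m d1 d2 \<Phi> (a \<cdot>\<^sub>m X) = a \<cdot>\<^sub>m id_tensor m d1 d2 \<Phi> X"
    if "X \<in> carrier_mat (m * d1) (m * d1)" for a X
  proof (rule eq_matI)
    fix r c
    assume "r < dim_row (a \<cdot>\<^sub>m id_tensor m d1 d2 \<Phi> X)" "c < dim_col (a \<cdot>\<^sub>m id_tensor m d1 d2 \<Phi> X)"
    hence rc: "r < m * d2" "c < m * d2" by (auto simp: id_tensor_def)
    have L: "\<Phi> (a \<cdot>\<^sub>m mat_block d1 X p q) = a \<cdot>\<^sub>m \<Phi> (mat_block d1 X p q)" for p q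
      using assms carr by (auto simp: linear_map_def)
    show "id_tensor m d1 d2 \<Phi> (a \<cdot>\<^sub>m X) $$ (r, c) = (a \<cdot>\<^sub>m id_tensor m d1 d2 \<Phi> X) $$ (r, c)"
      using rc bd[OF rc(1)] bd[OF rc(2)] that carr'[THEN carrier_matD(1)] carr'[THEN carrier_matD(2)]
      by (simp add: id_tensor_def smult L)
  qed (auto simp: id_tensor_def)
  show ?thesis using c1 c2 c3 by (auto simp: linear_map_def)
qed

definition positive_map :: "nat \<Rightarrow> nat \<Rightarrow> (complex mat \<Rightarrow> complex mat) \<Rightarrow> bool" where
  "positive_map d1 d2 \<Phi> \<longleftrightarrow> linear_map d1 d2 \<Phi> \<and> (\<forall>X. psd d1 X \<longrightarrow> psd d2 (\<Phi> X))"

definition k_positive :: "nat \<Rightarrow> nat \<Rightarrow> nat \<Rightarrow> (complex mat \<Rightarrow> complex mat) \<Rightarrow> bool" where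
  "k_positive k d1 d2 \<Phi> \<longleftrightarrow>
     linear_map d1 d2 \<Phi> \<and> positive_map (k * d1) (k * d2) (id_tensor k d1 d2 \<Phi>)"

definition completely_positive :: "nat \<Rightarrow> nat \<Rightarrow> (complex mat \<Rightarrow> complex mat) \<Rightarrow> bool" where
  "completely_positive d1 d2 \<Phi> \<longleftrightarrow> linear_map d1 d2 \<Phi> \<and> (\<forall>k\<ge>1. k_positive k d1 d2 \<Phi>)"

definition separable :: "nat \<Rightarrow> nat \<Rightarrow> complex mat \<Rightarrow> bool" where
  "separable d1 d2 X \<longleftrightarrow>
     (\<exists>(n::nat) A B. (\<forall>i<n. psd d1 (A i) \<and> psd d2 (B i)) \<and>
        X = mat_sum (d1 * d2) (d1 * d2) (\<lambda>i. kron (A i) (B i)) {..<n})"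

definition entanglement_breaking :: "nat \<Rightarrow> nat \<Rightarrow> (complex mat \<Rightarrow> complex mat) \<Rightarrow> bool" where
  "entanglement_breaking d1 d2 \<Phi> \<longleftrightarrow>
     linear_map d1 d2 \<Phi> \<and>
     (\<forall>m\<ge>1. \<forall>X. psd (m * d1) X \<longrightarrow> separable m d2 (id_tensor m d1 d2 \<Phi> X))"

definition k_entanglement_breaking ::
  "nat \<Rightarrow> nat \<Rightarrow> nat \<Rightarrow> (complex mat \<Rightarrow> complex mat) \<Rightarrow> bool" where
  "k_entanglement_breaking k d1 d2 \<Phi> \<longleftrightarrow>
     k_positive k d1 d2 \<Phi> \<and>
     (\<forall>X. psd (k * d1) X \<longrightarrow> separable k d2 (id_tensor k d1 d2 \<Phi> X))"

definition orthonormal :: "nat \<Rightarrow> nat \<Rightarrow> (nat \<Rightarrow> complex vec) \<Rightarrow> bool" where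
  "orthonormal d n u \<longleftrightarrow>
     (\<forall>i<n. u i \<in> carrier_vec d) \<and> (\<forall>i<n. \<forall>j<n. u i \<bullet>c u j = (if i = j then 1 else 0))"

definition schmidt_decomposition ::
  "nat \<Rightarrow> nat \<Rightarrow> complex vec \<Rightarrow> nat \<Rightarrow> (nat \<Rightarrow> real) \<Rightarrow> (nat \<Rightarrow> complex vec) \<Rightarrow> (nat \<Rightarrow> complex vec) \<Rightarrow> bool"
  where
  "schmidt_decomposition d1 d2 \<xi> n lam u v \<longleftrightarrow>
     orthonormal d1 n u \<and> orthonormal d2 n v \<and> (\<forall>i<n. 0 \<le> lam i) \<and>
     \<xi> = vec (d1 * d2) (\<lambda>a. \<Sum>i<n. complex_of_real (lam i) * kron_vec (u i) (v i) $ a)"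

text \<open>The number of nonzero coefficients is the same in all Schmidt decompositions of \<open>\<xi>\<close>.\<close>

definition schmidt_rank :: "nat \<Rightarrow> nat \<Rightarrow> complex vec \<Rightarrow> nat" where
  "schmidt_rank d1 d2 \<xi> =
     (THE r. \<exists>n lam u v. schmidt_decomposition d1 d2 \<xi> n lam u v \<and> r = card {i. i < n \<and> lam i \<noteq> 0})"

text \<open>
  The infimum of a nonempty set of natural numbers is its minimum, and every positive semidefinite
  matrix has a decomposition. Inserting \<open>1\<close> only matters for the zero matrix, whose Schmidt number
  is \<open>1\<close> by convention: a decomposition of any other matrix contains a nonzero vector, which has
  Schmidt rank at least \<open>1\<close>. Only the values at positive semidefinite matrices are meaningful.
\<close>

definition schmidt_number :: "nat \<Rightarrow> nat \<Rightarrow> complex mat \<Rightarrow> nat" where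
  "schmidt_number d1 d2 X =
     Inf {Max (insert 1 ((\<lambda>i. schmidt_rank d1 d2 (\<xi> i)) ` {..<n})) | (n::nat) \<xi>.
       (\<forall>i<n. \<xi> i \<in> carrier_vec (d1 * d2)) \<and>
       X = mat_sum (d1 * d2) (d1 * d2) (\<lambda>i. outer (\<xi> i) (\<xi> i)) {..<n}}"

definition Ad :: "complex mat \<Rightarrow> complex mat \<Rightarrow> complex mat" where
  "Ad V X = mat_adjoint V * X * V"

definition k_PEB :: "nat \<Rightarrow> nat \<Rightarrow> nat \<Rightarrow> (complex mat \<Rightarrow> complex mat) \<Rightarrow> bool" where
  "k_PEB k d1 d2 \<Phi> \<longleftrightarrow>
     completely_positive d1 d2 \<Phi> \<and>
     (\<exists>(n::nat) V. (\<forall>i<n. V i \<in> carrier_mat d1 d2 \<and> vec_space.rank d1 (V i) \<le> k) \<and>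
        (\<forall>X\<in>carrier_mat d1 d1. \<Phi> X = mat_sum d2 d2 (\<lambda>i. Ad (V i) X) {..<n}))"

definition orth_projection :: "nat \<Rightarrow> complex mat \<Rightarrow> bool" where
  "orth_projection d P \<longleftrightarrow> P \<in> carrier_mat d d \<and> P * P = P \<and> mat_adjoint P = P"

definition choi :: "nat \<Rightarrow> nat \<Rightarrow> (complex mat \<Rightarrow> complex mat) \<Rightarrow> complex mat" where
  "choi d1 d2 \<Phi> = mat_sum (d1 * d2) (d1 * d2)
     (\<lambda>(i, j). kron (mat_unit d1 i j) (\<Phi> (mat_unit d1 i j))) ({..<d1} \<times> {..<d1})"

end

theory Submission
  imports Defs "Jordan_Normal_Form.Spectral_Radius"
begin

text \<open>
  All conditions are about the Choi matrices of the maps \<open>\<Phi> \<circ> Ad V\<close>, and they differ in the class from which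
  \<open>V\<close> is taken. A linear map is entanglement breaking if and only if its Choi matrix is separable
  (\<open>entanglement_breaking_iff_choi\<close>). The Choi matrix of \<open>Ad V\<close> is \<open>|\<xi>\<rangle>\<langle>\<xi>|\<close> where \<open>\<xi>\<close> corresponds to \<open>V\<close> and
  the Schmidt rank of \<open>\<xi>\<close> is the rank of \<open>V\<close>; as positive semidefinite matrices are sums of matrices
  \<open>|\<xi>\<rangle>\<langle>\<xi>|\<close>, the image of such a matrix under \<open>id \<otimes> \<Phi>\<close> is a sum of Choi matrices of maps \<open>\<Phi> \<circ> Ad V\<close>
  (\<open>id_tensor_sum_outer\<close>). In this way \<open>k\<close>-entanglement breaking is about the \<open>V\<close> with \<open>k\<close> rows, the conditions
  on partially entanglement breaking maps and on Schmidt numbers are about \<open>V\<close> of rank at most \<open>k\<close>, and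
  one condition is about projections.

  These classes lead to the same condition, called \<open>breaks_kraus_rank\<close>. A matrix \<open>V\<close> of rank at most \<open>k\<close> factors
  as \<open>X * Y\<close> where \<open>Y\<close> has \<open>k\<close> rows, and the factor \<open>X\<close> acts on the Choi matrix by a local operation on the first
  tensor factor, which preserves separability (\<open>separable_choi_comp_Ad_mult\<close>). Moreover \<open>V = V * P\<close> for a
  projection \<open>P\<close> of rank \<open>min k d1\<close> (\<open>projection_fixing_rows\<close>), so that projections suffice.

  The conditions with a positive map \<open>\<Gamma>\<close> are dual to separability. The cone of separable matrices is closed,
  by Caratheodory's theorem and compactness; hence a Hermitian matrix \<open>Y\<close> outside of it is separated from it by a
  functional which is nonnegative on product states. Such functionals are the pairings \<open>tr (Y C)\<close> with Choi matrices
  \<open>C\<close> of positive maps (\<open>entanglement_witness\<close>). In the pairing of two Choi matrices a Kraus operator can be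
  moved from one map to the other (\<open>trace_choi_comp_Ad\<close>), and the pairing is the expectation of
  \<open>id \<otimes> \<Gamma>'\<close> at a maximally entangled vector, with \<open>\<Gamma>'\<close> the dual map of \<open>\<Gamma>\<close> (\<open>trace_choi_eq_dual_map\<close>). A witness
  therefore contradicts both the condition on traces and the \<open>k\<close>-positivity of \<open>\<Gamma>' \<circ> \<Phi>\<close>. In the other direction
  \<open>id \<otimes> \<Gamma>\<close> is positive on separable matrices for each positive \<open>\<Gamma>\<close> (\<open>psd_id_tensor_separable\<close>).
\<close>

section \<open>Linear systems and the spectral theorem\<close>

text \<open>
  Counting dimensions for linear systems. It is used twice over: over \<open>\<complex>\<close> to find orthogonal vectors and to
  bound ranks, over \<open>\<real>\<close> to shorten conic combinations.
\<close>

lemma homogeneous_system_nontrivial: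
  fixes a :: "nat \<Rightarrow> nat \<Rightarrow> 'a :: field"
  assumes "N < M"
  shows "\<exists>x. (\<exists>j<M. x j \<noteq> 0) \<and> (\<forall>i<N. (\<Sum>j<M. a i j * x j) = 0)"
proof -
  \<comment> \<open>Zero rows make the system square; its determinant vanishes because row \<open>N\<close> is zero.\<close>
  define A where "A = mat M M (\<lambda>(i, j). if i < N then a i j else 0)"
  have A: "A \<in> carrier_mat M M" by (simp add: A_def)
  have "transpose_mat A *\<^sub>v unit_vec M N = 0\<^sub>v M"
    using assms by (intro eq_vecI) (auto simp: A_def scalar_prod_def unit_vec_def intro!: sum.neutral)
  moreover have "unit_vec M N \<noteq> (0\<^sub>v M :: 'a vec)"
    using assms by (metis unit_vec_nonzero)
  ultimately have "det (transpose_mat A) = 0"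
    using det_0_iff_vec_prod_zero_field[of "transpose_mat A" M] A unit_vec_carrier[of M N]
    by (metis transpose_carrier_mat)
  hence "det A = 0" using det_transpose[OF A] by simp
  then obtain v where v: "v \<in> carrier_vec M" "v \<noteq> 0\<^sub>v M" "A *\<^sub>v v = 0\<^sub>v M"
    using det_0_iff_vec_prod_zero_field[OF A] by auto
  have "\<exists>j<M. v $ j \<noteq> 0" using v(1,2) by (metis carrier_vecD eq_vecI index_zero_vec)
  moreover have "(\<Sum>j<M. a i j * v $ j) = 0" if "i < N" for i
  proof -
    have "(A *\<^sub>v v) $ i = 0" using v(3) that assms by simp
    thus ?thesis using that assms v(1)
      by (simp add: A_def scalar_prod_def atLeast0LessThan)
  qed
  ultimately show ?thesis by (intro exI[of _ "\<lambda>j. v $ j"]) auto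
qed

text \<open>
  Vectors are functions here, of which the first \<open>d\<close> values matter: this keeps the sums below free of
  carrier conditions, and \<open>u i j\<close> is the \<open>j\<close>-th entry of the \<open>i\<close>-th vector of a family.
\<close>

definition cinner :: "nat \<Rightarrow> (nat \<Rightarrow> complex) \<Rightarrow> (nat \<Rightarrow> complex) \<Rightarrow> complex" where
  "cinner d f g = (\<Sum>i<d. f i * cnj (g i))"

definition orthonormal_family :: "nat \<Rightarrow> nat \<Rightarrow> (nat \<Rightarrow> nat \<Rightarrow> complex) \<Rightarrow> bool" where
  "orthonormal_family d n u \<longleftrightarrow> (\<forall>i<n. \<forall>j<n. cinner d (u i) (u j) = (if i = j then 1 else 0))"

lemma cinner_commute: "cinner d g f = cnj (cinner d f g)"
  by (simp add: cinner_def mult.commute)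

lemma cinner_self: "cinner d f f = of_real (\<Sum>i<d. (cmod (f i))\<^sup>2)"
  by (simp add: cinner_def complex_norm_square[symmetric])

lemma cinner_scale_left: "cinner d (\<lambda>i. c * f i) g = c * cinner d f g"
  by (simp add: cinner_def sum_distrib_left mult.assoc)

lemma cinner_scale_right: "cinner d f (\<lambda>i. c * g i) = cnj c * cinner d f g"
  by (simp add: cinner_def sum_distrib_left algebra_simps)

lemma cinner_sum_left: "cinner d (\<lambda>i. \<Sum>k\<in>K. F k i) g = (\<Sum>k\<in>K. cinner d (F k) g)"
  unfolding cinner_def sum_distrib_right by (rule sum.swap)

lemma normalize_vector:
  assumes "\<exists>i<d. f i \<noteq> 0"
  shows "\<exists>c::real. c > 0 \<and> cinner d (\<lambda>i. of_real c * f i) (\<lambda>i. of_real c * f i) = 1"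
proof -
  let ?s = "\<Sum>i<d. (cmod (f i))\<^sup>2"
  obtain i where i: "i < d" "f i \<noteq> 0" using assms by blast
  have s: "?s > 0" by (rule sum_pos2[of _ i]) (use i in auto)
  define t where "t = ?s"
  have "1 / sqrt t * (1 / sqrt t * t) = 1"
    using s by (simp add: t_def[symmetric] field_simps)
  hence "of_real (1 / sqrt t) * (of_real (1 / sqrt t) * of_real t) = (1::complex)"
    unfolding of_real_mult[symmetric] by simp
  hence "cinner d (\<lambda>i. of_real (1 / sqrt t) * f i) (\<lambda>i. of_real (1 / sqrt t) * f i) = 1"
    unfolding cinner_scale_left cinner_scale_right complex_cnj_complex_of_real cinner_self t_def .
  thus ?thesis using s by (intro exI[of _ "1 / sqrt t"]) (simp add: t_def)
qed

lemma orthonormal_family_extend_one: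
  assumes "orthonormal_family d n u" "n < d"
  shows "\<exists>w. orthonormal_family d (Suc n) (u(n := w))"
proof -
  obtain x where x: "\<exists>j<d. x j \<noteq> 0" "\<forall>i<n. (\<Sum>j<d. cnj (u i j) * x j) = 0"
    using homogeneous_system_nontrivial[OF assms(2), of "\<lambda>i j. cnj (u i j)"] by auto
  obtain c where c: "cinner d (\<lambda>i. of_real c * x i) (\<lambda>i. of_real c * x i) = 1"
    using normalize_vector[OF x(1)] by auto
  have o: "cinner d (\<lambda>i. of_real c * x i) (u i) = 0" if "i < n" for i
    using x(2) that unfolding cinner_scale_left by (simp add: cinner_def mult.commute)
  have o': "cinner d (u i) (\<lambda>i. of_real c * x i) = 0" if "i < n" for i
    using o[OF that] by (subst cinner_commute) simp
  have "orthonormal_family d (Suc n) (u(n := (\<lambda>i. of_real c * x i)))"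
    using assms(1) c o o' by (auto simp: orthonormal_family_def less_Suc_eq)
  thus ?thesis by blast
qed

lemma orthonormal_family_extend:
  assumes "orthonormal_family d n u" "n \<le> d"
  shows "\<exists>v. orthonormal_family d d v \<and> (\<forall>i<n. v i = u i)"
proof -
  have "n \<le> m \<Longrightarrow> m \<le> d \<Longrightarrow> \<exists>v. orthonormal_family d m v \<and> (\<forall>i<n. v i = u i)" for m
  proof (induction m rule: dec_induct)
    case base thus ?case using assms by auto
  next
    case (step m)
    then obtain v where v: "orthonormal_family d m v" "\<forall>i<n. v i = u i" by auto
    obtain w where w: "orthonormal_family d (Suc m) (v(m := w))" using orthonormal_family_extend_one[OF v(1)] step by auto
    have "\<forall>i<n. (v(m := w)) i = u i" using v(2) step by auto
    with w show ?case by blast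
  qed
  thus ?thesis using assms(2) by blast
qed

text \<open>
  If the rows of a square matrix are orthonormal, so are its columns: a left inverse is a right inverse.
\<close>

lemma orthonormal_basis_complete:
  assumes "orthonormal_family d d u" "r < d" "s < d"
  shows "(\<Sum>i<d. u i r * cnj (u i s)) = (if r = s then 1 else 0)"
proof -
  define A where "A = mat d d (\<lambda>(i, r). u i r)"
  define B where "B = mat d d (\<lambda>(r, i). cnj (u i r))"
  have "A * B = 1\<^sub>m d"
    using assms(1) by (intro eq_matI)
      (auto simp: A_def B_def scalar_prod_def orthonormal_family_def cinner_def atLeast0LessThan)
  hence "B * A = 1\<^sub>m d"
    by (intro mat_mult_left_right_inverse[of A d B]) (auto simp: A_def B_def)
  hence "(B * A) $$ (s, r) = (if r = s then 1 else 0)" using assms by auto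
  thus ?thesis using assms by (simp add: A_def B_def scalar_prod_def atLeast0LessThan mult.commute)
qed

lemma orthonormal_basis_expand:
  assumes "orthonormal_family d d u" "r < d"
  shows "f r = (\<Sum>i<d. cinner d f (u i) * u i r)"
proof -
  have "(\<Sum>i<d. cinner d f (u i) * u i r) = (\<Sum>i<d. \<Sum>s<d. f s * (u i r * cnj (u i s)))"
    unfolding cinner_def sum_distrib_right by (intro sum.cong refl) (simp add: algebra_simps)
  also have "\<dots> = (\<Sum>s<d. f s * (\<Sum>i<d. u i r * cnj (u i s)))"
    unfolding sum_distrib_left by (rule sum.swap)
  also have "\<dots> = (\<Sum>s<d. if r = s then f s else 0)"
    using assms by (intro sum.cong refl) (simp add: orthonormal_basis_complete)
  finally show ?thesis using assms(2) by simp
qed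

definition hermitian_fun :: "nat \<Rightarrow> (nat \<Rightarrow> nat \<Rightarrow> complex) \<Rightarrow> bool" where
  "hermitian_fun d A \<longleftrightarrow> (\<forall>r<d. \<forall>s<d. A s r = cnj (A r s))"

lemma hermitian_cinner:
  assumes "hermitian_fun d A"
  shows "cinner d (\<lambda>r. \<Sum>s<d. A r s * f s) g = cinner d f (\<lambda>r. \<Sum>s<d. A r s * g s)"
proof -
  have "cinner d (\<lambda>r. \<Sum>s<d. A r s * f s) g = (\<Sum>r<d. \<Sum>s<d. A r s * f s * cnj (g r))"
    by (simp add: cinner_def sum_distrib_right)
  also have "\<dots> = (\<Sum>s<d. \<Sum>r<d. A r s * f s * cnj (g r))" by (rule sum.swap)
  also have "\<dots> = (\<Sum>s<d. \<Sum>r<d. f s * cnj (A s r * g r))"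
  proof (intro sum.cong refl)
    fix s r assume "s \<in> {..<d}" "r \<in> {..<d}"
    hence "A r s = cnj (A s r)" using assms unfolding hermitian_fun_def by blast
    thus "A r s * f s * cnj (g r) = f s * cnj (A s r * g r)" by simp
  qed
  finally show ?thesis by (simp add: cinner_def sum_distrib_left)
qed

lemma eigenvector_exists:
  fixes C :: "nat \<Rightarrow> nat \<Rightarrow> complex"
  assumes "0 < n"
  shows "\<exists>x \<mu>. (\<exists>i<n. x i \<noteq> 0) \<and> (\<forall>p<n. (\<Sum>q<n. C p q * x q) = \<mu> * x p)"
proof -
  define A where "A = mat n n (\<lambda>(p, q). C p q)"
  have A: "A \<in> carrier_mat n n" by (simp add: A_def)
  obtain \<mu> where "eigenvalue A \<mu>"
    using spectrum_non_empty[OF A] assms by (auto simp: spectrum_def)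
  then obtain v where v: "v \<in> carrier_vec n" "v \<noteq> 0\<^sub>v n" "A *\<^sub>v v = \<mu> \<cdot>\<^sub>v v"
    using A by (auto simp: eigenvalue_def eigenvector_def)
  have "\<exists>i<n. v $ i \<noteq> 0" using v(1,2) by (metis carrier_vecD eq_vecI index_zero_vec)
  moreover have "(\<Sum>q<n. C p q * v $ q) = \<mu> * v $ p" if "p < n" for p
  proof -
    have "(A *\<^sub>v v) $ p = \<mu> * v $ p" using v that by simp
    thus ?thesis using that v(1) by (simp add: A_def scalar_prod_def atLeast0LessThan)
  qed
  ultimately show ?thesis by (intro exI[of _ "\<lambda>i. v $ i"] exI[of _ \<mu>]) auto
qed

text \<open>
  The spectral theorem. Orthonormal eigenvectors \<open>v\<^sub>0, \<dots>, v\<^bsub>j-1\<^esub>\<close> are collected one at a time: complete them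
  to an orthonormal basis \<open>u\<close>, compress \<open>A\<close> to the span of the remaining basis vectors and take an
  eigenvector \<open>w\<close> of the compression. Since \<open>A\<close> is Hermitian it maps this span to itself, so that \<open>w\<close> is an
  eigenvector of \<open>A\<close>.
\<close>

lemma hermitian_eigenbasis:
  assumes H: "hermitian_fun d A"
  shows "\<exists>v lam. orthonormal_family d d v \<and> (\<forall>i<d. \<forall>r<d. (\<Sum>s<d. A r s * v i s) = of_real (lam i) * v i r)"
proof -
  have "j \<le> d \<Longrightarrow> \<exists>v lam. orthonormal_family d j v \<and>
      (\<forall>i<j. \<forall>r<d. (\<Sum>s<d. A r s * v i s) = of_real (lam i) * v i r)" for j
  proof (induction j)
    case 0 thus ?case by (auto simp: orthonormal_family_def)
  next
    case (Suc j)
    then obtain v lam where v: "orthonormal_family d j v"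
      and ev: "\<forall>i<j. \<forall>r<d. (\<Sum>s<d. A r s * v i s) = of_real (lam i) * v i r" by auto
    obtain u where u: "orthonormal_family d d u" and uv: "\<forall>i<j. u i = v i"
      using orthonormal_family_extend[OF v] Suc by auto
    define AA where "AA f r = (\<Sum>s<d. A r s * f s)" for f r
    define n where "n = d - j"
    have n: "0 < n" using Suc by (simp add: n_def)
    obtain x \<mu> where x: "\<exists>q<n. x q \<noteq> 0"
      and ex: "\<forall>p<n. (\<Sum>q<n. cinner d (AA (u (j + q))) (u (j + p)) * x q) = \<mu> * x p"
      using eigenvector_exists[OF n, of "\<lambda>p q. cinner d (AA (u (j + q))) (u (j + p))"] by auto
    define w where "w r = (\<Sum>q<n. x q * u (j + q) r)" for r
    have AAw: "AA w r = (\<Sum>q<n. x q * AA (u (j + q)) r)" for r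
      unfolding AA_def w_def sum_distrib_left
      by (subst sum.swap) (simp add: algebra_simps)
    \<comment> \<open>The coordinates of \<open>w\<close>, and then of \<open>A w\<close>, in the basis \<open>u\<close>.\<close>
    have w_in: "cinner d w (u i) = (if i < j then 0 else x (i - j))" if "i < d" for i
    proof -
      have "cinner d w (u i) = (\<Sum>q<n. x q * cinner d (u (j + q)) (u i))"
        unfolding w_def cinner_sum_left cinner_scale_left ..
      also have "\<dots> = (\<Sum>q<n. if j + q = i then x q else 0)"
        using u that n_def by (intro sum.cong refl) (auto simp: orthonormal_family_def)
      also have "\<dots> = (\<Sum>q<n. if q = i - j \<and> j \<le> i then x q else 0)"
        by (intro sum.cong refl) auto
      also have "\<dots> = (if i < j then 0 else x (i - j))" using that n_def by (auto simp: sum.delta')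
      finally show ?thesis .
    qed
    have Aw_in: "cinner d (AA w) (u i) = \<mu> * cinner d w (u i)" if "i < d" for i
    proof (cases "i < j")
      case True
      have "cinner d (AA w) (u i) = cinner d w (AA (u i))"
        unfolding AA_def by (rule hermitian_cinner[OF H])
      also have "\<dots> = cinner d w (\<lambda>r. of_real (lam i) * u i r)"
        using True uv ev by (simp add: cinner_def AA_def)
      also have "\<dots> = 0" using w_in[OF that] True by (simp add: cinner_scale_right)
      finally show ?thesis using w_in[OF that] True by simp
    next
      case False
      have "cinner d (AA w) (u i) = (\<Sum>q<n. x q * cinner d (AA (u (j + q))) (u i))"
        unfolding AAw cinner_sum_left cinner_scale_left ..
      also have "\<dots> = \<mu> * x (i - j)"
        using ex[rule_format, of "i - j"] that False by (simp add: n_def mult.commute)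
      finally show ?thesis using w_in[OF that] False by simp
    qed
    have Aw: "AA w r = \<mu> * w r" if "r < d" for r
    proof -
      have "AA w r = (\<Sum>i<d. cinner d (AA w) (u i) * u i r)" by (rule orthonormal_basis_expand[OF u that])
      also have "\<dots> = \<mu> * (\<Sum>i<d. cinner d w (u i) * u i r)"
        unfolding sum_distrib_left by (intro sum.cong refl) (simp add: Aw_in)
      finally show ?thesis using orthonormal_basis_expand[OF u that, of w] by simp
    qed
    obtain q where q: "q < n" "x q \<noteq> 0" using x by auto
    have "\<exists>i<d. w i \<noteq> 0"
    proof (rule ccontr)
      assume "\<not> (\<exists>i<d. w i \<noteq> 0)"
      hence "cinner d w (u (j + q)) = 0" by (simp add: cinner_def)
      thus False using w_in[of "j + q"] q n_def by simp
    qed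
    then obtain c where c: "c > 0" "cinner d (\<lambda>i. of_real c * w i) (\<lambda>i. of_real c * w i) = 1"
      using normalize_vector by blast
    define w' where "w' = (\<lambda>i. of_real c * w i)"
    have Aw': "(\<Sum>s<d. A r s * w' s) = \<mu> * w' r" if "r < d" for r
    proof -
      have "(\<Sum>s<d. A r s * w' s) = of_real c * AA w r"
        by (simp add: w'_def AA_def sum_distrib_left algebra_simps)
      thus ?thesis using Aw[OF that] by (simp add: w'_def)
    qed
    have w'0: "cinner d w' (u i) = 0" if "i < j" for i
      using w_in[of i] that Suc by (simp add: w'_def cinner_scale_left)
    have "cinner d (\<lambda>r. \<Sum>s<d. A r s * w' s) w' = cinner d (\<lambda>r. \<mu> * w' r) w'"
      using Aw' by (simp add: cinner_def)
    moreover have "cinner d w' (\<lambda>r. \<Sum>s<d. A r s * w' s) = cinner d w' (\<lambda>r. \<mu> * w' r)"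
      using Aw' by (simp add: cinner_def)
    ultimately have "cinner d (\<lambda>r. \<mu> * w' r) w' = cinner d w' (\<lambda>r. \<mu> * w' r)"
      using hermitian_cinner[OF H, of w' w'] by simp
    \<comment> \<open>Comparing \<open>\<langle>A w, w\<rangle>\<close> with \<open>\<langle>w, A w\<rangle>\<close> shows that the eigenvalue is real.\<close>
    hence "cnj \<mu> = \<mu>"
      using c(2)[folded w'_def] by (simp add: cinner_scale_left cinner_scale_right)
    hence \<mu>: "\<mu> = of_real (Re \<mu>)" by (metis Reals_cnj_iff of_real_Re)
    have w'0': "cinner d (u i) w' = 0" if "i < j" for i
      using w'0[OF that] by (subst cinner_commute) simp
    have "orthonormal_family d (Suc j) (v(j := w'))"
      using v c(2) w'0 w'0' uv by (auto simp: orthonormal_family_def less_Suc_eq w'_def[symmetric])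
    moreover have "\<forall>i<Suc j. \<forall>r<d. (\<Sum>s<d. A r s * (v(j := w')) i s)
        = of_real ((lam(j := Re \<mu>)) i) * (v(j := w')) i r"
      using ev Aw' \<mu> by (auto simp: less_Suc_eq)
    ultimately show ?case by blast
  qed
  thus ?thesis by blast
qed

lemma spectral_decomposition:
  assumes "orthonormal_family d d v" "\<forall>i<d. \<forall>r<d. (\<Sum>s<d. A r s * v i s) = of_real (lam i) * v i r"
    and "r < d" "t < d"
  shows "A r t = (\<Sum>i<d. of_real (lam i) * v i r * cnj (v i t))"
proof -
  have "A r t = (\<Sum>s<d. if s = t then A r s else 0)" using assms by simp
  also have "\<dots> = (\<Sum>s<d. A r s * (\<Sum>i<d. v i s * cnj (v i t)))"
    using assms by (intro sum.cong refl) (simp add: orthonormal_basis_complete)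
  also have "\<dots> = (\<Sum>i<d. (\<Sum>s<d. A r s * v i s) * cnj (v i t))"
    unfolding sum_distrib_left sum_distrib_right by (subst sum.swap) (simp add: mult.assoc)
  also have "\<dots> = (\<Sum>i<d. of_real (lam i) * v i r * cnj (v i t))"
    using assms by (intro sum.cong refl) simp
  finally show ?thesis .
qed

section \<open>Separation from closed cones\<close>

text \<open>
  The step of Caratheodory's theorem for cones: subtract a multiple of a linear dependency among the
  generators such that one coefficient becomes zero and no coefficient becomes negative.
\<close>

lemma conic_combination_drop_one:
  fixes g :: "nat \<Rightarrow> 'i \<Rightarrow> real"
  assumes I: "finite I" "card I \<le> n"
    and G: "\<forall>j<Suc n. g j \<in> G"
    and scale: "\<And>g t. g \<in> G \<Longrightarrow> 0 \<le> t \<Longrightarrow> (\<lambda>ix. t * g ix) \<in> G"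
  shows "\<exists>h. (\<forall>j<n. h j \<in> G) \<and> (\<forall>ix\<in>I. (\<Sum>j<Suc n. g j ix) = (\<Sum>j<n. h j ix))"
proof -
  obtain e where e: "bij_betw e {0..<card I} I" using ex_bij_betw_nat_finite[OF I(1)] by auto
  obtain c0 where c0: "\<exists>j<Suc n. c0 j \<noteq> 0"
    and z0: "\<forall>i<card I. (\<Sum>j<Suc n. g j (e i) * c0 j) = 0"
    using homogeneous_system_nontrivial[of "card I" "Suc n" "\<lambda>i j. g j (e i)"] I(2)
    by (metis le_imp_less_Suc)
  have z0': "(\<Sum>j<Suc n. g j ix * c0 j) = 0" if "ix \<in> I" for ix
  proof -
    have "ix \<in> e ` {0..<card I}" using bij_betw_imp_surj_on[OF e] that by simp
    then obtain i where "i < card I" "ix = e i" by auto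
    thus ?thesis using z0 by blast
  qed
  have "\<exists>c. (\<exists>j<Suc n. (0::real) < c j) \<and> (\<forall>ix\<in>I. (\<Sum>j<Suc n. g j ix * c j) = 0)"
  proof (cases "\<exists>j<Suc n. c0 j > 0")
    case True thus ?thesis using z0' by blast
  next
    case False
    then obtain j where "j < Suc n" "- c0 j > 0" using c0 by (metis neg_0_less_iff_less linorder_neqE_linordered_idom)
    moreover have "\<forall>ix\<in>I. (\<Sum>j<Suc n. g j ix * (- c0 j)) = 0"
      using z0' by (simp only: mult_minus_right sum_negf neg_equal_0_iff_equal) blast
    ultimately show ?thesis by (intro exI[of _ "\<lambda>j. - c0 j"]) blast
  qed
  then obtain c where c: "\<exists>j<Suc n. (0::real) < c j"
    and z: "\<And>ix. ix \<in> I \<Longrightarrow> (\<Sum>j<Suc n. g j ix * c j) = 0" by blast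
  define cm where "cm = Max (c ` {..<Suc n})"
  have "cm \<in> c ` {..<Suc n}" unfolding cm_def by (intro Max_in) auto
  then obtain j0 where j0: "j0 < Suc n" "c j0 = cm" by auto
  have cm: "c j \<le> cm" if "j < Suc n" for j unfolding cm_def using that by (intro Max_ge) auto
  have cm0: "cm > 0" using c cm by (meson less_le_trans)
  \<comment> \<open>Dividing by the largest coefficient \<open>cm\<close> keeps every \<open>s j\<close> nonnegative and kills the one at \<open>j0\<close>.\<close>
  define s where "s j = 1 - c j / cm" for j
  have s: "s j \<ge> 0" if "j < Suc n" for j using cm[OF that] cm0 by (simp add: s_def field_simps)
  have s0: "s j0 = 0" using j0 cm0 by (simp add: s_def)
  define f where "f j = (\<lambda>ix. s j * g j ix)" for j
  \<comment> \<open>The last generator moves into the place that has become free.\<close>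
  define h where "h j = (if j = j0 then f n else f j)" for j
  have f: "f j \<in> G" if "j < Suc n" for j unfolding f_def using scale G s that by blast
  have "\<forall>j<n. h j \<in> G" using f by (simp add: h_def)
  moreover have "(\<Sum>j<Suc n. g j ix) = (\<Sum>j<n. h j ix)" if "ix \<in> I" for ix
  proof -
    have "(\<Sum>j<Suc n. f j ix) = (\<Sum>j<Suc n. g j ix - g j ix * c j / cm)"
      by (intro sum.cong refl) (simp add: f_def s_def algebra_simps)
    also have "\<dots> = (\<Sum>j<Suc n. g j ix) - (\<Sum>j<Suc n. g j ix * c j) / cm"
      unfolding sum_subtractf sum_divide_distrib ..
    finally have 1: "(\<Sum>j<Suc n. g j ix) = (\<Sum>j<Suc n. f j ix)" using z[OF that] by simp
    have fj0: "f j0 ix = 0" by (simp add: f_def s0)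
    have "(\<Sum>j<Suc n. f j ix) = (\<Sum>j<n. h j ix)"
    proof (cases "j0 = n")
      case True
      have "(\<Sum>j<n. f j ix) = (\<Sum>j<n. h j ix)" using True by (intro sum.cong) (auto simp: h_def)
      thus ?thesis using True fj0 by simp
    next
      case False
      hence j: "j0 \<in> {..<n}" using j0 by auto
      have "(\<Sum>j<n. f j ix) = f j0 ix + (\<Sum>j\<in>{..<n} - {j0}. f j ix)" using j by (intro sum.remove) auto
      moreover have "(\<Sum>j<n. h j ix) = h j0 ix + (\<Sum>j\<in>{..<n} - {j0}. h j ix)" using j by (intro sum.remove) auto
      moreover have "(\<Sum>j\<in>{..<n} - {j0}. h j ix) = (\<Sum>j\<in>{..<n} - {j0}. f j ix)"
        by (intro sum.cong) (auto simp: h_def)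
      ultimately show ?thesis using fj0 by (simp add: h_def)
    qed
    with 1 show ?thesis by simp
  qed
  ultimately show ?thesis by blast
qed

text \<open>
  Conic combinations of any length can be written with \<open>card I\<close> terms, so that a sequence of them can be
  treated as a sequence in a space of fixed finite dimension.
\<close>

lemma caratheodory_cone:
  fixes g :: "nat \<Rightarrow> 'i \<Rightarrow> real"
  assumes I: "finite I" and ne: "G \<noteq> {}"
    and scale: "\<And>g t. g \<in> G \<Longrightarrow> 0 \<le> t \<Longrightarrow> (\<lambda>ix. t * g ix) \<in> G"
    and G: "\<forall>j<n. g j \<in> G"
  shows "\<exists>h. (\<forall>j<card I. h j \<in> G) \<and> (\<forall>ix\<in>I. (\<Sum>j<n. g j ix) = (\<Sum>j<card I. h j ix))"
  using G
proof (induction n arbitrary: g)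
  case 0
  obtain g0 where "g0 \<in> G" using ne by blast
  from scale[OF this, of 0] show ?case by (intro exI[of _ "\<lambda>_ _. 0"]) simp
next
  case (Suc n)
  show ?case
  proof (cases "card I \<le> n")
    case True
    obtain g' where g': "\<forall>j<n. g' j \<in> G" "\<forall>ix\<in>I. (\<Sum>j<Suc n. g j ix) = (\<Sum>j<n. g' j ix)"
      using conic_combination_drop_one[OF I True Suc.prems scale] by blast
    from Suc.IH[OF g'(1)] g'(2) show ?thesis by auto
  next
    case False
    obtain g0 where "g0 \<in> G" using ne by blast
    from scale[OF this, of 0] have z: "(\<lambda>_. 0) \<in> G" by simp
    define h where "h j = (if j < Suc n then g j else (\<lambda>_. 0))" for j
    have "(\<Sum>j<card I. h j ix) = (\<Sum>j<Suc n. g j ix)" for ix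
      by (rule sum.mono_neutral_cong_right) (use False in \<open>auto simp: h_def\<close>)
    moreover have "\<forall>j<card I. h j \<in> G" using Suc.prems z by (simp add: h_def)
    ultimately show ?thesis by metis
  qed
qed

lemma bounded_family_convergent_subsequence:
  fixes f :: "nat \<Rightarrow> 'i \<Rightarrow> real"
  assumes "finite I" "\<And>n ix. ix \<in> I \<Longrightarrow> \<bar>f n ix\<bar> \<le> B"
  shows "\<exists>r l. strict_mono (r :: nat \<Rightarrow> nat) \<and> (\<forall>ix\<in>I. (\<lambda>n. f (r n) ix) \<longlonglongrightarrow> l ix)"
  using assms
proof (induction I rule: finite_induct)
  case empty
  show ?case by (intro exI[of _ id]) (auto simp: strict_mono_def)
next
  case (insert a I)
  obtain r l where r: "strict_mono r" and l: "\<forall>ix\<in>I. (\<lambda>n. f (r n) ix) \<longlonglongrightarrow> l ix"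
    using insert.IH insert.prems by auto
  obtain q where q: "strict_mono q" "monoseq (\<lambda>n. f (r (q n)) a)"
    using seq_monosub[of "\<lambda>n. f (r n) a"] by auto
  have "Bseq (\<lambda>n. f (r (q n)) a)" using insert.prems by (intro BseqI'[of _ B]) simp
  hence "convergent (\<lambda>n. f (r (q n)) a)" using q(2) by (rule Bseq_monoseq_convergent)
  then obtain la where la: "(\<lambda>n. f (r (q n)) a) \<longlonglongrightarrow> la" by (auto simp: convergent_def)
  have "strict_mono (r \<circ> q)" using r q(1) by (rule strict_mono_o)
  moreover have "(\<lambda>n. f ((r \<circ> q) n) ix) \<longlonglongrightarrow> (l(a := la)) ix" if "ix \<in> insert a I" for ix
  proof (cases "ix = a")
    case True thus ?thesis using la by simp
  next
    case False
    hence "((\<lambda>n. f (r n) ix) \<circ> q) \<longlonglongrightarrow> l ix"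
      using l that q(1) by (intro LIMSEQ_subseq_LIMSEQ) auto
    thus ?thesis using False by (simp add: o_def)
  qed
  ultimately show ?case by blast
qed

text \<open>
  The one-sided derivative at a minimum is nonnegative.
\<close>

lemma nonneg_slope:
  fixes a b :: real
  assumes "\<And>t. 0 < t \<Longrightarrow> t \<le> 1 \<Longrightarrow> 0 \<le> 2 * t * a + t\<^sup>2 * b" "0 \<le> b"
  shows "0 \<le> a"
proof (rule ccontr)
  assume "\<not> 0 \<le> a"
  hence a: "a < 0" by simp
  \<comment> \<open>A step so short that the quadratic term stays below half of the linear one, and at most \<open>1\<close>.\<close>
  define t where "t = - a / (b - a + 1)"
  have p: "b - a + 1 > 0" using a assms(2) by simp
  have t: "0 < t" "t \<le> 1" using a p assms(2) by (auto simp: t_def field_simps)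
  have "t * b < - a"
    using a p assms(2) mult_strict_left_mono_neg[OF _ a, of b "b - a + 1"] by (simp add: t_def field_simps)
  hence "t * (2 * a + t * b) < 0" using a t by (intro mult_pos_neg) auto
  moreover have "0 \<le> t * (2 * a + t * b)" using assms(1)[OF t] by (simp add: power2_eq_square algebra_simps)
  ultimately show False by simp
qed

text \<open>
  The cone generated by a closed set of rays is closed if its elements are bounded by a linear functional,
  here the sum over \<open>D\<close>: the summands of a bounded conic combination are then bounded one by one,
  and by the bound on their number a minimizing sequence has a subsequence along which each summand converges.
\<close>

lemma closed_cone_nearest_point:
  fixes G :: "('i \<Rightarrow> real) set" and x :: "'i \<Rightarrow> real"
  assumes I: "finite I" "D \<subseteq> I" and ne: "G \<noteq> {}"
    and scale: "\<And>g t. g \<in> G \<Longrightarrow> 0 \<le> t \<Longrightarrow> (\<lambda>ix. t * g ix) \<in> G"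
    and bound: "\<And>g ix. g \<in> G \<Longrightarrow> ix \<in> I \<Longrightarrow> \<bar>g ix\<bar> \<le> (\<Sum>\<kappa>\<in>D. g \<kappa>)"
    and clos: "\<And>g l. \<forall>n. g n \<in> G \<Longrightarrow> \<forall>ix\<in>I. (\<lambda>n. g n ix) \<longlonglongrightarrow> l ix \<Longrightarrow> \<exists>h\<in>G. \<forall>ix\<in>I. h ix = l ix"
  shows "\<exists>(m::nat) h. (\<forall>j<m. h j \<in> G) \<and>
    (\<forall>n g. (\<forall>j<n. g j \<in> G) \<longrightarrow>
       (\<Sum>ix\<in>I. (x ix - (\<Sum>j<m. h j ix))\<^sup>2) \<le> (\<Sum>ix\<in>I. (x ix - (\<Sum>j<n::nat. g j ix))\<^sup>2))"
proof -
  define N where "N = card I"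
  define F where "F n g = (\<Sum>ix\<in>I. (x ix - (\<Sum>j<n. g j ix))\<^sup>2)" for n :: nat and g
  define S where "S = {F n g | n g. \<forall>j<n. g j \<in> G}"
  have S0: "0 \<le> s" if "s \<in> S" for s using that by (auto simp: S_def F_def sum_nonneg)
  hence bb: "bdd_below S" by (auto simp: bdd_below_def)
  have Sne: "S \<noteq> {}" unfolding S_def by (auto intro!: exI[of _ 0])
  define \<delta> where "\<delta> = Inf S"
  have "\<exists>h. (\<forall>j<N. h j \<in> G) \<and> F N h < \<delta> + inverse (real (Suc k))" for k
  proof -
    have "\<exists>s\<in>S. s < \<delta> + inverse (real (Suc k))"
      using Sne bb unfolding \<delta>_def by (intro cInf_lessD) (auto simp del: of_nat_Suc)
    then obtain n g where g: "\<forall>j<n. g j \<in> G" "F n g < \<delta> + inverse (real (Suc k))" by (auto simp: S_def)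
    obtain h where h: "\<forall>j<N. h j \<in> G" "\<forall>ix\<in>I. (\<Sum>j<n. g j ix) = (\<Sum>j<N. h j ix)"
      using caratheodory_cone[OF I(1) ne scale g(1)] unfolding N_def by blast
    have "F N h = F n g" unfolding F_def using h(2) by (intro sum.cong) auto
    with h g show ?thesis by auto
  qed
  then obtain h where h: "\<And>k j. j < N \<Longrightarrow> h k j \<in> G" and Fh: "\<And>k. F N (h k) < \<delta> + inverse (real (Suc k))"
    by metis
  \<comment> \<open>A bound for all entries of the minimizing sequence, from \<open>\<bar>y\<bar> \<le> 1 + y\<^sup>2\<close> for the distance \<open>y\<close> in each coordinate.\<close>
  define B where "B = (\<Sum>\<kappa>\<in>D. \<bar>x \<kappa>\<bar> + (1 + (\<delta> + 1)))"
  have finD: "finite D" using I finite_subset by auto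
  have hB: "\<bar>h k j ix\<bar> \<le> B" if "j < N" "ix \<in> I" for k j ix
  proof -
    have pos: "0 \<le> (\<Sum>\<kappa>\<in>D. h k j' \<kappa>)" if "j' < N" for j'
      using bound[OF h[OF that, of k] \<open>ix \<in> I\<close>] by linarith
    have "\<bar>h k j ix\<bar> \<le> (\<Sum>\<kappa>\<in>D. h k j \<kappa>)" using bound h that by blast
    also have "\<dots> \<le> (\<Sum>j<N. \<Sum>\<kappa>\<in>D. h k j \<kappa>)" using that pos
      by (intro member_le_sum[of j "{..<N}" "\<lambda>j. \<Sum>\<kappa>\<in>D. h k j \<kappa>"]) auto
    also have "\<dots> = (\<Sum>\<kappa>\<in>D. \<Sum>j<N. h k j \<kappa>)" by (rule sum.swap)
    also have "\<dots> \<le> B" unfolding B_def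
    proof (rule sum_mono)
      fix \<kappa> assume \<kappa>: "\<kappa> \<in> D"
      define y where "y = x \<kappa> - (\<Sum>j<N. h k j \<kappa>)"
      have "y\<^sup>2 \<le> F N (h k)" unfolding F_def y_def
        using \<kappa> I by (intro member_le_sum) auto
      also have "\<dots> \<le> \<delta> + inverse (real (Suc k))" using Fh[of k] by simp
      also have "\<dots> \<le> \<delta> + 1" by (simp add: field_simps)
      finally have "y\<^sup>2 \<le> \<delta> + 1" .
      moreover have "\<bar>y\<bar> \<le> 1 + y\<^sup>2"
      proof -
        have "0 \<le> (\<bar>y\<bar> - 1)\<^sup>2" by simp
        hence "2 * \<bar>y\<bar> \<le> 1 + y\<^sup>2" by (simp add: power2_diff)
        thus ?thesis by simp
      qed
      ultimately show "(\<Sum>j<N. h k j \<kappa>) \<le> \<bar>x \<kappa>\<bar> + (1 + (\<delta> + 1))" unfolding y_def by linarith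
    qed
    finally show ?thesis .
  qed
  obtain r l where r: "strict_mono r"
    and l: "\<forall>p\<in>{..<N} \<times> I. (\<lambda>n. h (r n) (fst p) (snd p)) \<longlonglongrightarrow> l p"
    using bounded_family_convergent_subsequence[of "{..<N} \<times> I" "\<lambda>n p. h n (fst p) (snd p)" B] I hB
    by auto
  have l': "(\<lambda>n. h (r n) j ix) \<longlonglongrightarrow> l (j, ix)" if "j < N" "ix \<in> I" for j ix
    using l that by fastforce
  have "\<exists>g\<in>G. \<forall>ix\<in>I. g ix = l (j, ix)" if "j < N" for j
    using that h l' by (intro clos[of "\<lambda>n. h (r n) j"]) auto
  then obtain z where z: "\<And>j. j < N \<Longrightarrow> z j \<in> G" "\<And>j ix. j < N \<Longrightarrow> ix \<in> I \<Longrightarrow> z j ix = l (j, ix)" by metis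
  have "(\<lambda>n. F N (h (r n))) \<longlonglongrightarrow> F N z" unfolding F_def
    using l' z(2) by (intro tendsto_intros) auto
  moreover have "F N (h (r n)) \<le> \<delta> + inverse (real (Suc n))" for n
  proof -
    have "inverse (real (Suc (r n))) \<le> inverse (real (Suc n))"
      using seq_suble[OF r, of n] by (simp add: field_simps)
    thus ?thesis using Fh[of "r n"] by linarith
  qed
  moreover have "(\<lambda>n. \<delta> + inverse (real (Suc n))) \<longlonglongrightarrow> \<delta> + 0"
    by (intro tendsto_intros LIMSEQ_inverse_real_of_nat)
  ultimately have "F N z \<le> \<delta> + 0" by (intro LIMSEQ_le[of "\<lambda>n. F N (h (r n))"]) auto
  hence Fz: "F N z \<le> \<delta>" by simp
  have \<delta>: "\<delta> \<le> F n g" if "\<forall>j<n. g j \<in> G" for n g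
  proof -
    have "F n g \<in> S" unfolding S_def using that by blast
    thus ?thesis unfolding \<delta>_def using bb by (rule cInf_lower)
  qed
  have "F N z \<le> F n g" if "\<forall>j<n. g j \<in> G" for n g using Fz \<delta>[OF that] by linarith
  with z(1) show ?thesis unfolding F_def by (intro exI[of _ N] exI[of _ z]) simp
qed

text \<open>
  Hahn--Banach for such cones. With the nearest point \<open>z\<close> of the cone, the functional is \<open>w = z - x\<close>: moving
  from \<open>z\<close> towards a generator or towards \<open>0\<close> does not decrease the distance to \<open>x\<close>.
\<close>

theorem closed_cone_separation:
  fixes G :: "('i \<Rightarrow> real) set" and x :: "'i \<Rightarrow> real"
  assumes I: "finite I" "D \<subseteq> I" and ne: "G \<noteq> {}"
    and scale: "\<And>g t. g \<in> G \<Longrightarrow> 0 \<le> t \<Longrightarrow> (\<lambda>ix. t * g ix) \<in> G"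
    and bound: "\<And>g ix. g \<in> G \<Longrightarrow> ix \<in> I \<Longrightarrow> \<bar>g ix\<bar> \<le> (\<Sum>\<kappa>\<in>D. g \<kappa>)"
    and clos: "\<And>g l. \<forall>n. g n \<in> G \<Longrightarrow> \<forall>ix\<in>I. (\<lambda>n. g n ix) \<longlonglongrightarrow> l ix \<Longrightarrow> \<exists>h\<in>G. \<forall>ix\<in>I. h ix = l ix"
    and x: "\<not> (\<exists>(n::nat) g. (\<forall>j<n. g j \<in> G) \<and> (\<forall>ix\<in>I. x ix = (\<Sum>j<n. g j ix)))"
  shows "\<exists>w. (\<forall>g\<in>G. 0 \<le> (\<Sum>ix\<in>I. w ix * g ix)) \<and> (\<Sum>ix\<in>I. w ix * x ix) < 0"
proof -
  have "\<exists>(m::nat) h. (\<forall>j<m. h j \<in> G) \<and> (\<forall>n g. (\<forall>j<n. g j \<in> G) \<longrightarrow>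
       (\<Sum>ix\<in>I. (x ix - (\<Sum>j<m. h j ix))\<^sup>2) \<le> (\<Sum>ix\<in>I. (x ix - (\<Sum>j<n::nat. g j ix))\<^sup>2))"
    by (rule closed_cone_nearest_point[OF I ne]) (fact scale bound clos)+
  then obtain m :: nat and h where mh: "(\<forall>j<m. h j \<in> G) \<and> (\<forall>n g. (\<forall>j<n. g j \<in> G) \<longrightarrow>
       (\<Sum>ix\<in>I. (x ix - (\<Sum>j<m. h j ix))\<^sup>2) \<le> (\<Sum>ix\<in>I. (x ix - (\<Sum>j<n::nat. g j ix))\<^sup>2))"
    by (elim exE)
  note h = mh[THEN conjunct1] and min = mh[THEN conjunct2, THEN spec, THEN spec, THEN mp]
  define z where "z ix = (\<Sum>j<m. h j ix)" for ix
  define w where "w ix = z ix - x ix" for ix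
  define ip where "ip f g = (\<Sum>ix\<in>I. f ix * g ix :: real)" for f g
  have expand: "(\<Sum>ix\<in>I. (x ix - (z ix + t * y ix))\<^sup>2) = ip w w + (2 * t * ip w y + t\<^sup>2 * ip y y)" for t y
    unfolding ip_def w_def sum_distrib_left sum.distrib[symmetric]
    by (intro sum.cong refl) (simp add: power2_eq_square algebra_simps)
  have ww: "(\<Sum>ix\<in>I. (x ix - (\<Sum>j<m. h j ix))\<^sup>2) = ip w w"
    using expand[of 0] by (simp add: z_def)
  have sq: "0 \<le> ip y y" for y unfolding ip_def by (intro sum_nonneg) auto
  have "0 \<le> ip w g" if g: "g \<in> G" for g
  proof (rule nonneg_slope[OF _ sq])
    fix t :: real assume t: "0 < t" "t \<le> 1"
    define h' where "h' = h(m := (\<lambda>ix. t * g ix))"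
    have "(\<lambda>ix. t * g ix) \<in> G" using scale[OF g, of t] t by simp
    hence h': "\<forall>j<Suc m. h' j \<in> G" using h by (simp add: h'_def less_Suc_eq)
    have "(\<Sum>j<Suc m. h' j ix) = z ix + t * g ix" for ix by (simp add: h'_def z_def)
    hence "ip w w \<le> (\<Sum>ix\<in>I. (x ix - (z ix + t * g ix))\<^sup>2)"
      using min[OF h'] ww by simp
    thus "0 \<le> 2 * t * ip w g + t\<^sup>2 * ip g g" using expand[of t g] by simp
  qed
  moreover have "0 \<le> - ip w z"
  proof (rule nonneg_slope[OF _ sq])
    fix t :: real assume t: "0 < t" "t \<le> 1"
    have h': "\<forall>j<m. (\<lambda>ix. (1 - t) * h j ix) \<in> G" using h scale[of _ "1 - t"] t by simp
    have "(\<Sum>j<m. (1 - t) * h j ix) = z ix + (- t) * z ix" for ix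
      unfolding z_def sum_distrib_left[symmetric] by (simp add: algebra_simps)
    hence "ip w w \<le> (\<Sum>ix\<in>I. (x ix - (z ix + (- t) * z ix))\<^sup>2)"
      using min[OF h'] ww by simp
    thus "0 \<le> 2 * t * - ip w z + t\<^sup>2 * ip z z" using expand[of "- t" z] by simp
  qed
  moreover have "ip w w > 0"
  proof -
    have "\<not> (\<forall>ix\<in>I. x ix = z ix)" using x h unfolding z_def by blast
    then obtain ix where "ix \<in> I" "w ix \<noteq> 0" unfolding w_def by auto
    thus ?thesis unfolding ip_def using I(1) by (intro sum_pos2[of I ix]) (auto simp: zero_less_mult_iff)
  qed
  moreover have "ip w x = ip w z - ip w w"
    unfolding ip_def w_def sum_subtractf[symmetric] by (intro sum.cong) (auto simp: algebra_simps)
  ultimately show ?thesis unfolding ip_def by (intro exI[of _ w]) auto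
qed

section \<open>Positive semidefinite matrices as Gram matrices\<close>

lemma quadratic_form_eq:
  assumes "A \<in> carrier_mat d d" "v \<in> carrier_vec d"
  shows "(A *\<^sub>v v) \<bullet>c v = (\<Sum>i<d. \<Sum>j<d. cnj (v $ i) * A $$ (i, j) * v $ j)"
  using assms
  by (auto simp: scalar_prod_def atLeast0LessThan sum_distrib_right sum_distrib_left algebra_simps
      intro!: sum.cong)

lemma psd_iff_quadratic_form:
  "psd d A \<longleftrightarrow> A \<in> carrier_mat d d \<and>
     (\<forall>f. 0 \<le> (\<Sum>i<d. \<Sum>j<d. cnj (f i) * A $$ (i, j) * f j))"
proof -
  have "(\<forall>v\<in>carrier_vec d. 0 \<le> (A *\<^sub>v v) \<bullet>c v) \<longleftrightarrow>
      (\<forall>f. 0 \<le> (\<Sum>i<d. \<Sum>j<d. cnj (f i) * A $$ (i, j) * f j))" if A: "A \<in> carrier_mat d d"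
  proof (intro iffI allI ballI)
    fix f :: "nat \<Rightarrow> complex"
    assume "\<forall>v\<in>carrier_vec d. 0 \<le> (A *\<^sub>v v) \<bullet>c v"
    from this[rule_format, of "vec d f"] show "0 \<le> (\<Sum>i<d. \<Sum>j<d. cnj (f i) * A $$ (i, j) * f j)"
      unfolding quadratic_form_eq[OF A vec_carrier] by simp
  next
    fix v :: "complex vec"
    assume "\<forall>f. 0 \<le> (\<Sum>i<d. \<Sum>j<d. cnj (f i) * A $$ (i, j) * f j)" "v \<in> carrier_vec d"
    thus "0 \<le> (A *\<^sub>v v) \<bullet>c v" unfolding quadratic_form_eq[OF A \<open>v \<in> carrier_vec d\<close>] by blast
  qed
  thus ?thesis unfolding psd_def by blast
qed

lemma psd_carrier: "psd d A \<Longrightarrow> A \<in> carrier_mat d d"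
  by (simp add: psd_def)

text \<open>
  Polarization: the quadratic form is real at \<open>e\<^sub>i + e\<^sub>j\<close> and at \<open>e\<^sub>i + \<i> e\<^sub>j\<close>.
\<close>

lemma psd_hermitian:
  assumes "psd d A"
  shows "hermitian_fun d (\<lambda>i j. A $$ (i, j))"
  unfolding hermitian_fun_def
proof (intro allI impI)
  fix i j assume ij: "i < d" "j < d"
  define B where "B = (\<lambda>k l. A $$ (k, l))"
  have q: "Im (\<Sum>k<d. \<Sum>l<d. cnj (f k) * B k l * f l) = 0" for f
    using assms unfolding psd_iff_quadratic_form B_def by (auto simp: less_eq_complex_def)
  have delta: "(\<Sum>k<d. \<Sum>l<d. (if k = a then x else 0) * B k l * (if l = b then y else 0)) = x * B a b * y"
    if "a < d" "b < d" for a b x y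
  proof -
    have "(\<Sum>k<d. \<Sum>l<d. (if k = a then x else 0) * B k l * (if l = b then y else 0))
        = (\<Sum>k<d. if k = a then x * B a b * y else 0)"
    proof (intro sum.cong refl)
      fix k
      have "(\<Sum>l<d. (if k = a then x else 0) * B k l * (if l = b then y else 0))
          = (\<Sum>l<d. if l = b then (if k = a then x * B a b * y else 0) else 0)"
        by (intro sum.cong) auto
      thus "(\<Sum>l<d. (if k = a then x else 0) * B k l * (if l = b then y else 0))
          = (if k = a then x * B a b * y else 0)" using that by simp
    qed
    thus ?thesis using that by simp
  qed
  have eq: "Im (B i i + c * B i j + cnj c * B j i + cnj c * B j j * c) = 0" for c
  proof -
    let ?u = "\<lambda>k. if k = i then 1 else 0" and ?v = "\<lambda>k. if k = j then c else 0"
    let ?v' = "\<lambda>k. if k = j then cnj c else 0"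
    have "(\<Sum>k<d. \<Sum>l<d. cnj (?u k + ?v k) * B k l * (?u l + ?v l))
       = (\<Sum>k<d. \<Sum>l<d. ?u k * B k l * ?u l + ?u k * B k l * ?v l + (?v' k * B k l * ?u l + ?v' k * B k l * ?v l))"
      by (intro sum.cong refl) (simp add: distrib_left distrib_right)
    also have "\<dots> = B i i + c * B i j + (cnj c * B j i + cnj c * B j j * c)"
      unfolding sum.distrib using ij by (simp only: delta) (simp add: mult.commute)
    finally show ?thesis using q[of "\<lambda>k. ?u k + ?v k"] by (simp add: add.assoc)
  qed
  have ii: "Im (B i i) = 0" using eq[of 0] by simp
  have "Im (B j j) = 0 " 
    using q[of "\<lambda>k. if k = j then 1 else 0"] delta[OF ij(2) ij(2), of 1 1] 
    by (simp add: if_distrib[of cnj] cong: if_cong)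
  hence "Im (B i j) = - Im (B j i)" "Re (B i j) = Re (B j i)"
    using eq[of 1] eq[of "\<i>"] ii by auto
  thus "A $$ (j, i) = cnj (A $$ (i, j))" by (simp add: complex_eq_iff B_def)
qed

lemma psd_gramI:
  assumes "A \<in> carrier_mat d d"
    and "\<And>i j. i < d \<Longrightarrow> j < d \<Longrightarrow> A $$ (i, j) = (\<Sum>n\<in>N. w n i * cnj (w n j))"
  shows "psd d A"
proof -
  have "0 \<le> (\<Sum>i<d. \<Sum>j<d. cnj (f i) * A $$ (i, j) * f j)" for f
  proof -
    have "(\<Sum>i<d. \<Sum>j<d. cnj (f i) * A $$ (i, j) * f j)
        = (\<Sum>i<d. \<Sum>j<d. \<Sum>n\<in>N. cnj (f i) * w n i * cnj (cnj (f j) * w n j))"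
      using assms(2) by (intro sum.cong refl) (simp add: sum_distrib_left sum_distrib_right algebra_simps)
    also have "\<dots> = (\<Sum>i<d. \<Sum>n\<in>N. \<Sum>j<d. cnj (f i) * w n i * cnj (cnj (f j) * w n j))"
      by (intro sum.cong refl sum.swap)
    also have "\<dots> = (\<Sum>n\<in>N. \<Sum>i<d. \<Sum>j<d. cnj (f i) * w n i * cnj (cnj (f j) * w n j))"
      by (rule sum.swap)
    also have "\<dots> = (\<Sum>n\<in>N. (\<Sum>i<d. cnj (f i) * w n i) * cnj (\<Sum>i<d. cnj (f i) * w n i))"
      by (simp add: sum_product)
    also have "\<dots> = of_real (\<Sum>n\<in>N. (cmod (\<Sum>i<d. cnj (f i) * w n i))\<^sup>2)"
      unfolding of_real_sum by (intro sum.cong refl) (simp only: complex_norm_square)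
    finally show ?thesis by (simp add: sum_nonneg less_eq_complex_def)
  qed
  thus ?thesis using assms(1) unfolding psd_iff_quadratic_form by blast
qed

text \<open>
  The Gram vectors are the eigenvectors, scaled by the square roots of the eigenvalues. Gram matrices
  make all later positivity statements stable under linear operations on the vectors.
\<close>

lemma psd_gramE:
  assumes "psd d A"
  obtains w :: "nat \<Rightarrow> nat \<Rightarrow> complex"
  where "\<And>i j. i < d \<Longrightarrow> j < d \<Longrightarrow> A $$ (i, j) = (\<Sum>n<d. w n i * cnj (w n j))"
proof -
  obtain v lam where v: "orthonormal_family d d v"
    and ev: "\<forall>i<d. \<forall>r<d. (\<Sum>s<d. A $$ (r, s) * v i s) = of_real (lam i) * v i r"
    using hermitian_eigenbasis[OF psd_hermitian[OF assms]] by auto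
  have lam: "0 \<le> lam i" if "i < d" for i
  proof -
    have "(\<Sum>r<d. \<Sum>s<d. cnj (v i r) * A $$ (r, s) * v i s) = (\<Sum>r<d. cnj (v i r) * (\<Sum>s<d. A $$ (r, s) * v i s))"
      by (simp add: sum_distrib_left mult.assoc)
    also have "\<dots> = (\<Sum>r<d. of_real (lam i) * (v i r * cnj (v i r)))"
      using ev that by (intro sum.cong refl) (simp add: algebra_simps)
    also have "\<dots> = of_real (lam i)"
      using v that unfolding sum_distrib_left[symmetric] by (simp add: orthonormal_family_def cinner_def)
    finally have "(\<Sum>r<d. \<Sum>s<d. cnj (v i r) * A $$ (r, s) * v i s) = of_real (lam i)" .
    moreover have "0 \<le> (\<Sum>r<d. \<Sum>s<d. cnj (v i r) * A $$ (r, s) * v i s)"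
      using assms unfolding psd_iff_quadratic_form by blast
    ultimately show ?thesis by (simp add: less_eq_complex_def)
  qed
  define w where "w n i = of_real (sqrt (lam n)) * v n i" for n i
  have "A $$ (i, j) = (\<Sum>n<d. w n i * cnj (w n j))" if "i < d" "j < d" for i j
  proof -
    have "A $$ (i, j) = (\<Sum>n<d. of_real (lam n) * v n i * cnj (v n j))"
      by (rule spectral_decomposition[OF v ev that(1) that(2)])
    also have "\<dots> = (\<Sum>n<d. w n i * cnj (w n j))"
    proof (intro sum.cong refl)
      fix n assume "n \<in> {..<d}"
      hence "of_real (lam n) = (of_real (sqrt (lam n)) * of_real (sqrt (lam n)) :: complex)"
        using lam by (simp flip: of_real_mult)
      thus "of_real (lam n) * v n i * cnj (v n j) = w n i * cnj (w n j)" by (simp add: w_def algebra_simps)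
    qed
    finally show ?thesis .
  qed
  thus ?thesis by (rule that)
qed

lemma psd_gram_ex:
  assumes "psd d A"
  shows "\<exists>w::nat \<Rightarrow> nat \<Rightarrow> complex. \<forall>i<d. \<forall>j<d. A $$ (i, j) = (\<Sum>n<d. w n i * cnj (w n j))"
  by (rule psd_gramE[OF assms]) blast

lemma mat_sum_carrier [simp]: "mat_sum nr nc A I \<in> carrier_mat nr nc"
  by (simp add: mat_sum_def)

lemma mat_sum_index [simp]: "r < nr \<Longrightarrow> c < nc \<Longrightarrow> mat_sum nr nc A I $$ (r, c) = (\<Sum>i\<in>I. A i $$ (r, c))"
  by (simp add: mat_sum_def)

lemma mat_sum_dim [simp]: "dim_row (mat_sum nr nc A I) = nr" "dim_col (mat_sum nr nc A I) = nc"
  by (simp_all add: mat_sum_def)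

lemma mat_sum_cong: "(\<And>i. i \<in> I \<Longrightarrow> A i = B i) \<Longrightarrow> mat_sum nr nc A I = mat_sum nr nc B I"
  by (intro eq_matI) auto

lemma outer_carrier: "x \<in> carrier_vec n \<Longrightarrow> y \<in> carrier_vec m \<Longrightarrow> outer x y \<in> carrier_mat n m"
  by (simp add: outer_def)

lemma outer_index: "x \<in> carrier_vec n \<Longrightarrow> y \<in> carrier_vec m \<Longrightarrow> i < n \<Longrightarrow> j < m \<Longrightarrow>
   outer x y $$ (i, j) = x $ i * cnj (y $ j)"
  by (simp add: outer_def)

lemma psd_outer: "x \<in> carrier_vec n \<Longrightarrow> psd n (outer x x)"
  by (rule psd_gramI[where N = "{()}" and w = "\<lambda>_ i. x $ i"]) (simp_all add: outer_carrier outer_index)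

lemma psd_eq_sum_outer:
  assumes "psd d A"
  shows "\<exists>\<xi>. (\<forall>i<d. \<xi> i \<in> carrier_vec d) \<and> A = mat_sum d d (\<lambda>i. outer (\<xi> i) (\<xi> i)) {..<d}"
proof -
  obtain w where w: "\<And>i j. i < d \<Longrightarrow> j < d \<Longrightarrow> A $$ (i, j) = (\<Sum>n<d. w n i * cnj (w n j))"
    using psd_gramE[OF assms] by blast
  have "A = mat_sum d d (\<lambda>n. outer (vec d (w n)) (vec d (w n))) {..<d}"
    using psd_carrier[OF assms] w
    by (intro eq_matI) (auto simp: outer_index[OF vec_carrier vec_carrier])
  thus ?thesis by (intro exI[of _ "\<lambda>n. vec d (w n)"]) simp
qed

section \<open>Block matrices\<close>

lemma sum_blocks: "(\<Sum>i<m * d. f i) = (\<Sum>p<m. \<Sum>r<d. f (p * d + r :: nat))"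
proof -
  have "(\<Sum>i<m * d. f i) = (\<Sum>p<m. sum f {p * d..<p * d + d})" by (rule sum.nat_group[symmetric])
  also have "\<dots> = (\<Sum>p<m. \<Sum>r<d. f (p * d + r))"
  proof (rule sum.cong[OF refl])
    fix p show "sum f {p * d..<p * d + d} = (\<Sum>r<d. f (p * d + r))"
      using sum.shift_bounds_nat_ivl[of f 0 "p * d" d] by (simp add: atLeast0LessThan add.commute)
  qed
  finally show ?thesis .
qed

lemma block_cases:
  fixes i m d :: nat
  assumes "i < m * d"
  obtains p r where "p < m" "r < d" "i = p * d + r"
proof (rule that)
  have "0 < d" using assms by (cases d) auto
  thus "i mod d < d" by (rule mod_less_divisor)
  show "i div d < m" using assms by (rule less_mult_imp_div_less)
  show "i = i div d * d + i mod d" by (rule div_mult_mod_eq[symmetric])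
qed

lemma block_eqI:
  assumes "A \<in> carrier_mat (m * d) (m * d)" "B \<in> carrier_mat (m * d) (m * d)"
    and "\<And>p q r s. p < m \<Longrightarrow> q < m \<Longrightarrow> r < d \<Longrightarrow> s < d \<Longrightarrow>
      A $$ (p * d + r, q * d + s) = B $$ (p * d + r, q * d + s)"
  shows "A = B"
proof (rule eq_matI)
  fix i j assume "i < dim_row B" "j < dim_col B"
  hence "i < m * d" "j < m * d" using assms(1,2) by auto
  obtain p r where i: "p < m" "r < d" "i = p * d + r" by (rule block_cases[OF \<open>i < m * d\<close>])
  obtain q s where j: "q < m" "s < d" "j = q * d + s" by (rule block_cases[OF \<open>j < m * d\<close>])
  show "A $$ (i, j) = B $$ (i, j)" unfolding i(3) j(3) using i j by (intro assms(3))
qed (use assms(1,2) in auto)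

lemma psd_blockI:
  assumes "A \<in> carrier_mat (m * d) (m * d)"
    and "\<And>p q r s. p < m \<Longrightarrow> q < m \<Longrightarrow> r < d \<Longrightarrow> s < d \<Longrightarrow>
      A $$ (p * d + r, q * d + s) = (\<Sum>n\<in>N. w n p r * cnj (w n q s))"
  shows "psd (m * d) A"
proof (rule psd_gramI[where N = N and w = "\<lambda>n i. w n (i div d) (i mod d)"])
  fix i j assume "i < m * d" "j < m * d"
  obtain p r where i: "p < m" "r < d" "i = p * d + r" by (rule block_cases[OF \<open>i < m * d\<close>])
  obtain q s where j: "q < m" "s < d" "j = q * d + s" by (rule block_cases[OF \<open>j < m * d\<close>])
  show "A $$ (i, j) = (\<Sum>n\<in>N. w n (i div d) (i mod d) * cnj (w n (j div d) (j mod d)))"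
    using assms(2)[OF i(1) j(1) i(2) j(2)] i j by simp
qed (fact assms)

lemma mat_block_carrier [simp]: "mat_block d X p q \<in> carrier_mat d d"
  by (simp add: mat_block_def)

lemma mat_block_index [simp]: "r < d \<Longrightarrow> s < d \<Longrightarrow> mat_block d X p q $$ (r, s) = X $$ (p * d + r, q * d + s)"
  by (simp add: mat_block_def)

lemma mat_block_dim [simp]: "dim_row (mat_block d X p q) = d" "dim_col (mat_block d X p q) = d"
  by (simp_all add: mat_block_def)

lemma mat_unit_carrier [simp]: "mat_unit d i j \<in> carrier_mat d d"
  by (simp add: mat_unit_def)

lemma mat_unit_index [simp]:
  "r < d \<Longrightarrow> s < d \<Longrightarrow> mat_unit d i j $$ (r, s) = (if r = i \<and> s = j then 1 else 0)"
  by (simp add: mat_unit_def)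

lemma id_tensor_carrier [simp]: "id_tensor m d1 d2 \<Phi> X \<in> carrier_mat (m * d2) (m * d2)"
  by (simp add: id_tensor_def)

lemma id_tensor_index:
  "p < m \<Longrightarrow> q < m \<Longrightarrow> r < d2 \<Longrightarrow> s < d2 \<Longrightarrow>
   id_tensor m d1 d2 \<Phi> X $$ (p * d2 + r, q * d2 + s) = \<Phi> (mat_block d1 X p q) $$ (r, s)"
  by (simp add: id_tensor_def block_index_less)

lemma linear_map_carrier: "linear_map d1 d2 \<Phi> \<Longrightarrow> X \<in> carrier_mat d1 d1 \<Longrightarrow> \<Phi> X \<in> carrier_mat d2 d2"
  by (simp add: linear_map_def)

lemma linear_map_mat_sum:
  assumes L: "linear_map d1 d2 \<Phi>" and "finite I" "\<And>i. i \<in> I \<Longrightarrow> A i \<in> carrier_mat d1 d1"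
  shows "\<Phi> (mat_sum d1 d1 A I) = mat_sum d2 d2 (\<lambda>i. \<Phi> (A i)) I"
  using assms(2,3)
proof (induction I rule: finite_induct)
  case empty
  have "mat_sum d1 d1 A {} = 0 \<cdot>\<^sub>m 0\<^sub>m d1 d1" by (intro eq_matI) auto
  moreover have "\<Phi> (0 \<cdot>\<^sub>m 0\<^sub>m d1 d1) = 0 \<cdot>\<^sub>m \<Phi> (0\<^sub>m d1 d1)"
    using L zero_carrier_mat unfolding linear_map_def by blast
  moreover have "0 \<cdot>\<^sub>m \<Phi> (0\<^sub>m d1 d1) = mat_sum d2 d2 (\<lambda>i. \<Phi> (A i)) {}"
    using linear_map_carrier[OF L zero_carrier_mat] by (intro eq_matI) auto
  ultimately show ?case by metis
next
  case (insert x F)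
  have "mat_sum d1 d1 A (insert x F) = A x + mat_sum d1 d1 A F"
    using insert.hyps insert.prems(1)[of x] by (intro eq_matI) auto
  also have "\<Phi> \<dots> = \<Phi> (A x) + \<Phi> (mat_sum d1 d1 A F)"
    using L insert.prems by (simp add: linear_map_def)
  also have "\<dots> = mat_sum d2 d2 (\<lambda>i. \<Phi> (A i)) (insert x F)"
    using insert.hyps insert.prems insert.IH linear_map_carrier[OF L, of "A x"] by (intro eq_matI) auto
  finally show ?case .
qed

text \<open>
  A linear map on matrices is determined by its values on the matrix units.
\<close>

lemma linear_map_expand:
  assumes L: "linear_map d1 d2 \<Phi>" and X: "X \<in> carrier_mat d1 d1" and rs: "r < d2" "s < d2"
  shows "\<Phi> X $$ (r, s) = (\<Sum>p<d1. \<Sum>q<d1. X $$ (p, q) * \<Phi> (mat_unit d1 p q) $$ (r, s))"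
proof -
  define T where "T x = X $$ x \<cdot>\<^sub>m mat_unit d1 (fst x) (snd x)" for x
  have T: "T x \<in> carrier_mat d1 d1" for x by (simp add: T_def)
  have "X = mat_sum d1 d1 T ({..<d1} \<times> {..<d1})"
  proof (rule eq_matI)
    fix i j assume "i < dim_row (mat_sum d1 d1 T ({..<d1} \<times> {..<d1}))"
      "j < dim_col (mat_sum d1 d1 T ({..<d1} \<times> {..<d1}))"
    hence ij: "i < d1" "j < d1" by auto
    have "(\<Sum>x\<in>{..<d1} \<times> {..<d1}. T x $$ (i, j))
       = (\<Sum>x\<in>{..<d1} \<times> {..<d1}. if x = (i, j) then X $$ (i, j) else 0)"
      using ij by (intro sum.cong refl) (auto simp: mat_unit_def T_def split: if_splits)
    thus "X $$ (i, j) = mat_sum d1 d1 T ({..<d1} \<times> {..<d1}) $$ (i, j)"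
      using ij by simp
  qed (use X in auto)
  hence "\<Phi> X = \<Phi> (mat_sum d1 d1 T ({..<d1} \<times> {..<d1}))" by (rule arg_cong)
  also have "\<dots> = mat_sum d2 d2 (\<lambda>x. \<Phi> (T x)) ({..<d1} \<times> {..<d1})"
    by (rule linear_map_mat_sum[OF L]) (use T in auto)
  finally have "\<Phi> X $$ (r, s) = (\<Sum>x\<in>{..<d1} \<times> {..<d1}. \<Phi> (T x) $$ (r, s))"
    using rs by simp
  also have "\<dots> = (\<Sum>x\<in>{..<d1} \<times> {..<d1}. X $$ x * \<Phi> (mat_unit d1 (fst x) (snd x)) $$ (r, s))"
  proof (rule sum.cong[OF refl])
    fix x
    have "\<Phi> (T x) = X $$ x \<cdot>\<^sub>m \<Phi> (mat_unit d1 (fst x) (snd x))"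
      using L by (simp add: linear_map_def T_def)
    thus "\<Phi> (T x) $$ (r, s) = X $$ x * \<Phi> (mat_unit d1 (fst x) (snd x)) $$ (r, s)"
      using linear_map_carrier[OF L mat_unit_carrier, of "fst x" "snd x"] rs by simp
  qed
  also have "\<dots> = (\<Sum>p<d1. \<Sum>q<d1. X $$ (p, q) * \<Phi> (mat_unit d1 p q) $$ (r, s))"
    by (simp add: sum.cartesian_product case_prod_unfold)
  finally show ?thesis .
qed

lemma linear_map_comp: "linear_map d1 d2 \<Phi> \<Longrightarrow> linear_map d0 d1 \<Psi> \<Longrightarrow> linear_map d0 d2 (\<Phi> \<circ> \<Psi>)"
  by (simp add: linear_map_def)

lemma choi_carrier [simp]: "choi d1 d2 \<Phi> \<in> carrier_mat (d1 * d2) (d1 * d2)"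
  by (simp add: choi_def)

lemma kron_index:
  assumes "A \<in> carrier_mat m m" "B \<in> carrier_mat d d" "p < m" "q < m" "r < d" "s < d"
  shows "kron A B $$ (p * d + r, q * d + s) = A $$ (p, q) * B $$ (r, s)"
  using assms block_index_less[OF assms(3,5)] block_index_less[OF assms(4,6)] by (auto simp: kron_def)

lemma choi_index:
  assumes F: "\<And>i j. \<Phi> (mat_unit d1 i j) \<in> carrier_mat d2 d2"
    and pq: "p < d1" "q < d1" and rs: "r < d2" "s < d2"
  shows "choi d1 d2 \<Phi> $$ (p * d2 + r, q * d2 + s) = \<Phi> (mat_unit d1 p q) $$ (r, s)"
proof -
  have "choi d1 d2 \<Phi> $$ (p * d2 + r, q * d2 + s)
      = (\<Sum>x\<in>{..<d1} \<times> {..<d1}. kron (mat_unit d1 (fst x) (snd x)) (\<Phi> (mat_unit d1 (fst x) (snd x))) $$ (p * d2 + r, q * d2 + s))"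
    using block_index_less[OF pq(1) rs(1)] block_index_less[OF pq(2) rs(2)]
    by (simp add: choi_def case_prod_unfold)
  also have "\<dots> = (\<Sum>x\<in>{..<d1} \<times> {..<d1}. if x = (p, q) then \<Phi> (mat_unit d1 p q) $$ (r, s) else 0)"
    using pq rs by (intro sum.cong refl) (auto simp: kron_index[OF mat_unit_carrier F] split: if_splits)
  finally show ?thesis using pq by simp
qed

lemma choi_linear_index:
  assumes L: "linear_map d1 d2 \<Phi>" and "p < d1" "q < d1" "r < d2" "s < d2"
  shows "choi d1 d2 \<Phi> $$ (p * d2 + r, q * d2 + s) = \<Phi> (mat_unit d1 p q) $$ (r, s)"
  by (rule choi_index) (use assms linear_map_carrier[OF L] in auto)

lemma mat_block_choi:
  assumes "\<And>i j. \<Phi> (mat_unit d1 i j) \<in> carrier_mat d2 d2" "p < d1" "q < d1"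
  shows "mat_block d2 (choi d1 d2 \<Phi>) p q = \<Phi> (mat_unit d1 p q)"
  using assms(1)[of p q] choi_index[of \<Phi>, OF assms] by (intro eq_matI) auto

lemma choi_cong:
  assumes "\<And>X. X \<in> carrier_mat d1 d1 \<Longrightarrow> \<Phi> X = \<Psi> X"
  shows "choi d1 d2 \<Phi> = choi d1 d2 \<Psi>"
  unfolding choi_def using assms by (intro mat_sum_cong) auto

text \<open>
  The Choi matrix of \<open>\<Phi> \<circ> \<Psi>\<close> is the image of that of \<open>\<Psi>\<close>; this links conditions on compositions to
  conditions on \<open>id \<otimes> \<Phi>\<close>.
\<close>

lemma choi_comp:
  assumes "linear_map d1 d2 \<Phi>" "linear_map d0 d1 \<Psi>"
  shows "choi d0 d2 (\<Phi> \<circ> \<Psi>) = id_tensor d0 d1 d2 \<Phi> (choi d0 d1 \<Psi>)"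
proof (rule block_eqI)
  fix p q r s assume "p < d0" "q < d0" "r < d2" "s < d2"
  thus "choi d0 d2 (\<Phi> \<circ> \<Psi>) $$ (p * d2 + r, q * d2 + s)
      = id_tensor d0 d1 d2 \<Phi> (choi d0 d1 \<Psi>) $$ (p * d2 + r, q * d2 + s)"
    using assms by (simp add: choi_index id_tensor_index mat_block_choi linear_map_carrier)
qed auto

section \<open>Kraus operators\<close>

lemma mat_adjoint_carrier: "V \<in> carrier_mat m a \<Longrightarrow> mat_adjoint V \<in> carrier_mat a m"
  unfolding mat_adjoint_def by (intro carrier_matI) auto

lemma mat_adjoint_index:
  "V \<in> carrier_mat m a \<Longrightarrow> i < a \<Longrightarrow> j < m \<Longrightarrow> mat_adjoint V $$ (i, j) = cnj (V $$ (j, i))"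
  unfolding mat_adjoint_def mat_of_rows_def by auto

lemma Ad_carrier: "V \<in> carrier_mat m a \<Longrightarrow> X \<in> carrier_mat m m \<Longrightarrow> Ad V X \<in> carrier_mat a a"
  unfolding Ad_def using mat_adjoint_carrier[of V m a] by auto

lemma Ad_index:
  assumes V: "V \<in> carrier_mat m a" and X: "X \<in> carrier_mat m m" and rs: "r < a" "s < a"
  shows "Ad V X $$ (r, s) = (\<Sum>p<m. \<Sum>q<m. cnj (V $$ (p, r)) * X $$ (p, q) * V $$ (q, s))"
proof -
  have V': "mat_adjoint V \<in> carrier_mat a m" by (rule mat_adjoint_carrier[OF V])
  have "Ad V X $$ (r, s) = (\<Sum>p<m. mat_adjoint V $$ (r, p) * (\<Sum>q<m. X $$ (p, q) * V $$ (q, s)))"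
    unfolding Ad_def using V V' X rs by (simp add: scalar_prod_def atLeast0LessThan)
  thus ?thesis using mat_adjoint_index[OF V rs(1)] by (simp add: sum_distrib_left mult.assoc)
qed

lemma linear_map_Ad:
  assumes V: "V \<in> carrier_mat m a"
  shows "linear_map m a (Ad V)"
  unfolding linear_map_def
proof (intro conjI ballI allI)
  fix X Y :: "complex mat" assume X: "X \<in> carrier_mat m m"
  show "Ad V X \<in> carrier_mat a a" by (rule Ad_carrier[OF V X])
  fix c show "Ad V (c \<cdot>\<^sub>m X) = c \<cdot>\<^sub>m Ad V X"
  proof (rule eq_matI)
    fix r s assume "r < dim_row (c \<cdot>\<^sub>m Ad V X)" "s < dim_col (c \<cdot>\<^sub>m Ad V X)"
    hence rs: "r < a" "s < a" using Ad_carrier[OF V X] by auto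
    have "Ad V (c \<cdot>\<^sub>m X) $$ (r, s) = (\<Sum>p<m. \<Sum>q<m. c * (cnj (V $$ (p, r)) * X $$ (p, q) * V $$ (q, s)))"
      unfolding Ad_index[OF V smult_carrier_mat[OF X] rs] using X by (intro sum.cong refl) simp
    thus "Ad V (c \<cdot>\<^sub>m X) $$ (r, s) = (c \<cdot>\<^sub>m Ad V X) $$ (r, s)"
      using Ad_carrier[OF V X] rs by (simp add: Ad_index[OF V X rs] sum_distrib_left)
  qed (use Ad_carrier[OF V X] Ad_carrier[OF V smult_carrier_mat[OF X], of c] in auto)
  assume Y: "Y \<in> carrier_mat m m"
  show "Ad V (X + Y) = Ad V X + Ad V Y"
  proof (rule eq_matI)
    fix r s assume "r < dim_row (Ad V X + Ad V Y)" "s < dim_col (Ad V X + Ad V Y)"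
    hence rs: "r < a" "s < a" using Ad_carrier[OF V Y] by auto
    have "Ad V (X + Y) $$ (r, s) = (\<Sum>p<m. \<Sum>q<m. cnj (V $$ (p, r)) * X $$ (p, q) * V $$ (q, s)
          + cnj (V $$ (p, r)) * Y $$ (p, q) * V $$ (q, s))"
      unfolding Ad_index[OF V add_carrier_mat[OF Y] rs] using X Y by (intro sum.cong refl) (simp add: algebra_simps)
    thus "Ad V (X + Y) $$ (r, s) = (Ad V X + Ad V Y) $$ (r, s)"
      using Ad_carrier[OF V X] Ad_carrier[OF V Y] rs
      by (simp add: Ad_index[OF V X rs] Ad_index[OF V Y rs] sum.distrib)
  qed (use Ad_carrier[OF V Y] Ad_carrier[OF V add_carrier_mat[OF Y], of X] in auto)
qed

lemma Ad_unit_index: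
  assumes V: "V \<in> carrier_mat m a" and "p < m" "q < m" "r < a" "s < a"
  shows "Ad V (mat_unit m p q) $$ (r, s) = cnj (V $$ (p, r)) * V $$ (q, s)"
proof -
  have "Ad V (mat_unit m p q) $$ (r, s)
      = (\<Sum>p'<m. \<Sum>q'<m. if q' = q then (if p' = p then cnj (V $$ (p, r)) * V $$ (q, s) else 0) else 0)"
    unfolding Ad_index[OF V mat_unit_carrier assms(4,5)] by (intro sum.cong) auto
  thus ?thesis using assms by simp
qed

text \<open>
  The vector \<open>\<Sum>\<^sub>p e\<^sub>p \<otimes> V\<^sup>* e\<^sub>p\<close> and the inverse correspondence. Choi matrices of the maps \<open>Ad V\<close> are exactly the
  rank one matrices \<open>|\<xi>\<rangle>\<langle>\<xi>|\<close>, and the Schmidt rank of \<open>\<xi>\<close> is the rank of \<open>V\<close>.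
\<close>

definition kraus_vec :: "complex mat \<Rightarrow> complex vec" where
  "kraus_vec V = vec (dim_row V * dim_col V) (\<lambda>i. cnj (V $$ (i div dim_col V, i mod dim_col V)))"

definition kraus_mat :: "nat \<Rightarrow> nat \<Rightarrow> complex vec \<Rightarrow> complex mat" where
  "kraus_mat m a \<xi> = mat m a (\<lambda>(p, r). cnj (\<xi> $ (p * a + r)))"

lemma kraus_mat_carrier [simp]: "kraus_mat m a \<xi> \<in> carrier_mat m a"
  by (simp add: kraus_mat_def)

lemma kraus_vec_carrier: "V \<in> carrier_mat m a \<Longrightarrow> kraus_vec V \<in> carrier_vec (m * a)"
  by (simp add: kraus_vec_def)

lemma kraus_vec_index:
  "V \<in> carrier_mat m a \<Longrightarrow> p < m \<Longrightarrow> r < a \<Longrightarrow> kraus_vec V $ (p * a + r) = cnj (V $$ (p, r))"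
  by (auto simp: kraus_vec_def block_index_less)

lemma kraus_vec_kraus_mat:
  assumes "\<xi> \<in> carrier_vec (m * a)"
  shows "kraus_vec (kraus_mat m a \<xi>) = \<xi>"
proof (rule eq_vecI)
  fix i assume "i < dim_vec \<xi>"
  hence "i < m * a" using assms by simp
  then obtain p r where "p < m" "r < a" "i = p * a + r" by (rule block_cases)
  thus "kraus_vec (kraus_mat m a \<xi>) $ i = \<xi> $ i"
    using kraus_vec_index[OF kraus_mat_carrier, of p m r a] by (simp add: kraus_mat_def)
qed (use assms kraus_vec_carrier[OF kraus_mat_carrier] in auto)

lemma choi_Ad:
  assumes V: "V \<in> carrier_mat m a"
  shows "choi m a (Ad V) = outer (kraus_vec V) (kraus_vec V)"
proof (rule block_eqI[of _ m a])
  fix p q r s assume pq: "p < m" "q < m" and rs: "r < a" "s < a"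
  show "choi m a (Ad V) $$ (p * a + r, q * a + s) = outer (kraus_vec V) (kraus_vec V) $$ (p * a + r, q * a + s)"
    using V pq rs block_index_less
    by (simp add: choi_index Ad_carrier Ad_unit_index kraus_vec_index
        outer_index[OF kraus_vec_carrier[OF V] kraus_vec_carrier[OF V]])
qed (use kraus_vec_carrier[OF V] outer_carrier in auto)

text \<open>
  Local linear operations act on the Gram vectors: the sums over the two tensor indices factor for each \<open>n\<close>.
\<close>

lemma sum_sum_mult_cnj:
  fixes f g :: "'a \<Rightarrow> 'b \<Rightarrow> complex"
  shows "(\<Sum>t\<in>A. \<Sum>u\<in>B. \<Sum>n\<in>N. f n t * cnj (g n u) * c n)
    = (\<Sum>n\<in>N. (\<Sum>t\<in>A. f n t) * cnj (\<Sum>u\<in>B. g n u) * c n)"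
proof -
  have "(\<Sum>t\<in>A. \<Sum>u\<in>B. \<Sum>n\<in>N. f n t * cnj (g n u) * c n)
      = (\<Sum>t\<in>A. \<Sum>n\<in>N. \<Sum>u\<in>B. f n t * cnj (g n u) * c n)"
    by (intro sum.cong refl sum.swap)
  also have "\<dots> = (\<Sum>n\<in>N. \<Sum>t\<in>A. \<Sum>u\<in>B. f n t * cnj (g n u) * c n)" by (rule sum.swap)
  also have "\<dots> = (\<Sum>n\<in>N. (\<Sum>t\<in>A. f n t) * cnj (\<Sum>u\<in>B. g n u) * c n)"
    unfolding cnj_sum sum_product by (simp only: sum_distrib_right)
  finally show ?thesis .
qed

lemma sum_sum_cnj:
  fixes f g :: "'a \<Rightarrow> 'b \<Rightarrow> complex"
  shows "(\<Sum>t\<in>A. \<Sum>u\<in>B. \<Sum>n\<in>N. f n t * cnj (g n u)) = (\<Sum>n\<in>N. (\<Sum>t\<in>A. f n t) * cnj (\<Sum>u\<in>B. g n u))"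
  using sum_sum_mult_cnj[of f g "\<lambda>_. 1" N B A] by simp

lemma completely_positive_Ad:
  assumes V: "V \<in> carrier_mat m a"
  shows "completely_positive m a (Ad V)"
proof -
  have "psd (k * a) (id_tensor k m a (Ad V) X)" if X: "psd (k * m) X" for k X
  proof -
    obtain w where w: "\<And>i j. i < k * m \<Longrightarrow> j < k * m \<Longrightarrow> X $$ (i, j) = (\<Sum>n<k * m. w n i * cnj (w n j))"
      using psd_gramE[OF X] by blast
    show ?thesis
    proof (rule psd_blockI[where N = "{..<k * m}" and w = "\<lambda>n p r. \<Sum>t<m. cnj (V $$ (t, r)) * w n (p * m + t)"])
      fix p q r s assume *: "p < k" "q < k" "r < a" "s < a"
      have "id_tensor k m a (Ad V) X $$ (p * a + r, q * a + s)
          = (\<Sum>t<m. \<Sum>u<m. cnj (V $$ (t, r)) * X $$ (p * m + t, q * m + u) * V $$ (u, s))"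
        using * by (simp add: id_tensor_index Ad_index[OF V])
      also have "\<dots> = (\<Sum>t<m. \<Sum>u<m. \<Sum>n<k * m. (cnj (V $$ (t, r)) * w n (p * m + t)) *
            cnj (cnj (V $$ (u, s)) * w n (q * m + u)))"
      proof (intro sum.cong refl)
        fix t u assume "t \<in> {..<m}" "u \<in> {..<m}"
        hence "X $$ (p * m + t, q * m + u) = (\<Sum>n<k * m. w n (p * m + t) * cnj (w n (q * m + u)))"
          using * by (intro w) (simp_all add: block_index_less)
        thus "cnj (V $$ (t, r)) * X $$ (p * m + t, q * m + u) * V $$ (u, s) =
            (\<Sum>n<k * m. (cnj (V $$ (t, r)) * w n (p * m + t)) * cnj (cnj (V $$ (u, s)) * w n (q * m + u)))"
          by (simp add: sum_distrib_left sum_distrib_right algebra_simps)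
      qed
      finally show "id_tensor k m a (Ad V) X $$ (p * a + r, q * a + s)
          = (\<Sum>n<k * m. (\<Sum>t<m. cnj (V $$ (t, r)) * w n (p * m + t)) *
               cnj (\<Sum>t<m. cnj (V $$ (t, s)) * w n (q * m + t)))"
        unfolding sum_sum_cnj .
    qed simp
  qed
  thus ?thesis using linear_map_Ad[OF V] linear_map_id_tensor[OF linear_map_Ad[OF V]]
    by (auto simp: completely_positive_def k_positive_def positive_map_def)
qed

section \<open>Separable matrices\<close>

abbreviation product_vectors ::
  "nat \<Rightarrow> nat \<Rightarrow> complex mat \<Rightarrow> 'i set \<Rightarrow> ('i \<Rightarrow> nat \<Rightarrow> complex) \<Rightarrow> ('i \<Rightarrow> nat \<Rightarrow> complex) \<Rightarrow> bool" where
  "product_vectors m b X N x y \<equiv> \<forall>p<m. \<forall>q<m. \<forall>r<b. \<forall>s<b.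
     X $$ (p * b + r, q * b + s) = (\<Sum>\<nu>\<in>N. x \<nu> p * y \<nu> r * cnj (x \<nu> q * y \<nu> s))"

text \<open>
  Separable matrices are the sums of \<open>|x \<otimes> y\<rangle>\<langle>x \<otimes> y|\<close>; the index set is arbitrary here, since sums and
  compositions produce products of index sets.
\<close>

lemma separableI:
  assumes X: "X \<in> carrier_mat (m * b) (m * b)" and N: "finite N"
    and e: "\<And>p q r s. p < m \<Longrightarrow> q < m \<Longrightarrow> r < b \<Longrightarrow> s < b \<Longrightarrow>
      X $$ (p * b + r, q * b + s) = (\<Sum>\<nu>\<in>N. x \<nu> p * y \<nu> r * cnj (x \<nu> q * y \<nu> s))"
  shows "separable m b X"
proof -
  obtain h where h: "bij_betw h {0..<card N} N" using ex_bij_betw_nat_finite[OF N] by auto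
  define A where "A i = outer (vec m (x (h i))) (vec m (x (h i)))" for i
  define B where "B i = outer (vec b (y (h i))) (vec b (y (h i)))" for i
  have A: "A i \<in> carrier_mat m m" for i unfolding A_def by (rule outer_carrier) auto
  have B: "B i \<in> carrier_mat b b" for i unfolding B_def by (rule outer_carrier) auto
  have "X = mat_sum (m * b) (m * b) (\<lambda>i. kron (A i) (B i)) {..<card N}"
  proof (rule block_eqI[OF X])
    fix p q r s assume *: "p < m" "q < m" "r < b" "s < b"
    have "(\<Sum>\<nu>\<in>N. x \<nu> p * y \<nu> r * cnj (x \<nu> q * y \<nu> s))
       = (\<Sum>i<card N. x (h i) p * y (h i) r * cnj (x (h i) q * y (h i) s))"
      using sum.reindex_bij_betw[OF h, of "\<lambda>\<nu>. x \<nu> p * y \<nu> r * cnj (x \<nu> q * y \<nu> s)"]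
      by (simp add: atLeast0LessThan)
    also have "\<dots> = (\<Sum>i<card N. kron (A i) (B i) $$ (p * b + r, q * b + s))"
    proof (rule sum.cong[OF refl])
      fix i
      have "A i $$ (p, q) = x (h i) p * cnj (x (h i) q)" "B i $$ (r, s) = y (h i) r * cnj (y (h i) s)"
        using * by (simp_all add: A_def B_def outer_index[OF vec_carrier vec_carrier])
      thus "x (h i) p * y (h i) r * cnj (x (h i) q * y (h i) s) = kron (A i) (B i) $$ (p * b + r, q * b + s)"
        unfolding kron_index[OF A B *] by simp
    qed
    finally show "X $$ (p * b + r, q * b + s)
        = mat_sum (m * b) (m * b) (\<lambda>i. kron (A i) (B i)) {..<card N} $$ (p * b + r, q * b + s)"
      using e[OF *] * by (simp add: block_index_less)
  qed simp
  moreover have "psd m (A i)" "psd b (B i)" for i by (auto simp: A_def B_def intro: psd_outer)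
  ultimately show ?thesis unfolding separable_def by blast
qed

lemma separable_carrier: "separable m b X \<Longrightarrow> X \<in> carrier_mat (m * b) (m * b)"
  by (auto simp: separable_def)

lemma separable_ex_product_vectors:
  assumes "separable m b X"
  shows "\<exists>(N :: (nat \<times> nat \<times> nat) set) x y. finite N \<and> (product_vectors m b X N x y)"
proof -
  obtain n :: nat and A B where AB: "\<And>i. i < n \<Longrightarrow> psd m (A i)" "\<And>i. i < n \<Longrightarrow> psd b (B i)"
    and X: "X = mat_sum (m * b) (m * b) (\<lambda>i. kron (A i) (B i)) {..<n}"
    using assms unfolding separable_def by blast
  have "\<forall>i. \<exists>w. i < n \<longrightarrow> (\<forall>p<m. \<forall>q<m. A i $$ (p, q) = (\<Sum>j<m. w j p * cnj (w j q)))"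
    using psd_gram_ex[OF AB(1)] by blast
  from choice[OF this] obtain a
    where a: "\<And>i p q. i < n \<Longrightarrow> p < m \<Longrightarrow> q < m \<Longrightarrow> A i $$ (p, q) = (\<Sum>j<m. a i j p * cnj (a i j q))"
    by blast
  have "\<forall>i. \<exists>w. i < n \<longrightarrow> (\<forall>p<b. \<forall>q<b. B i $$ (p, q) = (\<Sum>j<b. w j p * cnj (w j q)))"
    using psd_gram_ex[OF AB(2)] by blast
  from choice[OF this] obtain c
    where c: "\<And>i p q. i < n \<Longrightarrow> p < b \<Longrightarrow> q < b \<Longrightarrow> B i $$ (p, q) = (\<Sum>j<b. c i j p * cnj (c i j q))"
    by blast
  let ?N = "{..<n} \<times> {..<m} \<times> {..<b}"
  show ?thesis
  proof (rule exI[of _ ?N], rule exI[of _ "\<lambda>\<nu>. a (fst \<nu>) (fst (snd \<nu>))"],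
      rule exI[of _ "\<lambda>\<nu>. c (fst \<nu>) (snd (snd \<nu>))"], intro conjI allI impI)
    fix p q r s assume *: "p < m" "q < m" "r < b" "s < b"
    have "X $$ (p * b + r, q * b + s) = (\<Sum>i<n. kron (A i) (B i) $$ (p * b + r, q * b + s))"
      using * by (simp add: X block_index_less)
    also have "\<dots> = (\<Sum>i<n. A i $$ (p, q) * B i $$ (r, s))"
      using kron_index[OF AB(1)[THEN psd_carrier] AB(2)[THEN psd_carrier] *] by (intro sum.cong refl) simp
    also have "\<dots> = (\<Sum>i<n. (\<Sum>j<m. a i j p * cnj (a i j q)) * (\<Sum>l<b. c i l r * cnj (c i l s)))"
      using * by (intro sum.cong refl) (simp add: a c)
    also have "\<dots> = (\<Sum>i<n. \<Sum>j<m. \<Sum>l<b. a i j p * c i l r * cnj (a i j q * c i l s))"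
      unfolding sum_product by (intro sum.cong refl) (simp add: algebra_simps)
    finally show "X $$ (p * b + r, q * b + s) = (\<Sum>\<nu>\<in>?N. a (fst \<nu>) (fst (snd \<nu>)) p * c (fst \<nu>) (snd (snd \<nu>)) r
        * cnj (a (fst \<nu>) (fst (snd \<nu>)) q * c (fst \<nu>) (snd (snd \<nu>)) s))"
      by (simp add: sum.cartesian_product case_prod_unfold)
  qed simp
qed

lemma separable_mat_sum:
  assumes "finite I" "\<And>i. i \<in> I \<Longrightarrow> separable m b (X i)"
  shows "separable m b (mat_sum (m * b) (m * b) X I)"
proof -
  let ?P = "\<lambda>i N x y. finite (N :: (nat \<times> nat \<times> nat) set) \<and> (product_vectors m b (X i) N x y)"
  have "\<exists>t. ?P i (fst t) (fst (snd t)) (snd (snd t))" if i: "i \<in> I" for i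
  proof -
    obtain N x y where "?P i N x y"
      using separable_ex_product_vectors[OF assms(2)[OF i]] by (elim exE)
    thus ?thesis by (intro exI[of _ "(N, x, y)"]) simp
  qed
  hence "\<forall>i\<in>I. \<exists>t. ?P i (fst t) (fst (snd t)) (snd (snd t))" by (rule ballI)
  from bchoice[OF this] obtain t where t: "\<forall>i\<in>I. ?P i (fst (t i)) (fst (snd (t i))) (snd (snd (t i)))"
    by (elim exE)
  define N x y where "N i = fst (t i)" and "x i = fst (snd (t i))" and "y i = snd (snd (t i))" for i
  have N: "\<And>i. i \<in> I \<Longrightarrow> finite (N i)"
    and e: "\<And>i p q r s. i \<in> I \<Longrightarrow> p < m \<Longrightarrow> q < m \<Longrightarrow> r < b \<Longrightarrow> s < b \<Longrightarrow>
      X i $$ (p * b + r, q * b + s) = (\<Sum>\<nu>\<in>N i. x i \<nu> p * y i \<nu> r * cnj (x i \<nu> q * y i \<nu> s))"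
    using t by (simp_all add: N_def x_def y_def)
  show ?thesis
  proof (rule separableI[where N = "Sigma I N" and x = "\<lambda>\<nu>. x (fst \<nu>) (snd \<nu>)" and y = "\<lambda>\<nu>. y (fst \<nu>) (snd \<nu>)"])
    fix p q r s assume *: "p < m" "q < m" "r < b" "s < b"
    have "mat_sum (m * b) (m * b) X I $$ (p * b + r, q * b + s) = (\<Sum>i\<in>I. X i $$ (p * b + r, q * b + s))"
      using * by (simp add: block_index_less)
    also have "\<dots> = (\<Sum>i\<in>I. \<Sum>\<nu>\<in>N i. x i \<nu> p * y i \<nu> r * cnj (x i \<nu> q * y i \<nu> s))"
      using * by (intro sum.cong refl e)
    finally show "mat_sum (m * b) (m * b) X I $$ (p * b + r, q * b + s) = (\<Sum>\<nu>\<in>Sigma I N.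
        x (fst \<nu>) (snd \<nu>) p * y (fst \<nu>) (snd \<nu>) r * cnj (x (fst \<nu>) (snd \<nu>) q * y (fst \<nu>) (snd \<nu>) s))"
      using assms(1) N by (simp add: sum.Sigma case_prod_unfold)
  qed (use assms(1) N in auto)
qed

text \<open>
  Unlike on general positive semidefinite matrices, positivity of \<open>\<Gamma>\<close> suffices on separable ones, because
  \<open>id \<otimes> \<Gamma>\<close> maps \<open>|x\<rangle>\<langle>x| \<otimes> |y\<rangle>\<langle>y|\<close> to \<open>|x\<rangle>\<langle>x| \<otimes> \<Gamma>(|y\<rangle>\<langle>y|)\<close>.
\<close>

lemma psd_id_tensor_separable:
  assumes G: "positive_map b c \<Gamma>" and X: "separable m b X"
  shows "psd (m * c) (id_tensor m b c \<Gamma> X)"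
proof -
  have L: "linear_map b c \<Gamma>" using G by (simp add: positive_map_def)
  obtain N :: "(nat \<times> nat \<times> nat) set" and x y where N: "finite N"
    and e: "product_vectors m b X N x y"
    using separable_ex_product_vectors[OF X] by (elim exE conjE) (rule that)
  define B where "B \<nu> = outer (vec b (y \<nu>)) (vec b (y \<nu>))" for \<nu>
  have Bc: "B \<nu> \<in> carrier_mat b b" for \<nu> unfolding B_def by (rule outer_carrier) auto
  have "psd c (\<Gamma> (B \<nu>))" for \<nu> using G psd_outer[of "vec b (y \<nu>)" b] by (simp add: positive_map_def B_def)
  hence "\<forall>\<nu>. \<exists>w. \<forall>r<c. \<forall>s<c. \<Gamma> (B \<nu>) $$ (r, s) = (\<Sum>j<c. w j r * cnj (w j s))"
    using psd_gram_ex by blast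
  from choice[OF this] obtain w
    where w: "\<And>\<nu> r s. r < c \<Longrightarrow> s < c \<Longrightarrow> \<Gamma> (B \<nu>) $$ (r, s) = (\<Sum>j<c. w \<nu> j r * cnj (w \<nu> j s))"
    by blast
  show ?thesis
  proof (rule psd_blockI[where N = "N \<times> {..<c}" and w = "\<lambda>n p r. x (fst n) p * w (fst n) (snd n) r"])
    fix p q r s assume *: "p < m" "q < m" "r < c" "s < c"
    have "mat_block b X p q = mat_sum b b (\<lambda>\<nu>. (x \<nu> p * cnj (x \<nu> q)) \<cdot>\<^sub>m B \<nu>) N"
    proof (rule eq_matI)
      fix i j assume "i < dim_row (mat_sum b b (\<lambda>\<nu>. (x \<nu> p * cnj (x \<nu> q)) \<cdot>\<^sub>m B \<nu>) N)"
        "j < dim_col (mat_sum b b (\<lambda>\<nu>. (x \<nu> p * cnj (x \<nu> q)) \<cdot>\<^sub>m B \<nu>) N)"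
      hence ij: "i < b" "j < b" by auto
      have "B \<nu> $$ (i, j) = y \<nu> i * cnj (y \<nu> j)" for \<nu>
        using ij by (simp add: B_def outer_index[OF vec_carrier vec_carrier])
      thus "mat_block b X p q $$ (i, j) = mat_sum b b (\<lambda>\<nu>. (x \<nu> p * cnj (x \<nu> q)) \<cdot>\<^sub>m B \<nu>) N $$ (i, j)"
        using ij e[rule_format, OF *(1,2) ij] Bc[THEN carrier_matD(1)] Bc[THEN carrier_matD(2)] by (simp add: algebra_simps)
    qed auto
    hence "id_tensor m b c \<Gamma> X $$ (p * c + r, q * c + s)
        = \<Gamma> (mat_sum b b (\<lambda>\<nu>. (x \<nu> p * cnj (x \<nu> q)) \<cdot>\<^sub>m B \<nu>) N) $$ (r, s)"
      using * by (simp add: id_tensor_index)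
    also have "\<dots> = (\<Sum>\<nu>\<in>N. \<Gamma> ((x \<nu> p * cnj (x \<nu> q)) \<cdot>\<^sub>m B \<nu>) $$ (r, s))"
      using linear_map_mat_sum[OF L N, of "\<lambda>\<nu>. (x \<nu> p * cnj (x \<nu> q)) \<cdot>\<^sub>m B \<nu>"] Bc * by simp
    also have "\<dots> = (\<Sum>\<nu>\<in>N. \<Sum>j<c. x \<nu> p * w \<nu> j r * cnj (x \<nu> q * w \<nu> j s))"
    proof (intro sum.cong refl)
      fix \<nu>
      have "\<Gamma> ((x \<nu> p * cnj (x \<nu> q)) \<cdot>\<^sub>m B \<nu>) = (x \<nu> p * cnj (x \<nu> q)) \<cdot>\<^sub>m \<Gamma> (B \<nu>)"
        using L Bc by (simp add: linear_map_def)
      thus "\<Gamma> ((x \<nu> p * cnj (x \<nu> q)) \<cdot>\<^sub>m B \<nu>) $$ (r, s) = (\<Sum>j<c. x \<nu> p * w \<nu> j r * cnj (x \<nu> q * w \<nu> j s))"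
        using linear_map_carrier[OF L Bc[of \<nu>]] * by (simp add: w sum_distrib_left algebra_simps)
    qed
    finally show "id_tensor m b c \<Gamma> X $$ (p * c + r, q * c + s) = (\<Sum>n\<in>N \<times> {..<c}.
        x (fst n) p * w (fst n) (snd n) r * cnj (x (fst n) q * w (fst n) (snd n) s))"
      by (simp add: sum.cartesian_product case_prod_unfold)
  qed simp
qed

section \<open>Composition with Kraus operators\<close>

lemma mat_adjoint_mult:
  fixes X Y :: "complex mat"
  assumes X: "X \<in> carrier_mat m k" and Y: "Y \<in> carrier_mat k a"
  shows "mat_adjoint (X * Y) = mat_adjoint Y * mat_adjoint X"
proof (rule eq_matI)
  note X' = mat_adjoint_carrier[OF X] and Y' = mat_adjoint_carrier[OF Y]
  note XY = mult_carrier_mat[OF X Y]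
  fix i j assume "i < dim_row (mat_adjoint Y * mat_adjoint X)" "j < dim_col (mat_adjoint Y * mat_adjoint X)"
  hence ij: "i < a" "j < m" using X' Y' by auto
  have "mat_adjoint (X * Y) $$ (i, j) = (\<Sum>t<k. cnj (X $$ (j, t) * Y $$ (t, i)))"
    unfolding mat_adjoint_index[OF XY ij] using X Y ij by (simp add: scalar_prod_def atLeast0LessThan)
  also have "\<dots> = (\<Sum>t<k. mat_adjoint Y $$ (i, t) * mat_adjoint X $$ (t, j))"
    using ij by (intro sum.cong refl) (simp add: mat_adjoint_index[OF X] mat_adjoint_index[OF Y] mult.commute)
  also have "\<dots> = (mat_adjoint Y * mat_adjoint X) $$ (i, j)"
    using X' Y' ij by (simp add: scalar_prod_def atLeast0LessThan)
  finally show "mat_adjoint (X * Y) $$ (i, j) = (mat_adjoint Y * mat_adjoint X) $$ (i, j)" .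
qed (use mat_adjoint_carrier[OF X] mat_adjoint_carrier[OF Y] mat_adjoint_carrier[OF mult_carrier_mat[OF X Y]] in auto)

lemma Ad_mult:
  assumes X: "X \<in> carrier_mat m k" and Y: "Y \<in> carrier_mat k a" and M: "M \<in> carrier_mat m m"
  shows "Ad (X * Y) M = Ad Y (Ad X M)"
proof -
  note X' = mat_adjoint_carrier[OF X] and Y' = mat_adjoint_carrier[OF Y]
  have "Ad (X * Y) M = mat_adjoint Y * mat_adjoint X * M * (X * Y)"
    by (simp add: Ad_def mat_adjoint_mult[OF X Y])
  also have "\<dots> = mat_adjoint Y * mat_adjoint X * M * X * Y"
    using X Y M X' Y' by (intro assoc_mult_mat[symmetric]) auto
  also have "mat_adjoint Y * mat_adjoint X * M = mat_adjoint Y * (mat_adjoint X * M)"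
    using X Y M X' Y' by (intro assoc_mult_mat) auto
  also have "mat_adjoint Y * (mat_adjoint X * M) * X = mat_adjoint Y * (mat_adjoint X * M * X)"
    using X Y M X' Y' by (intro assoc_mult_mat) auto
  finally show ?thesis by (simp add: Ad_def)
qed

text \<open>
  Replacing \<open>Y\<close> by \<open>X * Y\<close> conjugates the Choi matrix with \<open>cnj X \<otimes> 1\<close>, an operation on the first tensor
  factor alone.
\<close>

lemma choi_comp_Ad_mult_index:
  assumes L: "linear_map a b \<Phi>" and X: "X \<in> carrier_mat m k" and Y: "Y \<in> carrier_mat k a"
    and *: "p < m" "q < m" "r < b" "s < b"
  shows "choi m b (\<Phi> \<circ> Ad (X * Y)) $$ (p * b + r, q * b + s) =
    (\<Sum>t<k. \<Sum>u<k. cnj (X $$ (p, t)) * X $$ (q, u) * choi k b (\<Phi> \<circ> Ad Y) $$ (t * b + r, u * b + s))"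
proof -
  have LY: "linear_map k b (\<Phi> \<circ> Ad Y)" by (rule linear_map_comp[OF L linear_map_Ad[OF Y]])
  have LXY: "linear_map m b (\<Phi> \<circ> Ad (X * Y))"
    by (rule linear_map_comp[OF L linear_map_Ad[OF mult_carrier_mat[OF X Y]]])
  have "choi m b (\<Phi> \<circ> Ad (X * Y)) $$ (p * b + r, q * b + s) = (\<Phi> \<circ> Ad (X * Y)) (mat_unit m p q) $$ (r, s)"
    by (rule choi_linear_index[OF LXY *])
  also have "\<dots> = (\<Phi> \<circ> Ad Y) (Ad X (mat_unit m p q)) $$ (r, s)"
    by (simp add: Ad_mult[OF X Y mat_unit_carrier])
  also have "\<dots> = (\<Sum>t<k. \<Sum>u<k. Ad X (mat_unit m p q) $$ (t, u) * (\<Phi> \<circ> Ad Y) (mat_unit k t u) $$ (r, s))"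
    by (rule linear_map_expand[OF LY Ad_carrier[OF X mat_unit_carrier] *(3,4)])
  also have "\<dots> = (\<Sum>t<k. \<Sum>u<k. cnj (X $$ (p, t)) * X $$ (q, u) * choi k b (\<Phi> \<circ> Ad Y) $$ (t * b + r, u * b + s))"
    using * choi_linear_index[OF LY]
    by (intro sum.cong refl) (simp add: Ad_unit_index[OF X])
  finally show ?thesis .
qed

lemma psd_choi_comp_Ad_mult:
  assumes L: "linear_map a b \<Phi>" and X: "X \<in> carrier_mat m k" and Y: "Y \<in> carrier_mat k a"
    and S: "psd (k * b) (choi k b (\<Phi> \<circ> Ad Y))"
  shows "psd (m * b) (choi m b (\<Phi> \<circ> Ad (X * Y)))"
proof -
  obtain w where w: "\<And>i j. i < k * b \<Longrightarrow> j < k * b \<Longrightarrow>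
      choi k b (\<Phi> \<circ> Ad Y) $$ (i, j) = (\<Sum>n<k * b. w n i * cnj (w n j))"
    using psd_gramE[OF S] by blast
  show ?thesis
  proof (rule psd_blockI[where N = "{..<k * b}" and w = "\<lambda>n p r. \<Sum>t<k. cnj (X $$ (p, t)) * w n (t * b + r)"])
    fix p q r s assume *: "p < m" "q < m" "r < b" "s < b"
    have "choi m b (\<Phi> \<circ> Ad (X * Y)) $$ (p * b + r, q * b + s)
       = (\<Sum>t<k. \<Sum>u<k. \<Sum>n<k * b. cnj (X $$ (p, t)) * w n (t * b + r) * cnj (cnj (X $$ (q, u)) * w n (u * b + s)))"
      unfolding choi_comp_Ad_mult_index[OF L X Y *]
    proof (intro sum.cong refl)
      fix t u assume "t \<in> {..<k}" "u \<in> {..<k}"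
      hence "choi k b (\<Phi> \<circ> Ad Y) $$ (t * b + r, u * b + s) = (\<Sum>n<k * b. w n (t * b + r) * cnj (w n (u * b + s)))"
        using * by (intro w) (simp_all add: block_index_less)
      thus "cnj (X $$ (p, t)) * X $$ (q, u) * choi k b (\<Phi> \<circ> Ad Y) $$ (t * b + r, u * b + s) =
          (\<Sum>n<k * b. cnj (X $$ (p, t)) * w n (t * b + r) * cnj (cnj (X $$ (q, u)) * w n (u * b + s)))"
        by (simp add: sum_distrib_left algebra_simps)
    qed
    thus "choi m b (\<Phi> \<circ> Ad (X * Y)) $$ (p * b + r, q * b + s) = (\<Sum>n<k * b.
        (\<Sum>t<k. cnj (X $$ (p, t)) * w n (t * b + r)) * cnj (\<Sum>t<k. cnj (X $$ (q, t)) * w n (t * b + s)))"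
      unfolding sum_sum_cnj .
  qed simp
qed

section \<open>Entanglement breaking maps\<close>

lemma mat_adjoint_one: "mat_adjoint (1\<^sub>m m) = (1\<^sub>m m :: complex mat)"
  using mat_adjoint_carrier[OF one_carrier_mat[of m]]
  by (intro eq_matI) (auto simp: mat_adjoint_index[OF one_carrier_mat[of m]])

lemma Ad_one: "M \<in> carrier_mat m m \<Longrightarrow> Ad (1\<^sub>m m) M = M"
  by (simp add: Ad_def mat_adjoint_one)

lemma psd_choi_Ad: "V \<in> carrier_mat m a \<Longrightarrow> psd (m * a) (choi m a (Ad V))"
  by (simp add: choi_Ad psd_outer kraus_vec_carrier)

text \<open>
  If the Choi matrix of \<open>\<Psi>\<close> is \<open>\<Sum> |x \<otimes> y\<rangle>\<langle>x \<otimes> y|\<close>, then \<open>\<Psi>\<close> measures with the vectors \<open>x\<close> and prepares the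
  vectors \<open>y\<close>; a Gram vector of \<open>X\<close> is contracted with \<open>x\<close> in its second tensor factor.
\<close>

lemma separable_id_tensor_if_choi:
  assumes L: "linear_map m b \<Psi>" and S: "separable m b (choi m b \<Psi>)" and X: "psd (n * m) X"
  shows "separable n b (id_tensor n m b \<Psi> X)"
proof -
  obtain N :: "(nat \<times> nat \<times> nat) set" and x y where N: "finite N"
    and e: "product_vectors m b (choi m b \<Psi>) N x y"
    using separable_ex_product_vectors[OF S] by (elim exE conjE) (rule that)
  obtain w where w: "\<And>i j. i < n * m \<Longrightarrow> j < n * m \<Longrightarrow> X $$ (i, j) = (\<Sum>l<n * m. w l i * cnj (w l j))"
    using psd_gramE[OF X] by blast
  let ?N = "{..<n * m} \<times> N"
  let ?z = "\<lambda>\<mu> p t. w (fst \<mu>) (p * m + t) * x (snd \<mu>) t"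
  let ?c = "\<lambda>\<mu> r s. y (snd \<mu>) r * cnj (y (snd \<mu>) s)"
  show ?thesis
  proof (rule separableI[where N = ?N and x = "\<lambda>\<mu> p. \<Sum>t<m. ?z \<mu> p t" and y = "\<lambda>\<mu>. y (snd \<mu>)"])
    fix p q r s assume *: "p < n" "q < n" "r < b" "s < b"
    have "id_tensor n m b \<Psi> X $$ (p * b + r, q * b + s) = \<Psi> (mat_block m X p q) $$ (r, s)"
      using * by (simp add: id_tensor_index)
    also have "\<dots> = (\<Sum>t<m. \<Sum>u<m. mat_block m X p q $$ (t, u) * \<Psi> (mat_unit m t u) $$ (r, s))"
      by (rule linear_map_expand[OF L mat_block_carrier *(3,4)])
    also have "\<dots> = (\<Sum>t<m. \<Sum>u<m. \<Sum>\<mu>\<in>?N. ?z \<mu> p t * cnj (?z \<mu> q u) * ?c \<mu> r s)"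
    proof (intro sum.cong refl)
      fix t u assume "t \<in> {..<m}" "u \<in> {..<m}"
      hence tu: "t < m" "u < m" by auto
      have "mat_block m X p q $$ (t, u) = (\<Sum>l<n * m. w l (p * m + t) * cnj (w l (q * m + u)))"
        using tu * w[of "p * m + t" "q * m + u"] by (simp add: block_index_less)
      moreover have "\<Psi> (mat_unit m t u) $$ (r, s) = (\<Sum>\<nu>\<in>N. x \<nu> t * y \<nu> r * cnj (x \<nu> u * y \<nu> s))"
        using e[rule_format, OF tu *(3,4)] choi_linear_index[OF L tu *(3,4)] by simp
      ultimately have "mat_block m X p q $$ (t, u) * \<Psi> (mat_unit m t u) $$ (r, s)
          = (\<Sum>l<n * m. w l (p * m + t) * cnj (w l (q * m + u))) * (\<Sum>\<nu>\<in>N. x \<nu> t * y \<nu> r * cnj (x \<nu> u * y \<nu> s))"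
        by (simp only:)
      also have "\<dots> = (\<Sum>l<n * m. \<Sum>\<nu>\<in>N. w l (p * m + t) * x \<nu> t * cnj (w l (q * m + u) * x \<nu> u) * (y \<nu> r * cnj (y \<nu> s)))"
        unfolding sum_product by (simp only: complex_cnj_mult mult_ac)
      also have "\<dots> = (\<Sum>\<mu>\<in>?N. ?z \<mu> p t * cnj (?z \<mu> q u) * ?c \<mu> r s)"
        by (simp add: sum.cartesian_product case_prod_unfold)
      finally show "mat_block m X p q $$ (t, u) * \<Psi> (mat_unit m t u) $$ (r, s)
          = (\<Sum>\<mu>\<in>?N. ?z \<mu> p t * cnj (?z \<mu> q u) * ?c \<mu> r s)" .
    qed
    also have "\<dots> = (\<Sum>\<mu>\<in>?N. (\<Sum>t<m. ?z \<mu> p t) * cnj (\<Sum>u<m. ?z \<mu> q u) * ?c \<mu> r s)"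
      by (rule sum_sum_mult_cnj)
    finally show "id_tensor n m b \<Psi> X $$ (p * b + r, q * b + s) = (\<Sum>\<mu>\<in>?N.
        (\<Sum>t<m. ?z \<mu> p t) * y (snd \<mu>) r * cnj ((\<Sum>t<m. ?z \<mu> q t) * y (snd \<mu>) s))"
      by (simp only: complex_cnj_mult mult_ac)
  qed (use N in auto)
qed

lemma entanglement_breaking_iff_choi:
  assumes m: "1 \<le> m"
  shows "entanglement_breaking m b \<Psi> \<longleftrightarrow> linear_map m b \<Psi> \<and> separable m b (choi m b \<Psi>)"
proof
  assume E: "entanglement_breaking m b \<Psi>"
  hence L: "linear_map m b \<Psi>" by (simp add: entanglement_breaking_def)
  have "choi m b \<Psi> = choi m b (\<Psi> \<circ> Ad (1\<^sub>m m))" by (rule choi_cong) (simp add: Ad_one)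
  also have "\<dots> = id_tensor m m b \<Psi> (choi m m (Ad (1\<^sub>m m)))"
    by (rule choi_comp[OF L linear_map_Ad]) simp
  finally show "linear_map m b \<Psi> \<and> separable m b (choi m b \<Psi>)"
    using E m L psd_choi_Ad[of "1\<^sub>m m" m m] by (simp add: entanglement_breaking_def)
qed (simp add: entanglement_breaking_def separable_id_tensor_if_choi)

text \<open>
  \<open>\<Phi> \<circ> Ad Y\<close> is entanglement breaking, hence so is its composition with \<open>Ad X\<close>.
\<close>

lemma separable_choi_comp_Ad_mult:
  assumes L: "linear_map a b \<Phi>" and X: "X \<in> carrier_mat m k" and Y: "Y \<in> carrier_mat k a"
    and S: "separable k b (choi k b (\<Phi> \<circ> Ad Y))"
  shows "separable m b (choi m b (\<Phi> \<circ> Ad (X * Y)))"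
proof -
  have LY: "linear_map k b (\<Phi> \<circ> Ad Y)" by (rule linear_map_comp[OF L linear_map_Ad[OF Y]])
  have "choi m b (\<Phi> \<circ> Ad (X * Y)) = choi m b ((\<Phi> \<circ> Ad Y) \<circ> Ad X)"
    by (rule choi_cong) (simp add: Ad_mult[OF X Y])
  also have "\<dots> = id_tensor m k b (\<Phi> \<circ> Ad Y) (choi m k (Ad X))"
    by (rule choi_comp[OF LY linear_map_Ad[OF X]])
  finally show ?thesis using separable_id_tensor_if_choi[OF LY S psd_choi_Ad[OF X]] by simp
qed

text \<open>
  Through this identity the behaviour of \<open>id \<otimes> \<Phi>\<close> on positive semidefinite matrices is that of the Choi
  matrices of the maps \<open>\<Phi> \<circ> Ad V\<close>.
\<close>

lemma id_tensor_sum_outer: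
  assumes L: "linear_map a b \<Phi>" and "finite I" and \<xi>: "\<And>i. i \<in> I \<Longrightarrow> \<xi> i \<in> carrier_vec (m * a)"
  shows "id_tensor m a b \<Phi> (mat_sum (m * a) (m * a) (\<lambda>i. outer (\<xi> i) (\<xi> i)) I)
    = mat_sum (m * b) (m * b) (\<lambda>i. choi m b (\<Phi> \<circ> Ad (kraus_mat m a (\<xi> i)))) I"
proof -
  have "id_tensor m a b \<Phi> (mat_sum (m * a) (m * a) (\<lambda>i. outer (\<xi> i) (\<xi> i)) I)
      = mat_sum (m * b) (m * b) (\<lambda>i. id_tensor m a b \<Phi> (outer (\<xi> i) (\<xi> i))) I"
    by (rule linear_map_mat_sum[OF linear_map_id_tensor[OF L] \<open>finite I\<close>]) (rule outer_carrier[OF \<xi> \<xi>])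
  also have "\<dots> = mat_sum (m * b) (m * b) (\<lambda>i. choi m b (\<Phi> \<circ> Ad (kraus_mat m a (\<xi> i)))) I"
    using choi_Ad[OF kraus_mat_carrier] choi_comp[OF L linear_map_Ad[OF kraus_mat_carrier]] \<xi>
    by (intro mat_sum_cong) (simp add: kraus_vec_kraus_mat)
  finally show ?thesis .
qed

section \<open>Positive maps detect entanglement\<close>

lemma mat_trace_mult:
  assumes "A \<in> carrier_mat n n" "B \<in> carrier_mat n n"
  shows "mat_trace (A * B) = (\<Sum>i<n. \<Sum>j<n. A $$ (i, j) * B $$ (j, i))"
  using assms by (simp add: mat_trace_def scalar_prod_def atLeast0LessThan)

text \<open>
  On Hermitian matrices a real linear functional \<open>M \<mapsto> Re \<langle>W, M\<rangle>\<close> is the trace pairing with the Hermitian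
  part \<open>C\<close> of \<open>W\<close>.
\<close>

lemma hermitian_pairing:
  assumes M: "\<And>i j. i < n \<Longrightarrow> j < n \<Longrightarrow> M j i = cnj (M i j)"
    and C: "\<And>i j. C i j = (W i j + cnj (W j i)) / 2"
  shows "(\<Sum>i<n. \<Sum>j<n. M i j * C j i) = of_real (Re (\<Sum>i<n. \<Sum>j<n. cnj (W i j) * M i j))"
proof -
  define S where "S = (\<Sum>i<n. \<Sum>j<n. cnj (W i j) * M i j)"
  have "(\<Sum>i<n. \<Sum>j<n. M i j * W j i) = (\<Sum>j<n. \<Sum>i<n. M i j * W j i)" by (rule sum.swap)
  also have "\<dots> = (\<Sum>j<n. \<Sum>i<n. cnj (cnj (W j i) * M j i))"
  proof (intro sum.cong refl)
    fix i j assume "j \<in> {..<n}" "i \<in> {..<n}"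
    hence eq: "M i j = cnj (M j i)" by (intro M) auto
    show "M i j * W j i = cnj (cnj (W j i) * M j i)" by (subst eq) simp
  qed
  finally have 1: "(\<Sum>i<n. \<Sum>j<n. M i j * W j i) = cnj S" by (simp add: S_def)
  have "(\<Sum>i<n. \<Sum>j<n. M i j * C j i) = (\<Sum>i<n. \<Sum>j<n. (M i j * W j i + cnj (W i j) * M i j) / 2)"
    by (intro sum.cong refl) (simp add: C algebra_simps)
  also have "\<dots> = (cnj S + S) / 2"
    unfolding sum_divide_distrib[symmetric] sum.distrib 1 S_def ..
  also have "\<dots> = of_real (Re S)" by (simp add: complex_eq_iff)
  finally show ?thesis unfolding S_def .
qed

text \<open>
  The entries of \<open>|x \<otimes> y\<rangle>\<langle>x \<otimes> y|\<close>.
\<close>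

definition product_state :: "nat \<Rightarrow> (nat \<Rightarrow> complex) \<Rightarrow> (nat \<Rightarrow> complex) \<Rightarrow> nat \<Rightarrow> nat \<Rightarrow> complex" where
  "product_state b x y i j = x (i div b) * y (i mod b) * cnj (x (j div b) * y (j mod b))"

text \<open>
  A complex matrix as a family of real numbers, to which the separation theorem applies.
\<close>

definition re_im :: "(nat \<Rightarrow> nat \<Rightarrow> complex) \<Rightarrow> (nat \<times> nat) \<times> bool \<Rightarrow> real" where
  "re_im M = (\<lambda>((i, j), c). if c then Re (M i j) else Im (M i j))"

text \<open>
  The norm of \<open>y\<close> is moved to \<open>x\<close>. Both vectors are then bounded in terms of the trace, so that bounded
  sequences of product states come from bounded sequences of vectors.
\<close>

lemma product_state_normalize:
  "\<exists>x' y'. (\<forall>i<m * b. \<forall>j<m * b. product_state b x' y' i j = product_state b x y i j) \<and>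
     (\<forall>r<b. (cmod (y' r))\<^sup>2 \<le> 1) \<and>
     (\<forall>p<m. (cmod (x' p))\<^sup>2 \<le> (\<Sum>i<m * b. Re (product_state b x y i i)))"
proof -
  define c where "c = (\<Sum>r<b. (cmod (y r))\<^sup>2)"
  have diag: "Re (product_state b x y (p * b + r) (p * b + r)) = (cmod (x p))\<^sup>2 * (cmod (y r))\<^sup>2" if "r < b" for p r
    using that unfolding product_state_def
    by (simp add: complex_norm_square[symmetric] norm_mult power_mult_distrib del: complex_cnj_mult flip: of_real_power of_real_mult)
  have tr: "(\<Sum>i<m * b. Re (product_state b x y i i)) = (\<Sum>p<m. (cmod (x p))\<^sup>2 * c)"
    unfolding sum_blocks c_def sum_distrib_left by (intro sum.cong refl) (simp add: diag)
  have c0: "c \<ge> 0" unfolding c_def by (intro sum_nonneg) auto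
  have yc: "(cmod (y r))\<^sup>2 \<le> c" if "r < b" for r
    unfolding c_def using that by (intro member_le_sum) auto
  show ?thesis
  proof (cases "c = 0")
    case True
    hence y0: "y r = 0" if "r < b" for r using yc[OF that] by simp
    have "product_state b (\<lambda>_. 0) y i j = product_state b x y i j" if "i < m * b" for i j
    proof -
      have "i mod b < b" using that by (cases b) auto
      thus ?thesis using y0 by (simp add: product_state_def)
    qed
    thus ?thesis using y0 tr True by (intro exI[of _ "\<lambda>_. 0"] exI[of _ y]) auto
  next
    case False
    hence c: "c > 0" using c0 by simp
    define s where "s = sqrt c"
    have s: "s > 0" "s\<^sup>2 = c" using c by (simp_all add: s_def)
    have "product_state b (\<lambda>p. of_real s * x p) (\<lambda>r. y r / of_real s) i j = product_state b x y i j" for i j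
      using s by (simp add: product_state_def)
    moreover have "(cmod (y r / of_real s))\<^sup>2 \<le> 1" if "r < b" for r
      using yc[OF that] c s by (simp add: norm_divide power_divide)
    moreover have "(cmod (of_real s * x p))\<^sup>2 \<le> (\<Sum>p<m. (cmod (x p))\<^sup>2 * c)" if "p < m" for p
    proof -
      have "(cmod (of_real s * x p))\<^sup>2 = (cmod (x p))\<^sup>2 * c"
        using s by (simp add: norm_mult power_mult_distrib mult.commute)
      also have "\<dots> \<le> (\<Sum>p<m. (cmod (x p))\<^sup>2 * c)"
        using that c by (intro member_le_sum) auto
      finally show ?thesis .
    qed
    ultimately show ?thesis unfolding tr
      by (intro exI[of _ "\<lambda>p. of_real s * x p"] exI[of _ "\<lambda>r. y r / of_real s"]) blast
  qed
qed

lemma product_state_bound: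
  assumes "i < n" "j < n"
  shows "\<bar>re_im (product_state b x y) ((i, j), c)\<bar> \<le> (\<Sum>i<n. Re (product_state b x y i i))"
proof -
  define a where "a i = x (i div b) * y (i mod b)" for i
  have ps: "product_state b x y i j = a i * cnj (a j)" for i j by (simp add: product_state_def a_def)
  have d: "Re (product_state b x y i i) = (cmod (a i))\<^sup>2" for i
    unfolding ps complex_norm_square[symmetric] by simp
  have le: "(cmod (a i))\<^sup>2 \<le> (\<Sum>i<n. (cmod (a i))\<^sup>2)" if "i < n" for i
    using that by (intro member_le_sum) auto
  have "\<bar>re_im (product_state b x y) ((i, j), c)\<bar> \<le> cmod (a i * cnj (a j))"
    using abs_Re_le_cmod[of "a i * cnj (a j)"] abs_Im_le_cmod[of "a i * cnj (a j)"]
    unfolding re_im_def ps by simp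
  also have "\<dots> = cmod (a i) * cmod (a j)" by (simp add: norm_mult)
  also have "\<dots> \<le> ((cmod (a i))\<^sup>2 + (cmod (a j))\<^sup>2) / 2"
    using sum_squares_bound[of "cmod (a i)" "cmod (a j)"] by simp
  also have "\<dots> \<le> (\<Sum>i<n. (cmod (a i))\<^sup>2)" using le[OF assms(1)] le[OF assms(2)] by simp
  finally show ?thesis unfolding d .
qed

text \<open>
  The traces converge, hence are bounded, and so are the normalized vectors. A limit of vectors along a
  subsequence gives the limit of the product states.
\<close>

lemma product_states_closed:
  assumes l: "\<forall>ix\<in>({..<m * b} \<times> {..<m * b}) \<times> UNIV. (\<lambda>n. re_im (product_state b (x n) (y n)) ix) \<longlonglongrightarrow> l ix"
  shows "\<exists>x' y'. \<forall>ix\<in>({..<m * b} \<times> {..<m * b}) \<times> UNIV. re_im (product_state b x' y') ix = l ix"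
proof -
  let ?I = "({..<m * b} \<times> {..<m * b}) \<times> (UNIV :: bool set)"
  define \<tau> where "\<tau> n = (\<Sum>i<m * b. Re (product_state b (x n) (y n) i i))" for n
  have "(\<lambda>n. re_im (product_state b (x n) (y n)) ((i, i), True)) \<longlonglongrightarrow> l ((i, i), True)" if "i < m * b" for i
    using l that by blast
  hence "\<tau> \<longlonglongrightarrow> (\<Sum>i<m * b. l ((i, i), True))"
    unfolding \<tau>_def by (intro tendsto_sum) (simp add: re_im_def)
  hence "Bseq \<tau>" by (intro convergent_imp_Bseq) (auto simp: convergent_def)
  then obtain K where K: "K > 0" "\<And>n. \<bar>\<tau> n\<bar> \<le> K" by (auto simp: Bseq_def)
  let ?Q = "\<lambda>n x' y'. (\<forall>i<m * b. \<forall>j<m * b. product_state b x' y' i j = product_state b (x n) (y n) i j) \<and>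
     (\<forall>r<b. (cmod (y' r))\<^sup>2 \<le> 1) \<and> (\<forall>p<m. (cmod (x' p))\<^sup>2 \<le> \<tau> n)"
  have "\<forall>n. \<exists>x' y'. ?Q n x' y'" unfolding \<tau>_def using product_state_normalize by blast
  from choice[OF this] obtain x' where "\<forall>n. \<exists>y'. ?Q n (x' n) y'" by (elim exE)
  from choice[OF this] obtain y' where Q: "\<forall>n. ?Q n (x' n) (y' n)" by (elim exE)
  \<comment> \<open>All real and imaginary parts of both vectors in one real family.\<close>
  define f where "f n \<kappa> = (case \<kappa> of (Inl p, c) \<Rightarrow> if c then Re (x' n p) else Im (x' n p)
      | (Inr r, c) \<Rightarrow> if c then Re (y' n r) else Im (y' n r))" for n and \<kappa> :: "(nat + nat) \<times> bool"
  have sq: "\<bar>Re z\<bar> \<le> 1 + (cmod z)\<^sup>2" "\<bar>Im z\<bar> \<le> 1 + (cmod z)\<^sup>2" for z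
  proof -
    have "2 * cmod z \<le> 1 + (cmod z)\<^sup>2" using sum_squares_bound[of 1 "cmod z"] by simp
    moreover have "0 \<le> cmod z" by simp
    ultimately show "\<bar>Re z\<bar> \<le> 1 + (cmod z)\<^sup>2" "\<bar>Im z\<bar> \<le> 1 + (cmod z)\<^sup>2"
      using abs_Re_le_cmod[of z] abs_Im_le_cmod[of z] by linarith+
  qed
  let ?J = "({..<m} <+> {..<b}) \<times> (UNIV :: bool set)"
  have fb: "\<bar>f n \<kappa>\<bar> \<le> 2 + K" if "\<kappa> \<in> ?J" for n \<kappa>
  proof -
    have x: "(cmod (x' n p))\<^sup>2 \<le> K" if "p < m" for p
      using Q K(2)[of n] that by (meson abs_le_D1 order_trans)
    have y: "(cmod (y' n r))\<^sup>2 \<le> 1" if "r < b" for r using Q that by blast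
    consider p c where "\<kappa> = (Inl p, c)" "p < m" | r c where "\<kappa> = (Inr r, c)" "r < b"
      using \<open>\<kappa> \<in> ?J\<close> by auto
    thus ?thesis
    proof cases
      case 1
      thus ?thesis using x[of p] sq[of "x' n p"] by (auto simp: f_def)
    next
      case 2
      thus ?thesis using y[of r] sq[of "y' n r"] K(1) by (auto simp: f_def)
    qed
  qed
  obtain r L where r: "strict_mono r" and L: "\<forall>\<kappa>\<in>?J. (\<lambda>n. f (r n) \<kappa>) \<longlonglongrightarrow> L \<kappa>"
    using bounded_family_convergent_subsequence[of ?J f, OF _ fb] by auto
  define X where "X p = Complex (L (Inl p, True)) (L (Inl p, False))" for p
  define Y where "Y p = Complex (L (Inr p, True)) (L (Inr p, False))" for p
  have limX: "(\<lambda>n. x' (r n) p) \<longlonglongrightarrow> X p" if "p < m" for p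
  proof -
    have "(\<lambda>n. f (r n) (Inl p, True)) \<longlonglongrightarrow> L (Inl p, True)" "(\<lambda>n. f (r n) (Inl p, False)) \<longlonglongrightarrow> L (Inl p, False)"
      using L that by auto
    thus ?thesis by (simp add: f_def X_def tendsto_complex_iff)
  qed
  have limY: "(\<lambda>n. y' (r n) p) \<longlonglongrightarrow> Y p" if "p < b" for p
  proof -
    have "(\<lambda>n. f (r n) (Inr p, True)) \<longlonglongrightarrow> L (Inr p, True)" "(\<lambda>n. f (r n) (Inr p, False)) \<longlonglongrightarrow> L (Inr p, False)"
      using L that by auto
    thus ?thesis by (simp add: f_def Y_def tendsto_complex_iff)
  qed
  have "re_im (product_state b X Y) ((i, j), c) = l ((i, j), c)" if ij: "i < m * b" "j < m * b" for i j c
  proof -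
    have b: "i div b < m" "i mod b < b" "j div b < m" "j mod b < b"
      using ij by (auto simp: less_mult_imp_div_less intro!: mod_less_divisor gr0I)
    have "(\<lambda>n. product_state b (x' (r n)) (y' (r n)) i j) \<longlonglongrightarrow> product_state b X Y i j"
      unfolding product_state_def by (intro tendsto_intros limX limY b)
    hence "(\<lambda>n. product_state b (x (r n)) (y (r n)) i j) \<longlonglongrightarrow> product_state b X Y i j"
      using Q ij by simp
    hence "(\<lambda>n. re_im (product_state b (x (r n)) (y (r n))) ((i, j), c)) \<longlonglongrightarrow> re_im (product_state b X Y) ((i, j), c)"
      by (simp add: re_im_def tendsto_Re tendsto_Im)
    moreover have "(\<lambda>n. re_im (product_state b (x (r n)) (y (r n))) ((i, j), c)) \<longlonglongrightarrow> l ((i, j), c)"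
      using LIMSEQ_subseq_LIMSEQ[OF _ r, of "\<lambda>n. re_im (product_state b (x n) (y n)) ((i, j), c)" "l ((i, j), c)"] l ij
      by (simp add: o_def)
    ultimately show ?thesis by (rule LIMSEQ_unique)
  qed
  thus ?thesis by (intro exI[of _ X] exI[of _ Y]) auto
qed

lemma sum_re_im:
  "(\<Sum>ix\<in>({..<n} \<times> {..<n}) \<times> UNIV. w ix * re_im M ix)
   = Re (\<Sum>i<n. \<Sum>j<n. cnj (Complex (w ((i, j), True)) (w ((i, j), False))) * M i j)"
proof -
  have "(\<Sum>ix\<in>({..<n} \<times> {..<n}) \<times> UNIV. w ix * re_im M ix)
      = (\<Sum>i<n. \<Sum>j<n. \<Sum>c\<in>UNIV. w ((i, j), c) * re_im M ((i, j), c))"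
    by (simp only: sum.cartesian_product')
  also have "\<dots> = (\<Sum>i<n. \<Sum>j<n. Re (cnj (Complex (w ((i, j), True)) (w ((i, j), False))) * M i j))"
    by (intro sum.cong refl) (simp add: UNIV_bool re_im_def)
  finally show ?thesis by (simp only: Re_sum)
qed

text \<open>
  The generators of the cone are the product states, and its elements are the separable matrices. The
  trace is the linear functional which bounds the entries.
\<close>

lemma block_positive_witness:
  assumes Y: "Y \<in> carrier_mat (m * b) (m * b)" and H: "hermitian_fun (m * b) (\<lambda>i j. Y $$ (i, j))"
    and ns: "\<not> separable m b Y"
  shows "\<exists>C. (\<forall>x y. 0 \<le> (\<Sum>i<m * b. \<Sum>j<m * b. product_state b x y i j * C j i)) \<and>
    \<not> 0 \<le> (\<Sum>i<m * b. \<Sum>j<m * b. Y $$ (i, j) * C j i)"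
proof -
  let ?n = "m * b"
  let ?I = "({..<?n} \<times> {..<?n}) \<times> (UNIV :: bool set)"
  let ?D = "(\<lambda>i. ((i, i), True)) ` {..<?n}"
  define G where "G = {re_im (product_state b x y) | x y. True}"
  define M where "M = (\<lambda>i j. Y $$ (i, j))"
  have "\<exists>w. (\<forall>g\<in>G. 0 \<le> (\<Sum>ix\<in>?I. w ix * g ix)) \<and> (\<Sum>ix\<in>?I. w ix * re_im M ix) < 0"
  proof (rule closed_cone_separation[where D = ?D])
    show "finite ?I" by simp
    show "?D \<subseteq> ?I" by auto
    show "G \<noteq> {}" by (auto simp: G_def)
    fix g assume "g \<in> G"
    then obtain x y where g: "g = re_im (product_state b x y)" by (auto simp: G_def)
    {
      fix t :: real assume t: "0 \<le> t"
      hence tt: "of_real t = (of_real (sqrt t) * of_real (sqrt t) :: complex)" by (simp flip: of_real_mult)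
      have "product_state b (\<lambda>p. of_real (sqrt t) * x p) y i j = of_real t * product_state b x y i j" for i j
        unfolding tt by (simp add: product_state_def algebra_simps)
      hence "(\<lambda>ix. t * g ix) = re_im (product_state b (\<lambda>p. of_real (sqrt t) * x p) y)"
        by (auto simp: g re_im_def)
      thus "(\<lambda>ix. t * g ix) \<in> G" unfolding G_def by blast
    }
    fix ix assume "ix \<in> ?I"
    then obtain i j c where ix: "ix = ((i, j), c)" "i < ?n" "j < ?n" by auto
    have "(\<Sum>\<kappa>\<in>?D. g \<kappa>) = (\<Sum>i<?n. g ((i, i), True))" by (subst sum.reindex) (auto simp: inj_on_def)
    thus "\<bar>g ix\<bar> \<le> (\<Sum>\<kappa>\<in>?D. g \<kappa>)"
      using product_state_bound[OF ix(2,3), of b x y c] by (simp add: ix(1) g) (simp add: re_im_def)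
  next
    fix g l assume "\<forall>n. g n \<in> G" and l: "\<forall>ix\<in>?I. (\<lambda>n. g n ix) \<longlonglongrightarrow> l ix"
    hence "\<forall>n. \<exists>x y. g n = re_im (product_state b x y)" unfolding G_def by blast
    from choice[OF this] obtain x where "\<forall>n. \<exists>y. g n = re_im (product_state b (x n) y)" by (elim exE)
    from choice[OF this] obtain y where xy: "\<forall>n. g n = re_im (product_state b (x n) (y n))" by (elim exE)
    from l have "\<forall>ix\<in>?I. (\<lambda>n. re_im (product_state b (x n) (y n)) ix) \<longlonglongrightarrow> l ix" by (simp only: xy)
    from product_states_closed[OF this] show "\<exists>h\<in>G. \<forall>ix\<in>?I. h ix = l ix" unfolding G_def by blast
  next
    show "\<not> (\<exists>(n::nat) g. (\<forall>j<n. g j \<in> G) \<and> (\<forall>ix\<in>?I. re_im M ix = (\<Sum>j<n. g j ix)))"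
    proof
      assume "\<exists>(n::nat) g. (\<forall>j<n. g j \<in> G) \<and> (\<forall>ix\<in>?I. re_im M ix = (\<Sum>j<n. g j ix))"
      then obtain n :: nat and g where g: "\<forall>j<n. g j \<in> G" and e: "\<forall>ix\<in>?I. re_im M ix = (\<Sum>j<n. g j ix)"
        by (elim exE conjE)
      have "\<forall>j\<in>{..<n}. \<exists>x y. g j = re_im (product_state b x y)" using g unfolding G_def by blast
      from bchoice[OF this] obtain x where "\<forall>j\<in>{..<n}. \<exists>y. g j = re_im (product_state b (x j) y)" by (elim exE)
      from bchoice[OF this] obtain y where xy: "\<forall>j\<in>{..<n}. g j = re_im (product_state b (x j) (y j))" by (elim exE)
      have Mij: "M i j = (\<Sum>\<nu><n. product_state b (x \<nu>) (y \<nu>) i j)" if ij: "i < ?n" "j < ?n" for i j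
      proof (rule complex_eqI)
        have *: "re_im M ((i, j), c) = (\<Sum>\<nu><n. re_im (product_state b (x \<nu>) (y \<nu>)) ((i, j), c))" for c
          using e xy ij by simp
        show "Re (M i j) = Re (\<Sum>\<nu><n. product_state b (x \<nu>) (y \<nu>) i j)" using *[of True] by (simp add: re_im_def)
        show "Im (M i j) = Im (\<Sum>\<nu><n. product_state b (x \<nu>) (y \<nu>) i j)" using *[of False] by (simp add: re_im_def)
      qed
      have "separable m b Y"
      proof (rule separableI[OF Y, of "{..<n}"])
        fix p q r s assume *: "p < m" "q < m" "r < b" "s < b"
        show "Y $$ (p * b + r, q * b + s) = (\<Sum>\<nu><n. x \<nu> p * y \<nu> r * cnj (x \<nu> q * y \<nu> s))"
          using Mij[OF block_index_less[OF *(1,3)] block_index_less[OF *(2,4)]] *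
          by (simp add: M_def product_state_def)
      qed simp
      thus False using ns by simp
    qed
  qed
  then obtain w where w: "\<forall>g\<in>G. 0 \<le> (\<Sum>ix\<in>?I. w ix * g ix)" "(\<Sum>ix\<in>?I. w ix * re_im M ix) < 0"
    by (elim exE conjE)
  define W where "W i j = Complex (w ((i, j), True)) (w ((i, j), False))" for i j
  define C where "C i j = (W i j + cnj (W j i)) / 2" for i j
  have "0 \<le> (\<Sum>i<?n. \<Sum>j<?n. product_state b x y i j * C j i)" for x y
  proof -
    have "re_im (product_state b x y) \<in> G" unfolding G_def by blast
    hence "0 \<le> Re (\<Sum>i<?n. \<Sum>j<?n. cnj (W i j) * product_state b x y i j)"
      using w(1) unfolding W_def sum_re_im[symmetric] by blast
    moreover have "(\<Sum>i<?n. \<Sum>j<?n. product_state b x y i j * C j i)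
        = of_real (Re (\<Sum>i<?n. \<Sum>j<?n. cnj (W i j) * product_state b x y i j))"
      by (rule hermitian_pairing) (simp_all add: product_state_def C_def)
    ultimately show ?thesis by (simp add: less_eq_complex_def)
  qed
  moreover have "\<not> 0 \<le> (\<Sum>i<?n. \<Sum>j<?n. M i j * C j i)"
  proof -
    have "Re (\<Sum>i<?n. \<Sum>j<?n. cnj (W i j) * M i j) < 0" using w(2) unfolding W_def sum_re_im .
    moreover have "(\<Sum>i<?n. \<Sum>j<?n. M i j * C j i) = of_real (Re (\<Sum>i<?n. \<Sum>j<?n. cnj (W i j) * M i j))"
    proof (rule hermitian_pairing)
      show "M j i = cnj (M i j)" if "i < ?n" "j < ?n" for i j
        using H that unfolding hermitian_fun_def M_def by blast
    qed (simp add: C_def)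
    ultimately show ?thesis by (simp add: less_eq_complex_def)
  qed
  ultimately show ?thesis unfolding M_def by (intro exI[of _ C] conjI allI)
qed

text \<open>
  The criterion of M., P. and R. Horodecki: the block-positive matrix \<open>C\<close> is the Choi matrix of the map
  \<open>\<Gamma>\<close> with \<open>\<Gamma>(E\<^bsub>pq\<^esub>)\<close> the block of \<open>C\<close> at \<open>(p, q)\<close>, and block positivity is positivity of \<open>\<Gamma>\<close>.
\<close>

theorem entanglement_witness:
  assumes Y: "Y \<in> carrier_mat (m * b) (m * b)" and H: "hermitian_fun (m * b) (\<lambda>i j. Y $$ (i, j))"
    and ns: "\<not> separable m b Y"
  shows "\<exists>\<Gamma>. positive_map m b \<Gamma> \<and> \<not> 0 \<le> mat_trace (Y * choi m b \<Gamma>)"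
proof -
  obtain C where C': "\<forall>x y. 0 \<le> (\<Sum>i<m * b. \<Sum>j<m * b. product_state b x y i j * C j i)"
    and CY: "\<not> 0 \<le> (\<Sum>i<m * b. \<Sum>j<m * b. Y $$ (i, j) * C j i)"
    using block_positive_witness[OF assms] by (elim exE conjE)
  note C = C'[THEN spec, THEN spec]
  \<comment> \<open>The linear map whose Choi matrix is \<open>C\<close>.\<close>
  define \<Gamma> where "\<Gamma> X = mat b b (\<lambda>(r, s). \<Sum>p<m. \<Sum>q<m. X $$ (p, q) * C (p * b + r) (q * b + s))" for X
  have L: "linear_map m b \<Gamma>"
    unfolding linear_map_def
  proof (intro conjI ballI allI)
    fix X X' :: "complex mat" assume X: "X \<in> carrier_mat m m"
    show "\<Gamma> X \<in> carrier_mat b b" by (simp add: \<Gamma>_def)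
    show "\<Gamma> (c \<cdot>\<^sub>m X) = c \<cdot>\<^sub>m \<Gamma> X" for c
      using X by (intro eq_matI) (simp_all add: \<Gamma>_def sum_distrib_left mult.assoc)
    assume X': "X' \<in> carrier_mat m m"
    show "\<Gamma> (X + X') = \<Gamma> X + \<Gamma> X'"
      using X X' by (intro eq_matI) (simp_all add: \<Gamma>_def sum.distrib distrib_right)
  qed
  have "psd b (\<Gamma> X)" if X: "psd m X" for X
    unfolding psd_iff_quadratic_form
  proof (intro conjI allI)
    show "\<Gamma> X \<in> carrier_mat b b" by (simp add: \<Gamma>_def)
    fix f :: "nat \<Rightarrow> complex"
    obtain w where w: "\<And>p q. p < m \<Longrightarrow> q < m \<Longrightarrow> X $$ (p, q) = (\<Sum>n<m. w n p * cnj (w n q))"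
      using psd_gramE[OF X] by blast
    let ?t = "\<lambda>n r s p q. product_state b (\<lambda>p. cnj (w n p)) f (q * b + s) (p * b + r) * C (p * b + r) (q * b + s)"
    have "(\<Sum>r<b. \<Sum>s<b. cnj (f r) * \<Gamma> X $$ (r, s) * f s) = (\<Sum>r<b. \<Sum>s<b. \<Sum>p<m. \<Sum>q<m. \<Sum>n<m. ?t n r s p q)"
    proof (intro sum.cong refl)
      fix r s assume "r \<in> {..<b}" "s \<in> {..<b}"
      hence rs: "r < b" "s < b" by auto
      have "cnj (f r) * \<Gamma> X $$ (r, s) * f s = (\<Sum>p<m. \<Sum>q<m. cnj (f r) * (X $$ (p, q) * C (p * b + r) (q * b + s)) * f s)"
        using rs by (simp add: \<Gamma>_def sum_distrib_left sum_distrib_right)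
      also have "\<dots> = (\<Sum>p<m. \<Sum>q<m. \<Sum>n<m. ?t n r s p q)"
      proof (intro sum.cong refl)
        fix p q assume "p \<in> {..<m}" "q \<in> {..<m}"
        hence "X $$ (p, q) = (\<Sum>n<m. w n p * cnj (w n q))" using w by auto
        thus "cnj (f r) * (X $$ (p, q) * C (p * b + r) (q * b + s)) * f s = (\<Sum>n<m. ?t n r s p q)"
          using rs by (simp add: product_state_def sum_distrib_left sum_distrib_right mult_ac)
      qed
      finally show "cnj (f r) * \<Gamma> X $$ (r, s) * f s = (\<Sum>p<m. \<Sum>q<m. \<Sum>n<m. ?t n r s p q)" .
    qed
    also have "\<dots> = (\<Sum>n<m. \<Sum>q<m. \<Sum>s<b. \<Sum>p<m. \<Sum>r<b. ?t n r s p q)"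
    proof -
      have "(\<Sum>r<b. \<Sum>s<b. \<Sum>p<m. \<Sum>q<m. \<Sum>n<m. ?t n r s p q)
          = (\<Sum>\<kappa>\<in>{..<b} \<times> {..<b} \<times> {..<m} \<times> {..<m} \<times> {..<m}.
              case \<kappa> of (r, s, p, q, n) \<Rightarrow> ?t n r s p q)"
        by (simp add: sum.cartesian_product)
      also have "\<dots> = (\<Sum>\<kappa>\<in>{..<m} \<times> {..<m} \<times> {..<b} \<times> {..<m} \<times> {..<b}.
              case \<kappa> of (n, q, s, p, r) \<Rightarrow> ?t n r s p q)"
        by (rule sum.reindex_bij_witness[of _ "\<lambda>(n, q, s, p, r). (r, s, p, q, n)" "\<lambda>(r, s, p, q, n). (n, q, s, p, r)"]) auto
      finally show ?thesis by (simp add: sum.cartesian_product)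
    qed
    also have "\<dots> = (\<Sum>n<m. \<Sum>i<m * b. \<Sum>j<m * b. product_state b (\<lambda>p. cnj (w n p)) f i j * C j i)"
      unfolding sum_blocks ..
    also have "0 \<le> \<dots>" by (intro sum_nonneg C)
    finally show "0 \<le> (\<Sum>r<b. \<Sum>s<b. cnj (f r) * \<Gamma> X $$ (r, s) * f s)" .
  qed
  moreover have "mat_trace (Y * choi m b \<Gamma>) = (\<Sum>i<m * b. \<Sum>j<m * b. Y $$ (i, j) * C j i)"
    unfolding mat_trace_mult[OF Y choi_carrier]
  proof (intro sum.cong refl)
    fix i j assume "i \<in> {..<m * b}" "j \<in> {..<m * b}"
    hence ij: "i < m * b" "j < m * b" by auto
    obtain p r where i: "p < m" "r < b" "i = p * b + r" by (rule block_cases[OF ij(1)])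
    obtain q s where j: "q < m" "s < b" "j = q * b + s" by (rule block_cases[OF ij(2)])
    have "choi m b \<Gamma> $$ (j, i) = \<Gamma> (mat_unit m q p) $$ (s, r)"
      unfolding i(3) j(3) by (rule choi_linear_index[OF L j(1) i(1) j(2) i(2)])
    also have "\<dots> = (\<Sum>q'<m. \<Sum>p'<m. mat_unit m q p $$ (q', p') * C (q' * b + s) (p' * b + r))"
      using i j by (simp add: \<Gamma>_def)
    also have "\<dots> = (\<Sum>q'<m. \<Sum>p'<m. if p' = p then (if q' = q then C (q' * b + s) (p' * b + r) else 0) else 0)"
      by (intro sum.cong refl) auto
    also have "\<dots> = C j i" using i j by simp
    finally show "Y $$ (i, j) * choi m b \<Gamma> $$ (j, i) = Y $$ (i, j) * C j i" by simp
  qed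
  ultimately show ?thesis using L CY unfolding positive_map_def by (intro exI[of _ \<Gamma>]) simp
qed

section \<open>Singular values\<close>

text \<open>
  A sum of \<open>n\<close> nonzero multiples of \<open>u\<^sub>i \<otimes> v\<^sub>i\<close> with orthonormal \<open>u\<close> and \<open>v\<close> needs at least \<open>n\<close> product terms:
  with fewer terms a nonzero combination of the conjugates of the \<open>v\<^sub>j\<close> would be annihilated by the right hand side,
  while the left hand side maps it to a nonzero combination of the \<open>u\<^sub>j\<close>. This gives the uniqueness of the Schmidt
  rank as well as the lower bound on the rank of projections.
\<close>

lemma orthonormal_sum_rank_le:
  assumes u: "orthonormal_family d1 n u" and v: "orthonormal_family d2 n v" and l: "\<And>i. i < n \<Longrightarrow> l i \<noteq> 0"
    and e: "\<And>p s. p < d1 \<Longrightarrow> s < d2 \<Longrightarrow> (\<Sum>i<n. l i * u i p * v i s) = (\<Sum>t<k. x t p * y t s)"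
  shows "n \<le> k"
proof (rule ccontr)
  assume "\<not> n \<le> k"
  hence "k < n" by simp
  from homogeneous_system_nontrivial[OF this, of "\<lambda>t j. cinner d2 (y t) (v j)"]
  obtain c j0 where c: "\<And>t. t < k \<Longrightarrow> (\<Sum>j<n. cinner d2 (y t) (v j) * c j) = 0" and j0: "j0 < n" "c j0 \<noteq> 0"
    by auto
  have col: "(\<Sum>j<n. c j * l j * u j p) = 0" if p: "p < d1" for p
  proof -
    have "(\<Sum>j<n. c j * cinner d2 (\<lambda>s. \<Sum>i<n. l i * u i p * v i s) (v j))
        = (\<Sum>j<n. c j * cinner d2 (\<lambda>s. \<Sum>t<k. x t p * y t s) (v j))"
      using e[OF p] by (simp add: cinner_def)
    also have "\<dots> = (\<Sum>j<n. c j * (\<Sum>t<k. x t p * cinner d2 (y t) (v j)))"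
      by (simp only: cinner_sum_left cinner_scale_left)
    also have "\<dots> = (\<Sum>t<k. x t p * (\<Sum>j<n. cinner d2 (y t) (v j) * c j))"
      unfolding sum_distrib_left by (subst sum.swap) (simp add: mult_ac)
    also have "\<dots> = 0" using c by simp
    finally have "(\<Sum>j<n. c j * cinner d2 (\<lambda>s. \<Sum>i<n. l i * u i p * v i s) (v j)) = 0" .
    moreover have "cinner d2 (\<lambda>s. \<Sum>i<n. l i * u i p * v i s) (v j) = l j * u j p" if j: "j < n" for j
    proof -
      have "cinner d2 (\<lambda>s. \<Sum>i<n. l i * u i p * v i s) (v j) = (\<Sum>i<n. l i * u i p * cinner d2 (v i) (v j))"
        by (simp only: cinner_sum_left cinner_scale_left)
      also have "\<dots> = (\<Sum>i<n. if i = j then l j * u j p else 0)"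
        using v j by (intro sum.cong refl) (auto simp: orthonormal_family_def)
      finally show ?thesis using j by simp
    qed
    ultimately show ?thesis by (simp add: mult.assoc)
  qed
  have "c j0 * l j0 = (\<Sum>j<n. if j = j0 then c j * l j else 0)" using j0 by simp
  also have "\<dots> = (\<Sum>j<n. c j * l j * cinner d1 (u j) (u j0))"
    using u j0 by (intro sum.cong refl) (auto simp: orthonormal_family_def)
  also have "\<dots> = (\<Sum>p<d1. (\<Sum>j<n. c j * l j * u j p) * cnj (u j0 p))"
    unfolding cinner_def sum_distrib_right sum_distrib_left by (subst sum.swap) (simp add: mult.assoc)
  also have "\<dots> = 0" using col by simp
  finally show False using j0 l by simp
qed

text \<open>
  The \<open>v\<^sub>i\<close> are eigenvectors of the Hermitian matrix \<open>A = M\<^sup>T (cnj M)\<close> and \<open>w\<^sub>i = M (cnj v\<^sub>i)\<close>. The vectors \<open>w\<^sub>i\<close>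
  are orthogonal because \<open>\<langle>w\<^sub>i, w\<^sub>j\<rangle> = \<langle>A v\<^sub>j, v\<^sub>i\<rangle>\<close>.
\<close>

lemma singular_value_expansion:
  fixes M :: "nat \<Rightarrow> nat \<Rightarrow> complex"
  shows "\<exists>v w lam. orthonormal_family d2 d2 v \<and> (\<forall>p<d1. \<forall>r<d2. M p r = (\<Sum>i<d2. w i p * v i r)) \<and>
    (\<forall>i<d2. \<forall>j<d2. cinner d1 (w i) (w j) = (if i = j then of_real (lam i :: real) else 0))"
proof -
  define A where "A r s = (\<Sum>p<d1. M p r * cnj (M p s))" for r s
  have "hermitian_fun d2 A" by (simp add: hermitian_fun_def A_def mult.commute)
  from hermitian_eigenbasis[OF this] obtain v lam where v: "orthonormal_family d2 d2 v"
    and ev: "\<forall>i<d2. \<forall>r<d2. (\<Sum>s<d2. A r s * v i s) = of_real (lam i) * v i r"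
    by (elim exE conjE)
  define w where "w i p = (\<Sum>s<d2. M p s * cnj (v i s))" for i p
  have "M p r = (\<Sum>i<d2. w i p * v i r)" if "r < d2" for p r
    using orthonormal_basis_expand[OF v that, of "M p"] by (simp add: w_def cinner_def)
  moreover have "cinner d1 (w i) (w j) = (if i = j then of_real (lam i) else 0)" if ij: "i < d2" "j < d2" for i j
  proof -
    have "cinner d1 (w i) (w j) = (\<Sum>p<d1. \<Sum>s<d2. \<Sum>t<d2. M p s * cnj (v i s) * (cnj (M p t) * v j t))"
      unfolding cinner_def w_def by (simp add: sum_product)
    also have "\<dots> = (\<Sum>s<d2. \<Sum>p<d1. \<Sum>t<d2. M p s * cnj (v i s) * (cnj (M p t) * v j t))"
      by (rule sum.swap)
    also have "\<dots> = (\<Sum>s<d2. \<Sum>t<d2. \<Sum>p<d1. M p s * cnj (v i s) * (cnj (M p t) * v j t))"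
      by (intro sum.cong refl sum.swap)
    also have "\<dots> = (\<Sum>s<d2. cnj (v i s) * (\<Sum>t<d2. A s t * v j t))"
      unfolding A_def sum_distrib_left sum_distrib_right by (intro sum.cong refl) (simp add: mult_ac)
    also have "\<dots> = (\<Sum>s<d2. cnj (v i s) * (of_real (lam j) * v j s))"
      using ev ij by (intro sum.cong refl) simp
    also have "\<dots> = of_real (lam j) * cinner d2 (v j) (v i)"
      by (simp add: cinner_def sum_distrib_left mult_ac)
    finally show ?thesis using v ij by (auto simp: orthonormal_family_def)
  qed
  ultimately have "orthonormal_family d2 d2 v \<and> (\<forall>p<d1. \<forall>r<d2. M p r = (\<Sum>i<d2. w i p * v i r)) \<and>
    (\<forall>i<d2. \<forall>j<d2. cinner d1 (w i) (w j) = (if i = j then of_real (lam i) else 0))"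
    using v by simp
  thus ?thesis by (intro exI)
qed

text \<open>
  In the expansion the \<open>w\<^sub>i\<close> with eigenvalue \<open>0\<close> vanish, and the others are normalized.
\<close>

lemma singular_value_decomposition:
  fixes M :: "nat \<Rightarrow> nat \<Rightarrow> complex"
  shows "\<exists>n u v lam. orthonormal_family d1 n u \<and> orthonormal_family d2 n v \<and> (\<forall>i<n. (0::real) < lam i) \<and>
    (\<forall>p<d1. \<forall>r<d2. M p r = (\<Sum>i<n. of_real (lam i) * u i p * v i r))"
proof -
  obtain v w lam where v: "orthonormal_family d2 d2 v" and M: "\<forall>p<d1. \<forall>r<d2. M p r = (\<Sum>i<d2. w i p * v i r)"
    and w: "\<forall>i<d2. \<forall>j<d2. cinner d1 (w i) (w j) = (if i = j then of_real (lam i :: real) else 0)"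
    using singular_value_expansion[of d2 d1 M] by (elim exE conjE)
  define N where "N = {i. i < d2 \<and> lam i \<noteq> 0}"
  have finN: "finite N" by (simp add: N_def)
  obtain e where e: "bij_betw e {0..<card N} N" using ex_bij_betw_nat_finite[OF finN] by auto
  let ?n = "card N"
  have sq: "of_real (lam i) = (of_real (\<Sum>p<d1. (cmod (w i p))\<^sup>2) :: complex)" if "i < d2" for i
    using w that cinner_self[of d1 "w i"] by simp
  have lam0: "lam i = (\<Sum>p<d1. (cmod (w i p))\<^sup>2)" if "i < d2" for i
    using sq[OF that] by (simp only: of_real_eq_iff)
  have w0: "w i p = 0" if "i < d2" "i \<notin> N" "p < d1" for i p
  proof -
    have "(\<Sum>p<d1. (cmod (w i p))\<^sup>2) = 0" using lam0[OF that(1)] that(1,2) by (simp add: N_def)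
    hence "\<forall>p\<in>{..<d1}. (cmod (w i p))\<^sup>2 = 0" by (subst (asm) sum_nonneg_eq_0_iff) auto
    thus ?thesis using that(3) by simp
  qed
  have lampos: "0 < lam i" if "i \<in> N" for i
  proof -
    have "0 \<le> lam i" using lam0[of i] that by (simp add: N_def sum_nonneg)
    thus ?thesis using that by (simp add: N_def)
  qed
  have eN: "e i \<in> N" if "i < ?n" for i using bij_betwE[OF e] that by simp
  have einj: "e i = e j \<longleftrightarrow> i = j" if "i < ?n" "j < ?n" for i j
    using bij_betw_imp_inj_on[OF e] that by (auto simp: inj_on_def)
  define u where "u i p = of_real (1 / sqrt (lam (e i))) * w (e i) p" for i p
  have "orthonormal_family d1 ?n u"
    unfolding orthonormal_family_def
  proof (intro allI impI)
    fix i j assume ij: "i < ?n" "j < ?n"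
    have *: "1 / sqrt (lam (e i)) * (1 / sqrt (lam (e i)) * lam (e i)) = 1"
      using lampos[OF eN[OF ij(1)]] by (simp add: field_simps)
    have "cinner d1 (u i) (u j) = of_real (1 / sqrt (lam (e i))) * (of_real (1 / sqrt (lam (e j))) * cinner d1 (w (e i)) (w (e j)))"
      unfolding u_def cinner_scale_left cinner_scale_right complex_cnj_complex_of_real ..
    also have "cinner d1 (w (e i)) (w (e j)) = (if i = j then of_real (lam (e i)) else 0)"
      using w eN[OF ij(1)] eN[OF ij(2)] einj[OF ij] by (simp add: N_def)
    also have "of_real (1 / sqrt (lam (e i))) * (of_real (1 / sqrt (lam (e j))) * (if i = j then of_real (lam (e i)) else 0))
        = (if i = j then 1 else (0::complex))"
    proof (cases "i = j")
      case True
      have "of_real (1 / sqrt (lam (e i))) * (of_real (1 / sqrt (lam (e i))) * of_real (lam (e i))) = (1::complex)"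
        unfolding of_real_mult[symmetric] * by simp
      thus ?thesis unfolding True if_P[OF refl] .
    qed simp
    finally show "cinner d1 (u i) (u j) = (if i = j then 1 else 0)" .
  qed
  moreover have "orthonormal_family d2 ?n (\<lambda>i. v (e i))"
    using v eN einj by (auto simp: orthonormal_family_def N_def)
  moreover have "\<forall>i<?n. 0 < sqrt (lam (e i))" using lampos eN by simp
  moreover have "M p r = (\<Sum>i<?n. of_real (sqrt (lam (e i))) * u i p * v (e i) r)" if pr: "p < d1" "r < d2" for p r
  proof -
    have "M p r = (\<Sum>i<d2. w i p * v i r)" using M pr by blast
    also have "\<dots> = (\<Sum>i\<in>N. w i p * v i r)"
      by (rule sum.mono_neutral_right) (use w0 pr in \<open>auto simp: N_def\<close>)
    also have "\<dots> = (\<Sum>i<?n. w (e i) p * v (e i) r)"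
      using sum.reindex_bij_betw[OF e, of "\<lambda>i. w i p * v i r"] by (simp add: atLeast0LessThan)
    also have "\<dots> = (\<Sum>i<?n. of_real (sqrt (lam (e i))) * u i p * v (e i) r)"
    proof (intro sum.cong refl)
      fix i assume "i \<in> {..<?n}"
      hence "0 < lam (e i)" using lampos eN by simp
      thus "w (e i) p * v (e i) r = of_real (sqrt (lam (e i))) * u i p * v (e i) r" by (simp add: u_def)
    qed
    finally show ?thesis .
  qed
  ultimately show ?thesis
    by (rule_tac exI[of _ ?n], rule_tac exI[of _ u], rule_tac exI[of _ "\<lambda>i. v (e i)"],
        rule_tac exI[of _ "\<lambda>i. sqrt (lam (e i))"]) simp
qed

section \<open>Schmidt rank\<close>

lemma cscalar_prod_eq_cinner:
  "v \<in> carrier_vec d \<Longrightarrow> u \<bullet>c v = cinner d (\<lambda>j. u $ j) (\<lambda>j. v $ j)"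
  by (auto simp: scalar_prod_def cinner_def atLeast0LessThan)

lemma orthonormal_imp_family: "orthonormal d n u \<Longrightarrow> orthonormal_family d n (\<lambda>i j. u i $ j)"
  unfolding orthonormal_def orthonormal_family_def by (metis cscalar_prod_eq_cinner)

lemma family_imp_orthonormal:
  assumes "orthonormal_family d n u"
  shows "orthonormal d n (\<lambda>i. vec d (u i))"
proof -
  have "vec d (u i) \<bullet>c vec d (u j) = cinner d (u i) (u j)" for i j
    unfolding cscalar_prod_eq_cinner[OF vec_carrier] by (simp add: cinner_def)
  thus ?thesis using assms by (simp add: orthonormal_def orthonormal_family_def)
qed

lemma kron_vec_index:
  "u \<in> carrier_vec m \<Longrightarrow> v \<in> carrier_vec d \<Longrightarrow> p < m \<Longrightarrow> r < d \<Longrightarrow> kron_vec u v $ (p * d + r) = u $ p * v $ r"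
  using block_index_less[of p m r d] by (auto simp: kron_vec_def)

lemma schmidt_decomposition_index:
  assumes S: "schmidt_decomposition d1 d2 \<xi> n lam u v" and pr: "p < d1" "r < d2"
  shows "\<xi> $ (p * d2 + r) = (\<Sum>i<n. of_real (lam i) * (u i $ p) * (v i $ r))"
proof -
  have u: "u i \<in> carrier_vec d1" "v i \<in> carrier_vec d2" if "i < n" for i
    using S that by (auto simp: schmidt_decomposition_def orthonormal_def)
  have "\<xi> = vec (d1 * d2) (\<lambda>a. \<Sum>i<n. of_real (lam i) * kron_vec (u i) (v i) $ a)"
    using S by (simp add: schmidt_decomposition_def)
  hence "\<xi> $ (p * d2 + r) = vec (d1 * d2) (\<lambda>a. \<Sum>i<n. of_real (lam i) * kron_vec (u i) (v i) $ a) $ (p * d2 + r)"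
    by simp
  also have "\<dots> = (\<Sum>i<n. of_real (lam i) * kron_vec (u i) (v i) $ (p * d2 + r))"
    using block_index_less[OF pr] by simp
  also have "\<dots> = (\<Sum>i<n. of_real (lam i) * (u i $ p) * (v i $ r))"
    using kron_vec_index[OF u pr] by (intro sum.cong refl) simp
  finally show ?thesis .
qed

text \<open>
  The Schmidt decomposition is the singular value decomposition of the coefficient matrix.
\<close>

lemma schmidt_decomposition_ex:
  assumes \<xi>: "\<xi> \<in> carrier_vec (d1 * d2)"
  shows "\<exists>n lam u v. schmidt_decomposition d1 d2 \<xi> n lam u v"
proof -
  obtain n u v lam where u: "orthonormal_family d1 n u" and v: "orthonormal_family d2 n v" and l: "\<forall>i<n. (0::real) < lam i"
    and e: "\<forall>p<d1. \<forall>r<d2. \<xi> $ (p * d2 + r) = (\<Sum>i<n. of_real (lam i) * u i p * v i r)"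
    using singular_value_decomposition[of d1 d2 "\<lambda>p r. \<xi> $ (p * d2 + r)"] by (elim exE conjE)
  have "\<xi> = vec (d1 * d2) (\<lambda>a. \<Sum>i<n. of_real (lam i) * kron_vec (vec d1 (u i)) (vec d2 (v i)) $ a)"
  proof (rule eq_vecI)
    fix a assume "a < dim_vec (vec (d1 * d2) (\<lambda>a. \<Sum>i<n. of_real (lam i) * kron_vec (vec d1 (u i)) (vec d2 (v i)) $ a))"
    hence a: "a < d1 * d2" by simp
    then obtain p r where pr: "p < d1" "r < d2" "a = p * d2 + r" by (rule block_cases)
    show "\<xi> $ a = vec (d1 * d2) (\<lambda>a. \<Sum>i<n. of_real (lam i) * kron_vec (vec d1 (u i)) (vec d2 (v i)) $ a) $ a"
      using e a pr kron_vec_index[OF vec_carrier vec_carrier pr(1,2)] by (simp add: mult.assoc)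
  qed (use \<xi> in simp)
  hence "schmidt_decomposition d1 d2 \<xi> n lam (\<lambda>i. vec d1 (u i)) (\<lambda>i. vec d2 (v i))"
    using family_imp_orthonormal[OF u] family_imp_orthonormal[OF v] l
    by (simp add: schmidt_decomposition_def less_imp_le)
  thus ?thesis by (intro exI)
qed

text \<open>
  The vanishing coefficients are dropped, since \<open>orthonormal_sum_rank_le\<close> applies to nonzero ones only.
\<close>

lemma schmidt_decomposition_nonzero:
  assumes S: "schmidt_decomposition d1 d2 \<xi> n lam u v"
  defines "r \<equiv> card {i. i < n \<and> lam i \<noteq> 0}"
  shows "\<exists>l u' v'. orthonormal_family d1 r u' \<and> orthonormal_family d2 r v' \<and> (\<forall>i<r. l i \<noteq> 0) \<and>
    (\<forall>p<d1. \<forall>s<d2. \<xi> $ (p * d2 + s) = (\<Sum>i<r. (l i :: complex) * u' i p * v' i s))"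
proof -
  let ?N = "{i. i < n \<and> lam i \<noteq> 0}"
  obtain e where e: "bij_betw e {0..<r} ?N" using ex_bij_betw_nat_finite[of ?N] r_def by auto
  have eN: "e i < n" "lam (e i) \<noteq> 0" if "i < r" for i using bij_betwE[OF e] that by auto
  have einj: "e i = e j \<longleftrightarrow> i = j" if "i < r" "j < r" for i j
    using bij_betw_imp_inj_on[OF e] that by (auto simp: inj_on_def)
  have uv: "orthonormal_family d1 n (\<lambda>i j. u i $ j)" "orthonormal_family d2 n (\<lambda>i j. v i $ j)"
    using S by (auto simp: schmidt_decomposition_def intro: orthonormal_imp_family)
  have "orthonormal_family d1 r (\<lambda>i j. u (e i) $ j)" "orthonormal_family d2 r (\<lambda>i j. v (e i) $ j)"
    using uv eN einj by (auto simp: orthonormal_family_def)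
  moreover have "\<forall>i<r. complex_of_real (lam (e i)) \<noteq> 0" using eN by simp
  moreover have "\<xi> $ (p * d2 + s) = (\<Sum>i<r. of_real (lam (e i)) * (u (e i) $ p) * (v (e i) $ s))"
    if ps: "p < d1" "s < d2" for p s
  proof -
    have "\<xi> $ (p * d2 + s) = (\<Sum>i<n. of_real (lam i) * (u i $ p) * (v i $ s))"
      by (rule schmidt_decomposition_index[OF S ps])
    also have "\<dots> = (\<Sum>i\<in>?N. of_real (lam i) * (u i $ p) * (v i $ s))"
      by (rule sum.mono_neutral_right) auto
    also have "\<dots> = (\<Sum>i<r. of_real (lam (e i)) * (u (e i) $ p) * (v (e i) $ s))"
      using sum.reindex_bij_betw[OF e, of "\<lambda>i. of_real (lam i) * (u i $ p) * (v i $ s)"] by (simp add: atLeast0LessThan)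
    finally show ?thesis .
  qed
  ultimately show ?thesis
    by (rule_tac exI[of _ "\<lambda>i. complex_of_real (lam (e i))"], rule_tac exI[of _ "\<lambda>i j. u (e i) $ j"], rule_tac exI[of _ "\<lambda>i j. v (e i) $ j"]) simp
qed

lemma schmidt_rank_eq:
  assumes S: "schmidt_decomposition d1 d2 \<xi> n lam u v"
  shows "schmidt_rank d1 d2 \<xi> = card {i. i < n \<and> lam i \<noteq> 0}"
  unfolding schmidt_rank_def
proof (rule the_equality)
  have le: "card {i. i < n \<and> lam i \<noteq> 0} \<le> card {i. i < n' \<and> lam' i \<noteq> 0}"
    if S: "schmidt_decomposition d1 d2 \<xi> n lam u v" and S': "schmidt_decomposition d1 d2 \<xi> n' lam' u' v'"
    for n n' lam lam' u u' v v'
  proof -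
    let ?r = "card {i. i < n \<and> lam i \<noteq> 0}" and ?r' = "card {i. i < n' \<and> lam' i \<noteq> 0}"
    obtain l x y where 1: "orthonormal_family d1 ?r x" "orthonormal_family d2 ?r y" "\<forall>i<?r. l i \<noteq> 0"
      and e: "\<forall>p<d1. \<forall>s<d2. \<xi> $ (p * d2 + s) = (\<Sum>i<?r. (l i :: complex) * x i p * y i s)"
      using schmidt_decomposition_nonzero[OF S] by (elim exE conjE)
    obtain l' x' y' where
      e': "\<forall>p<d1. \<forall>s<d2. \<xi> $ (p * d2 + s) = (\<Sum>i<?r'. (l' i :: complex) * x' i p * y' i s)"
      using schmidt_decomposition_nonzero[OF S'] by (elim exE conjE)
    show ?thesis
      by (rule orthonormal_sum_rank_le[OF 1(1,2), where l = l and x = "\<lambda>i p. l' i * x' i p" and y = y']) (use 1(3) e e' in auto)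
  qed
  show "\<exists>n' lam' u' v'. schmidt_decomposition d1 d2 \<xi> n' lam' u' v' \<and>
      card {i. i < n \<and> lam i \<noteq> 0} = card {i. i < n' \<and> lam' i \<noteq> 0}"
    using S by (intro exI conjI) (assumption, rule refl)
  fix r assume "\<exists>n' lam' u' v'. schmidt_decomposition d1 d2 \<xi> n' lam' u' v' \<and> r = card {i. i < n' \<and> lam' i \<noteq> 0}"
  then obtain n' lam' u' v' where S': "schmidt_decomposition d1 d2 \<xi> n' lam' u' v'"
    and r: "r = card {i. i < n' \<and> lam' i \<noteq> 0}" by (elim exE conjE)
  show "r = card {i. i < n \<and> lam i \<noteq> 0}" unfolding r using le[OF S S'] le[OF S' S] by simp
qed

text \<open>
  The Schmidt rank is the tensor rank: by \<open>orthonormal_sum_rank_le\<close> no other sum of product vectors is shorter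
  than the Schmidt decomposition.
\<close>

lemma schmidt_rank_le_iff:
  assumes \<xi>: "\<xi> \<in> carrier_vec (d1 * d2)"
  shows "schmidt_rank d1 d2 \<xi> \<le> k \<longleftrightarrow>
    (\<exists>x y. \<forall>p<d1. \<forall>s<d2. \<xi> $ (p * d2 + s) = (\<Sum>t<k. x t p * y t s))"
proof -
  obtain n lam u v where S: "schmidt_decomposition d1 d2 \<xi> n lam u v"
    using schmidt_decomposition_ex[OF \<xi>] by (elim exE)
  let ?r = "card {i. i < n \<and> lam i \<noteq> 0}"
  obtain l x y where 1: "orthonormal_family d1 ?r x" "orthonormal_family d2 ?r y" "\<forall>i<?r. l i \<noteq> 0"
    and e: "\<forall>p<d1. \<forall>s<d2. \<xi> $ (p * d2 + s) = (\<Sum>i<?r. (l i :: complex) * x i p * y i s)"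
    using schmidt_decomposition_nonzero[OF S] by (elim exE conjE)
  have "?r \<le> k \<longleftrightarrow> (\<exists>x y. \<forall>p<d1. \<forall>s<d2. \<xi> $ (p * d2 + s) = (\<Sum>t<k. x t p * y t s))"
  proof
    assume r: "?r \<le> k"
    have "(\<Sum>t<k. (if t < ?r then l t * x t p else 0) * y t s) = (\<Sum>i<?r. l i * x i p * y i s)" for p s
      by (rule sum.mono_neutral_cong_right) (use r in auto)
    hence "\<forall>p<d1. \<forall>s<d2. \<xi> $ (p * d2 + s) = (\<Sum>t<k. (if t < ?r then l t * x t p else 0) * y t s)"
      using e by simp
    thus "\<exists>x y. \<forall>p<d1. \<forall>s<d2. \<xi> $ (p * d2 + s) = (\<Sum>t<k. x t p * y t s)"
      by (rule_tac exI[of _ "\<lambda>t p. if t < ?r then l t * x t p else 0"], rule_tac exI[of _ y])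
  next
    assume "\<exists>x y. \<forall>p<d1. \<forall>s<d2. \<xi> $ (p * d2 + s) = (\<Sum>t<k. x t p * y t s)"
    then obtain x' y' where e': "\<forall>p<d1. \<forall>s<d2. \<xi> $ (p * d2 + s) = (\<Sum>t<k. x' t p * y' t s)" by (elim exE)
    show "?r \<le> k" by (rule orthonormal_sum_rank_le[OF 1(1,2), where l = l and x = x' and y = y']) (use 1(3) e e' in auto)
  qed
  thus ?thesis using schmidt_rank_eq[OF S] by simp
qed

section \<open>Rank factorizations\<close>

abbreviation factors_through :: "nat \<Rightarrow> nat \<Rightarrow> nat \<Rightarrow> complex mat \<Rightarrow> bool" where
  "factors_through k m a V \<equiv> \<exists>X\<in>carrier_mat m k. \<exists>Y\<in>carrier_mat k a. V = X * Y"

text \<open>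
  Columns of \<open>V\<close> which form a maximal independent set make up \<open>X\<close>, and \<open>Y\<close> contains the coefficients of all
  columns of \<open>V\<close> in terms of them.
\<close>

lemma rank_factorization:
  fixes V :: "complex mat"
  assumes V: "V \<in> carrier_mat m a" and r: "vec_space.rank m V \<le> k"
  shows "factors_through k m a V"
proof -
  interpret vec_space "TYPE(complex)" m .
  have cV: "set (cols V) \<subseteq> carrier_vec m" using V cols_dim by blast
  obtain S where S: "maximal S (\<lambda>T. T \<subseteq> set (cols V) \<and> lin_indpt T)"
    using maximal_exists[of "(\<lambda>T. T \<subseteq> set (cols V) \<and> lin_indpt T)" "card (set (cols V))" "{}"]
    by (meson List.finite_set card_mono empty_iff empty_subsetI finite_lin_indpt2 rev_finite_subset)
  have SV: "S \<subseteq> set (cols V)" and li: "lin_indpt S" using S by (auto simp: maximal_def)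
  have Sc: "S \<subseteq> carrier_vec m" using SV cV by auto
  have finS: "finite S" using SV finite_subset by blast
  have cS: "card S \<le> k" using rank_card_indpt[OF V S] r by simp
  have span: "c \<in> span S" if c: "c \<in> set (cols V)" for c
  proof (rule ccontr)
    assume n: "c \<notin> span S"
    hence "c \<notin> S" using span_mem Sc by auto
    moreover have "lin_indpt (S \<union> {c})"
      using lin_dep_iff_in_span[of S c] n \<open>c \<notin> S\<close> Sc li c cV by auto
    ultimately show False using S c SV unfolding maximal_def by (metis Un_insert_right insertI1 insert_subset subset_insertI sup_bot_right)
  qed
  have "\<exists>f. c = lincomb f S" if "c \<in> set (cols V)" for c
    using span[OF that] finite_span[OF finS] Sc by auto
  hence "\<forall>j\<in>{..<a}. \<exists>f. col V j = lincomb f S" using V by (auto simp: cols_def)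
  from bchoice[OF this] obtain f where f: "\<forall>j\<in>{..<a}. col V j = lincomb (f j) S" by (elim exE)
  obtain e where e: "bij_betw e {0..<card S} S" using ex_bij_betw_nat_finite[OF finS] by auto
  define X where "X = mat m k (\<lambda>(i, t). if t < card S then e t $ i else 0)"
  define Y where "Y = mat k a (\<lambda>(t, j). f j (e t))"
  have "V = X * Y"
  proof (rule eq_matI)
    fix i j assume "i < dim_row (X * Y)" "j < dim_col (X * Y)"
    hence ij: "i < m" "j < a" by (auto simp: X_def Y_def)
    have "V $$ (i, j) = col V j $ i" using V ij by simp
    also have "\<dots> = (\<Sum>v\<in>S. f j v * v $ i)" using f ij lincomb_index[OF ij(1) Sc] by simp
    also have "\<dots> = (\<Sum>t<card S. f j (e t) * e t $ i)"
      using sum.reindex_bij_betw[OF e, of "\<lambda>v. f j v * v $ i"] by (simp add: atLeast0LessThan)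
    also have "\<dots> = (\<Sum>t<k. X $$ (i, t) * Y $$ (t, j))"
      by (rule sum.mono_neutral_cong_left) (use cS ij in \<open>auto simp: X_def Y_def\<close>)
    also have "\<dots> = (X * Y) $$ (i, j)" using ij by (simp add: X_def Y_def scalar_prod_def atLeast0LessThan)
    finally show "V $$ (i, j) = (X * Y) $$ (i, j)" .
  qed (use V in \<open>auto simp: X_def Y_def\<close>)
  moreover have "X \<in> carrier_mat m k" "Y \<in> carrier_mat k a" by (auto simp: X_def Y_def)
  ultimately show ?thesis by blast
qed

lemma rank_sum_outer_le:
  fixes f :: "nat \<Rightarrow> complex vec"
  assumes "finite J" "\<And>i. i \<in> J \<Longrightarrow> f i \<in> carrier_vec a"
  shows "vec_space.rank a (mat_sum a a (\<lambda>i. outer (f i) (f i)) J) \<le> card J"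
  using assms
proof (induction J rule: finite_induct)
  case empty
  interpret vec_space "TYPE(complex)" a .
  have "mat_sum a a (\<lambda>i. outer (f i) (f i)) {} = 0\<^sub>m a a" by (intro eq_matI) auto
  thus ?case using rank_0I by simp
next
  case (insert x J)
  interpret vec_space "TYPE(complex)" a .
  have x: "outer (f x) (f x) \<in> carrier_mat a a" using insert.prems by (intro outer_carrier) auto
  have "mat_sum a a (\<lambda>i. outer (f i) (f i)) (insert x J) = outer (f x) (f x) + mat_sum a a (\<lambda>i. outer (f i) (f i)) J"
    using insert.hyps x by (intro eq_matI) auto
  moreover have "rank (outer (f x) (f x)) \<le> 1"
    by (rule rank_le_1_product_entries[OF x, of "\<lambda>r. f x $ r" "\<lambda>c. cnj (f x $ c)"])
      (use insert.prems x in \<open>auto simp: outer_def\<close>)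
  moreover have "rank (mat_sum a a (\<lambda>i. outer (f i) (f i)) J) \<le> card J" using insert by auto
  ultimately show ?case using rank_subadditive[OF x mat_sum_carrier[of a a "\<lambda>i. outer (f i) (f i)" J]] insert.hyps by simp
qed

text \<open>
  \<open>P\<close> projects onto a space of dimension \<open>min k a\<close> which contains the range of the adjoint of \<open>V\<close>. This
  space is spanned by the conjugates of the right singular vectors of \<open>V\<close>, with vectors of an orthonormal basis
  added if \<open>V\<close> has smaller rank. Projections of one fixed rank suffice because of the added vectors.
\<close>

lemma projection_fixing_rows:
  fixes V :: "complex mat"
  assumes V: "V \<in> carrier_mat k a"
  shows "\<exists>P. orth_projection a P \<and> vec_space.rank a P = min k a \<and> V * P = V"
proof -
  obtain n u v' l where uv: "orthonormal_family k n u" "orthonormal_family a n v'" "\<forall>i<n. (0::real) < l i"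
    and e': "\<forall>p<k. \<forall>r<a. V $$ (p, r) = (\<Sum>i<n. of_real (l i) * u i p * v' i r)"
    using singular_value_decomposition[of k a "\<lambda>p r. V $$ (p, r)"] by (elim exE conjE)
  have nk: "n \<le> k"
  proof (rule orthonormal_sum_rank_le[OF uv(1,2), where l = "\<lambda>i. of_real (l i)"
      and x = "\<lambda>t p. if p = t then 1 else 0" and y = "\<lambda>t s. V $$ (t, s)"])
    fix p s assume "p < k" "s < a"
    moreover have "(\<Sum>t<k. (if p = t then 1 else 0) * V $$ (t, s)) = (\<Sum>t<k. if t = p then V $$ (p, s) else 0)"
      by (intro sum.cong refl) auto
    ultimately show "(\<Sum>i<n. of_real (l i) * u i p * v' i s) = (\<Sum>t<k. (if p = t then 1 else 0) * V $$ (t, s))"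
      using e' by simp
  qed (use uv(3) in auto)
  have na: "n \<le> a"
  proof (rule orthonormal_sum_rank_le[OF uv(1,2), where l = "\<lambda>i. of_real (l i)"
      and x = "\<lambda>t p. V $$ (p, t)" and y = "\<lambda>t s. if s = t then 1 else 0"])
    fix p s assume "p < k" "s < a"
    moreover have "(\<Sum>t<a. V $$ (p, t) * (if s = t then 1 else 0)) = (\<Sum>t<a. if t = s then V $$ (p, s) else 0)"
      by (intro sum.cong refl) auto
    ultimately show "(\<Sum>i<n. of_real (l i) * u i p * v' i s) = (\<Sum>t<a. V $$ (p, t) * (if s = t then 1 else 0))"
      using e' by simp
  qed (use uv(3) in auto)
  obtain v0 where v0: "orthonormal_family a a v0" and v0v: "\<forall>i<n. v0 i = v' i" using orthonormal_family_extend[OF uv(2) na] by blast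
  define h where "h = min k a"
  have nh: "n \<le> h" "h \<le> a" using nk na by (auto simp: h_def)
  define f where "f i = vec a (\<lambda>r. cnj (v0 i r))" for i
  define P where "P = mat_sum a a (\<lambda>i. outer (f i) (f i)) {..<h}"
  have fc: "f i \<in> carrier_vec a" for i by (simp add: f_def)
  have P: "P \<in> carrier_mat a a" by (simp add: P_def)
  have Pi: "P $$ (r, s) = (\<Sum>i<h. cnj (v0 i r) * v0 i s)" if "r < a" "s < a" for r s
    using that by (simp add: P_def outer_index[OF fc fc]) (simp add: f_def)
  have ortho: "(\<Sum>t<a. v0 i t * cnj (v0 j t)) = (if i = j then 1 else 0)" if "i < a" "j < a" for i j
    using v0 that by (simp add: orthonormal_family_def cinner_def)
  have act: "(\<Sum>t<a. v0 i t * P $$ (t, s)) = (if i < h then v0 i s else 0)" if "i < a" "s < a" for i s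
  proof -
    have "(\<Sum>t<a. v0 i t * P $$ (t, s)) = (\<Sum>t<a. \<Sum>j<h. v0 i t * cnj (v0 j t) * v0 j s)"
      using that by (intro sum.cong refl) (simp add: Pi sum_distrib_left mult.assoc)
    also have "\<dots> = (\<Sum>j<h. (\<Sum>t<a. v0 i t * cnj (v0 j t)) * v0 j s)"
      unfolding sum_distrib_right by (rule sum.swap)
    also have "\<dots> = (\<Sum>j<h. if j = i then v0 i s else 0)"
      using that nh ortho by (intro sum.cong refl) auto
    finally show ?thesis by auto
  qed
  have PP: "P * P = P"
  proof (rule eq_matI)
    fix r s assume "r < dim_row P" "s < dim_col P"
    hence rs: "r < a" "s < a" using P by auto
    have "(P * P) $$ (r, s) = (\<Sum>t<a. (\<Sum>i<h. cnj (v0 i r) * v0 i t) * P $$ (t, s))"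
      using P rs Pi by (simp add: scalar_prod_def atLeast0LessThan)
    also have "\<dots> = (\<Sum>i<h. cnj (v0 i r) * (\<Sum>t<a. v0 i t * P $$ (t, s)))"
      unfolding sum_distrib_right sum_distrib_left by (subst sum.swap) (simp add: mult.assoc)
    also have "\<dots> = (\<Sum>i<h. cnj (v0 i r) * v0 i s)"
      using nh rs by (intro sum.cong refl) (simp add: act)
    finally show "(P * P) $$ (r, s) = P $$ (r, s)" using Pi[OF rs] by simp
  qed (use P in auto)
  have adj: "mat_adjoint P = P"
    using mat_adjoint_carrier[OF P] P
    by (intro eq_matI) (auto simp: mat_adjoint_index[OF P] Pi mult.commute)
  have VP: "V * P = V"
  proof (rule eq_matI)
    fix p s assume "p < dim_row V" "s < dim_col V"
    hence ps: "p < k" "s < a" using V by auto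
    have "(V * P) $$ (p, s) = (\<Sum>t<a. (\<Sum>i<n. of_real (l i) * u i p * v0 i t) * P $$ (t, s))"
      using V P ps e' v0v by (simp add: scalar_prod_def atLeast0LessThan)
    also have "\<dots> = (\<Sum>i<n. of_real (l i) * u i p * (\<Sum>t<a. v0 i t * P $$ (t, s)))"
      unfolding sum_distrib_right sum_distrib_left by (subst sum.swap) (simp add: mult.assoc)
    also have "\<dots> = (\<Sum>i<n. of_real (l i) * u i p * v0 i s)"
      using nh ps by (intro sum.cong refl) (simp add: act)
    also have "\<dots> = (\<Sum>i<n. of_real (l i) * u i p * v' i s)" using v0v by simp
    finally show "(V * P) $$ (p, s) = V $$ (p, s)" using e' ps by simp
  qed (use V P in auto)
  have "vec_space.rank a P \<le> h"
    using rank_sum_outer_le[of "{..<h}" f a] fc by (simp add: P_def)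
  moreover have "h \<le> vec_space.rank a P"
  proof -
    obtain X Y where X: "X \<in> carrier_mat a (vec_space.rank a P)" and Y: "Y \<in> carrier_mat (vec_space.rank a P) a"
      and XY: "P = X * Y" using rank_factorization[OF P order_refl] by (elim bexE)
    have o1: "orthonormal_family a h (\<lambda>i r. cnj (v0 i r))"
      unfolding orthonormal_family_def
    proof (intro allI impI)
      fix i j assume "i < h" "j < h"
      hence "i < a" "j < a" using nh by auto
      have "cinner a (\<lambda>r. cnj (v0 i r)) (\<lambda>r. cnj (v0 j r)) = (\<Sum>t<a. v0 j t * cnj (v0 i t))"
        by (simp add: cinner_def mult.commute)
      also have "\<dots> = (if j = i then 1 else 0)" by (rule ortho) fact+
      finally show "cinner a (\<lambda>r. cnj (v0 i r)) (\<lambda>r. cnj (v0 j r)) = (if i = j then 1 else 0)" by auto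
    qed
    have o2: "orthonormal_family a h v0" using v0 nh by (auto simp: orthonormal_family_def)
    show ?thesis
    proof (rule orthonormal_sum_rank_le[OF o1 o2, where l = "\<lambda>_. 1"
        and x = "\<lambda>t p. X $$ (p, t)" and y = "\<lambda>t s. Y $$ (t, s)"])
      fix p s assume ps: "p < a" "s < a"
      have "P $$ (p, s) = (\<Sum>t<vec_space.rank a P. X $$ (p, t) * Y $$ (t, s))"
        unfolding arg_cong[OF XY, of "\<lambda>M. M $$ (p, s)"] using X Y ps by (simp add: scalar_prod_def atLeast0LessThan)
      thus "(\<Sum>i<h. 1 * cnj (v0 i p) * v0 i s) = (\<Sum>t<vec_space.rank a P. X $$ (p, t) * Y $$ (t, s))"
        using Pi[OF ps] by simp
    qed simp
  qed
  ultimately have "vec_space.rank a P = h" by simp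
  thus ?thesis using P PP adj VP unfolding orth_projection_def h_def by (intro exI[of _ P]) simp
qed

section \<open>Schmidt number\<close>

lemma kraus_mat_factorization:
  assumes \<xi>: "\<xi> \<in> carrier_vec (m * a)" and r: "schmidt_rank m a \<xi> \<le> k"
  shows "factors_through k m a (kraus_mat m a \<xi>)"
proof -
  obtain x y where e: "\<forall>p<m. \<forall>s<a. \<xi> $ (p * a + s) = (\<Sum>t<k. x t p * y t s)"
    using r unfolding schmidt_rank_le_iff[OF \<xi>] by (elim exE)
  define X where "X = mat m k (\<lambda>(p, t). cnj (x t p))"
  define Y where "Y = mat k a (\<lambda>(t, s). cnj (y t s))"
  have "kraus_mat m a \<xi> = X * Y"
    by (intro eq_matI) (simp_all add: kraus_mat_def X_def Y_def e scalar_prod_def atLeast0LessThan)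
  thus ?thesis by (intro bexI[of _ X] bexI[of _ Y]) (auto simp: X_def Y_def)
qed

text \<open>
  Together with the previous lemma: the Schmidt rank of \<open>kraus_vec V\<close> is at most \<open>k\<close> if and only if \<open>V\<close>
  factors through \<open>\<complex>\<^sup>k\<close>.
\<close>

lemma schmidt_rank_kraus_vec:
  assumes X: "X \<in> carrier_mat m k" and Y: "Y \<in> carrier_mat k a"
  shows "schmidt_rank m a (kraus_vec (X * Y)) \<le> k"
proof -
  have XY: "X * Y \<in> carrier_mat m a" using X Y by simp
  have "\<forall>p<m. \<forall>s<a. kraus_vec (X * Y) $ (p * a + s) = (\<Sum>t<k. cnj (X $$ (p, t)) * cnj (Y $$ (t, s)))"
    using X Y by (auto simp: kraus_vec_index[OF XY] scalar_prod_def atLeast0LessThan)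
  thus ?thesis unfolding schmidt_rank_le_iff[OF kraus_vec_carrier[OF XY]]
    by (rule_tac exI[of _ "\<lambda>t p. cnj (X $$ (p, t))"], rule_tac exI[of _ "\<lambda>t s. cnj (Y $$ (t, s))"])
qed

definition pure_decomposition :: "nat \<Rightarrow> complex mat \<Rightarrow> nat \<Rightarrow> (nat \<Rightarrow> complex vec) \<Rightarrow> bool" where
  "pure_decomposition d X n \<xi> \<longleftrightarrow>
     (\<forall>i<n. \<xi> i \<in> carrier_vec d) \<and> X = mat_sum d d (\<lambda>i. outer (\<xi> i) (\<xi> i)) {..<n}"

definition max_schmidt_rank :: "nat \<Rightarrow> nat \<Rightarrow> nat \<Rightarrow> (nat \<Rightarrow> complex vec) \<Rightarrow> nat" where
  "max_schmidt_rank d1 d2 n \<xi> = Max (insert 1 ((\<lambda>i. schmidt_rank d1 d2 (\<xi> i)) ` {..<n}))"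

lemma max_schmidt_rank_le_iff:
  "max_schmidt_rank d1 d2 n \<xi> \<le> k \<longleftrightarrow> 1 \<le> k \<and> (\<forall>i<n. schmidt_rank d1 d2 (\<xi> i) \<le> k)"
  unfolding max_schmidt_rank_def by (subst Max_le_iff) auto

lemma schmidt_number_eq_Inf:
  "schmidt_number d1 d2 X = Inf {max_schmidt_rank d1 d2 n \<xi> | n \<xi>. pure_decomposition (d1 * d2) X n \<xi>}"
  unfolding schmidt_number_def pure_decomposition_def max_schmidt_rank_def ..

lemma schmidt_number_leI:
  assumes "pure_decomposition (d1 * d2) X n \<xi>" "max_schmidt_rank d1 d2 n \<xi> \<le> k"
  shows "schmidt_number d1 d2 X \<le> k"
proof -
  have "schmidt_number d1 d2 X \<le> max_schmidt_rank d1 d2 n \<xi>"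
    unfolding schmidt_number_eq_Inf by (rule cInf_lower) (use assms(1) in auto)
  thus ?thesis using assms(2) by simp
qed

text \<open>
  Positive semidefiniteness provides a decomposition, so that the infimum is over a nonempty set of natural numbers.
\<close>

lemma schmidt_number_attained:
  assumes X: "psd (d1 * d2) X"
  shows "\<exists>n \<xi>. pure_decomposition (d1 * d2) X n \<xi> \<and> max_schmidt_rank d1 d2 n \<xi> = schmidt_number d1 d2 X"
proof -
  obtain \<xi> where "pure_decomposition (d1 * d2) X (d1 * d2) \<xi>"
    using psd_eq_sum_outer[OF X] unfolding pure_decomposition_def by (elim exE)
  hence "{max_schmidt_rank d1 d2 n \<xi> | n \<xi>. pure_decomposition (d1 * d2) X n \<xi>} \<noteq> {}" by blast
  from Inf_nat_def1[OF this] have "schmidt_number d1 d2 X \<in> {max_schmidt_rank d1 d2 n \<xi> | n \<xi>. pure_decomposition (d1 * d2) X n \<xi>}"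
    unfolding schmidt_number_eq_Inf .
  then obtain n \<xi> where "schmidt_number d1 d2 X = max_schmidt_rank d1 d2 n \<xi>" "pure_decomposition (d1 * d2) X n \<xi>"
    by blast
  thus ?thesis by (intro exI[of _ n] exI[of _ \<xi>]) simp
qed

lemma schmidt_number_eq_1_iff:
  assumes psd: "psd (m * b) X"
  shows "schmidt_number m b X = 1 \<longleftrightarrow> separable m b X"
proof
  assume S1: "schmidt_number m b X = 1"
  obtain n \<xi> where d: "pure_decomposition (m * b) X n \<xi>" and r: "max_schmidt_rank m b n \<xi> = 1"
    using schmidt_number_attained[OF psd] unfolding S1 by (elim exE conjE)
  have \<xi>: "\<forall>i<n. \<xi> i \<in> carrier_vec (m * b) \<and> schmidt_rank m b (\<xi> i) \<le> 1"
    using d max_schmidt_rank_le_iff[of m b n \<xi> 1] r by (simp add: pure_decomposition_def)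
  have X: "X = mat_sum (m * b) (m * b) (\<lambda>i. outer (\<xi> i) (\<xi> i)) {..<n}"
    using d by (simp add: pure_decomposition_def)
  have "\<forall>i\<in>{..<n}. \<exists>x. \<exists>y. \<forall>p<m. \<forall>s<b. \<xi> i $ (p * b + s) = x p * y s"
  proof
    fix i assume "i \<in> {..<n}"
    hence "\<xi> i \<in> carrier_vec (m * b)" "schmidt_rank m b (\<xi> i) \<le> 1" using \<xi> by auto
    hence "\<exists>x y. \<forall>p<m. \<forall>s<b. \<xi> i $ (p * b + s) = (\<Sum>t<1::nat. x t p * y t s)"
      by (simp only: schmidt_rank_le_iff)
    then obtain x y where "\<forall>p<m. \<forall>s<b. \<xi> i $ (p * b + s) = (\<Sum>t<1::nat. x t p * y t s)"
      by (elim exE)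
    thus "\<exists>x y. \<forall>p<m. \<forall>s<b. \<xi> i $ (p * b + s) = x p * y s"
      by (rule_tac exI[of _ "x 0"], rule_tac exI[of _ "y 0"]) simp
  qed
  from bchoice[OF this] obtain x where "\<forall>i\<in>{..<n}. \<exists>y. \<forall>p<m. \<forall>s<b. \<xi> i $ (p * b + s) = x i p * y s" by (elim exE)
  from bchoice[OF this] obtain y where e: "\<forall>i\<in>{..<n}. \<forall>p<m. \<forall>s<b. \<xi> i $ (p * b + s) = x i p * y i s" by (elim exE)
  show "separable m b X"
  proof (rule separableI[where N = "{..<n}" and x = x and y = y])
    fix p q r s assume *: "p < m" "q < m" "r < b" "s < b"
    have "X $$ (p * b + r, q * b + s) = (\<Sum>i<n. outer (\<xi> i) (\<xi> i) $$ (p * b + r, q * b + s))"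
      using * by (simp add: X block_index_less)
    also have "\<dots> = (\<Sum>i<n. x i p * y i r * cnj (x i q * y i s))"
    proof (intro sum.cong refl)
      fix i assume "i \<in> {..<n}"
      hence c: "\<xi> i \<in> carrier_vec (m * b)" and "\<xi> i $ (p * b + r) = x i p * y i r" "\<xi> i $ (q * b + s) = x i q * y i s"
        using * \<xi> e by auto
      thus "outer (\<xi> i) (\<xi> i) $$ (p * b + r, q * b + s) = x i p * y i r * cnj (x i q * y i s)"
        using outer_index[OF c c block_index_less[OF *(1,3)] block_index_less[OF *(2,4)]] by simp
    qed
    finally show "X $$ (p * b + r, q * b + s) = (\<Sum>i<n. x i p * y i r * cnj (x i q * y i s))" .
  qed (simp_all add: X)
next
  assume S: "separable m b X"
  obtain N :: "(nat \<times> nat \<times> nat) set" and x y where N: "finite N" and e: "product_vectors m b X N x y"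
    using separable_ex_product_vectors[OF S] by (elim exE conjE) (rule that)
  obtain h where h: "bij_betw h {0..<card N} N" using ex_bij_betw_nat_finite[OF N] by auto
  define \<xi> where "\<xi> i = vec (m * b) (\<lambda>j. x (h i) (j div b) * y (h i) (j mod b))" for i
  have \<xi>c: "\<xi> i \<in> carrier_vec (m * b)" for i by (simp add: \<xi>_def)
  have \<xi>i: "\<xi> i $ (p * b + r) = x (h i) p * y (h i) r" if "p < m" "r < b" for i p r
    using that by (simp add: \<xi>_def block_index_less)
  have "schmidt_rank m b (\<xi> i) \<le> 1" for i
  proof -
    have "\<forall>p<m. \<forall>s<b. \<xi> i $ (p * b + s) = (\<Sum>t<1::nat. x (h i) p * y (h i) s)" by (simp add: \<xi>i)
    thus ?thesis unfolding schmidt_rank_le_iff[OF \<xi>c]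
      by (rule_tac exI[of _ "\<lambda>_. x (h i)"], rule_tac exI[of _ "\<lambda>_. y (h i)"])
  qed
  moreover have "X = mat_sum (m * b) (m * b) (\<lambda>i. outer (\<xi> i) (\<xi> i)) {..<card N}"
  proof (rule block_eqI[OF separable_carrier[OF S]])
    fix p q r s assume *: "p < m" "q < m" "r < b" "s < b"
    have "X $$ (p * b + r, q * b + s) = (\<Sum>\<nu>\<in>N. x \<nu> p * y \<nu> r * cnj (x \<nu> q * y \<nu> s))"
      by (rule e[rule_format, OF *])
    also have "\<dots> = (\<Sum>i<card N. x (h i) p * y (h i) r * cnj (x (h i) q * y (h i) s))"
      using sum.reindex_bij_betw[OF h, of "\<lambda>\<nu>. x \<nu> p * y \<nu> r * cnj (x \<nu> q * y \<nu> s)"] by (simp add: atLeast0LessThan)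
    also have "\<dots> = mat_sum (m * b) (m * b) (\<lambda>i. outer (\<xi> i) (\<xi> i)) {..<card N} $$ (p * b + r, q * b + s)"
      using * by (simp add: outer_index[OF \<xi>c \<xi>c] \<xi>i block_index_less)
    finally show "X $$ (p * b + r, q * b + s) = mat_sum (m * b) (m * b) (\<lambda>i. outer (\<xi> i) (\<xi> i)) {..<card N} $$ (p * b + r, q * b + s)" .
  qed simp
  ultimately have "schmidt_number m b X \<le> 1"
    using \<xi>c by (intro schmidt_number_leI[of _ _ _ "card N" \<xi>]) (auto simp: pure_decomposition_def max_schmidt_rank_le_iff)
  moreover have "1 \<le> schmidt_number m b X"
  proof -
    obtain n \<xi> where "max_schmidt_rank m b n \<xi> = schmidt_number m b X"
      using schmidt_number_attained[OF psd] by (elim exE conjE)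
    thus ?thesis using max_schmidt_rank_le_iff[of m b n \<xi> "schmidt_number m b X"] by simp
  qed
  ultimately show "schmidt_number m b X = 1" by simp
qed

section \<open>Trace pairing of Choi matrices\<close>

text \<open>
  Both sides are the sum of \<open>\<Phi>(E\<^bsub>pq\<^esub>)\<^bsub>rs\<^esub> cnj V\<^bsub>qt\<^esub> V\<^bsub>pu\<^esub> \<Gamma>(E\<^bsub>tu\<^esub>)\<^bsub>sr\<^esub>\<close> over all indices: a Kraus operator can be moved
  from one argument of the pairing to the other one, where it becomes its adjoint.
\<close>

lemma trace_choi_comp_Ad:
  assumes F: "linear_map a b \<Phi>" and G: "linear_map a b \<Gamma>" and V: "V \<in> carrier_mat a a"
  shows "mat_trace (choi a b \<Phi> * choi a b (\<Gamma> \<circ> Ad V)) = mat_trace (choi a b (\<Phi> \<circ> Ad (mat_adjoint V)) * choi a b \<Gamma>)"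
proof -
  note V' = mat_adjoint_carrier[OF V]
  define f where "f p q r s = \<Phi> (mat_unit a p q) $$ (r, s)" for p q r s
  define g where "g p q r s = \<Gamma> (mat_unit a p q) $$ (r, s)" for p q r s
  define T where "T p q t u r s = f p q r s * (cnj (V $$ (q, t)) * V $$ (p, u) * g t u s r)" for p q t u r s
  have GV: "linear_map a b (\<Gamma> \<circ> Ad V)" by (rule linear_map_comp[OF G linear_map_Ad[OF V]])
  have FV: "linear_map a b (\<Phi> \<circ> Ad (mat_adjoint V))" by (rule linear_map_comp[OF F linear_map_Ad[OF V']])
  have "mat_trace (choi a b \<Phi> * choi a b (\<Gamma> \<circ> Ad V))
      = (\<Sum>p<a. \<Sum>r<b. \<Sum>q<a. \<Sum>s<b. choi a b \<Phi> $$ (p * b + r, q * b + s) * choi a b (\<Gamma> \<circ> Ad V) $$ (q * b + s, p * b + r))"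
    unfolding mat_trace_mult[OF choi_carrier choi_carrier] sum_blocks ..
  also have "\<dots> = (\<Sum>p<a. \<Sum>r<b. \<Sum>q<a. \<Sum>s<b. \<Sum>t<a. \<Sum>u<a. T p q t u r s)"
  proof (intro sum.cong refl)
    fix p r q s assume "p \<in> {..<a}" "r \<in> {..<b}" "q \<in> {..<a}" "s \<in> {..<b}"
    hence *: "p < a" "r < b" "q < a" "s < b" by auto
    have "choi a b (\<Gamma> \<circ> Ad V) $$ (q * b + s, p * b + r) = \<Gamma> (Ad V (mat_unit a q p)) $$ (s, r)"
      using choi_linear_index[OF GV *(3,1,4,2)] by simp
    also have "\<dots> = (\<Sum>t<a. \<Sum>u<a. Ad V (mat_unit a q p) $$ (t, u) * g t u s r)"
      unfolding g_def by (rule linear_map_expand[OF G Ad_carrier[OF V mat_unit_carrier] *(4,2)])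
    also have "\<dots> = (\<Sum>t<a. \<Sum>u<a. cnj (V $$ (q, t)) * V $$ (p, u) * g t u s r)"
      using * by (intro sum.cong refl) (simp add: Ad_unit_index[OF V])
    finally show "choi a b \<Phi> $$ (p * b + r, q * b + s) * choi a b (\<Gamma> \<circ> Ad V) $$ (q * b + s, p * b + r)
        = (\<Sum>t<a. \<Sum>u<a. T p q t u r s)"
      using choi_linear_index[OF F *(1,3,2,4)] by (simp add: T_def f_def sum_distrib_left)
  qed
  also have "\<dots> = (\<Sum>(p, r, q, s, t, u)\<in>{..<a} \<times> {..<b} \<times> {..<a} \<times> {..<b} \<times> {..<a} \<times> {..<a}. T p q t u r s)"
    by (simp add: sum.cartesian_product)
  also have "\<dots> = (\<Sum>(u, r, t, s, p, q)\<in>{..<a} \<times> {..<b} \<times> {..<a} \<times> {..<b} \<times> {..<a} \<times> {..<a}. T p q t u r s)"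
    by (rule sum.reindex_bij_witness[of _ "\<lambda>(u, r, t, s, p, q). (p, r, q, s, t, u)" "\<lambda>(p, r, q, s, t, u). (u, r, t, s, p, q)"]) auto
  also have "\<dots> = (\<Sum>u<a. \<Sum>r<b. \<Sum>t<a. \<Sum>s<b. \<Sum>p<a. \<Sum>q<a. T p q t u r s)"
    by (simp add: sum.cartesian_product)
  also have "\<dots> = (\<Sum>u<a. \<Sum>r<b. \<Sum>t<a. \<Sum>s<b. choi a b (\<Phi> \<circ> Ad (mat_adjoint V)) $$ (u * b + r, t * b + s) * choi a b \<Gamma> $$ (t * b + s, u * b + r))"
  proof (intro sum.cong refl)
    fix u r t s assume "u \<in> {..<a}" "r \<in> {..<b}" "t \<in> {..<a}" "s \<in> {..<b}"
    hence *: "u < a" "r < b" "t < a" "s < b" by auto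
    have "choi a b (\<Phi> \<circ> Ad (mat_adjoint V)) $$ (u * b + r, t * b + s) = \<Phi> (Ad (mat_adjoint V) (mat_unit a u t)) $$ (r, s)"
      using choi_linear_index[OF FV *(1,3,2,4)] by simp
    also have "\<dots> = (\<Sum>p<a. \<Sum>q<a. Ad (mat_adjoint V) (mat_unit a u t) $$ (p, q) * f p q r s)"
      unfolding f_def by (rule linear_map_expand[OF F Ad_carrier[OF V' mat_unit_carrier] *(2,4)])
    also have "\<dots> = (\<Sum>p<a. \<Sum>q<a. V $$ (p, u) * cnj (V $$ (q, t)) * f p q r s)"
      using * by (intro sum.cong refl) (simp add: Ad_unit_index[OF V'] mat_adjoint_index[OF V])
    finally have e: "choi a b (\<Phi> \<circ> Ad (mat_adjoint V)) $$ (u * b + r, t * b + s) = (\<Sum>p<a. \<Sum>q<a. V $$ (p, u) * cnj (V $$ (q, t)) * f p q r s)" .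
    have eg: "choi a b \<Gamma> $$ (t * b + s, u * b + r) = g t u s r"
      using choi_linear_index[OF G *(3,1,4,2)] by (simp add: g_def)
    show "(\<Sum>p<a. \<Sum>q<a. T p q t u r s) = choi a b (\<Phi> \<circ> Ad (mat_adjoint V)) $$ (u * b + r, t * b + s) * choi a b \<Gamma> $$ (t * b + s, u * b + r)"
      unfolding e eg sum_distrib_right T_def by (simp only: mult_ac)
  qed
  also have "\<dots> = mat_trace (choi a b (\<Phi> \<circ> Ad (mat_adjoint V)) * choi a b \<Gamma>)"
    unfolding mat_trace_mult[OF choi_carrier choi_carrier] sum_blocks ..
  finally show ?thesis .
qed

text \<open>
  The quadratic form of \<open>\<Gamma>(|f\<rangle>\<langle>f|)\<close>, spelled out because block positivity appears in this shape below.
\<close>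

lemma positive_map_quadratic_form:
  assumes G: "positive_map m b \<Gamma>"
  shows "0 \<le> (\<Sum>s<b. \<Sum>r<b. cnj (y s) * (\<Sum>q<m. \<Sum>p<m. f q * cnj (f p) * \<Gamma> (mat_unit m q p) $$ (s, r)) * y r)"
proof -
  have L: "linear_map m b \<Gamma>" using G by (simp add: positive_map_def)
  let ?O = "outer (vec m f) (vec m f)"
  have O: "?O \<in> carrier_mat m m" by (rule outer_carrier) auto
  have "psd b (\<Gamma> ?O)" using G psd_outer[of "vec m f" m] by (simp add: positive_map_def)
  hence "0 \<le> (\<Sum>s<b. \<Sum>r<b. cnj (y s) * \<Gamma> ?O $$ (s, r) * y r)" unfolding psd_iff_quadratic_form by blast
  also have "\<dots> = (\<Sum>s<b. \<Sum>r<b. cnj (y s) * (\<Sum>q<m. \<Sum>p<m. f q * cnj (f p) * \<Gamma> (mat_unit m q p) $$ (s, r)) * y r)"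
    by (intro sum.cong refl) (simp add: linear_map_expand[OF L O] outer_index[OF vec_carrier vec_carrier])
  finally show ?thesis .
qed

lemma trace_separable_choi_nonneg:
  assumes Y: "separable m b Y" and G: "positive_map m b \<Gamma>"
  shows "0 \<le> mat_trace (Y * choi m b \<Gamma>)"
proof -
  have L: "linear_map m b \<Gamma>" using G by (simp add: positive_map_def)
  obtain N :: "(nat \<times> nat \<times> nat) set" and x y where e: "product_vectors m b Y N x y"
    using separable_ex_product_vectors[OF Y] by (elim exE conjE) (rule that)
  define g where "g p q r s = \<Gamma> (mat_unit m p q) $$ (r, s)" for p q r s
  define T where "T \<nu> p q r s = x \<nu> p * y \<nu> r * cnj (x \<nu> q * y \<nu> s) * g q p s r" for \<nu> p q r s
  have "mat_trace (Y * choi m b \<Gamma>)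
      = (\<Sum>p<m. \<Sum>r<b. \<Sum>q<m. \<Sum>s<b. Y $$ (p * b + r, q * b + s) * choi m b \<Gamma> $$ (q * b + s, p * b + r))"
    unfolding mat_trace_mult[OF separable_carrier[OF Y] choi_carrier] sum_blocks ..
  also have "\<dots> = (\<Sum>p<m. \<Sum>r<b. \<Sum>q<m. \<Sum>s<b. \<Sum>\<nu>\<in>N. T \<nu> p q r s)"
  proof (intro sum.cong refl)
    fix p r q s assume "p \<in> {..<m}" "r \<in> {..<b}" "q \<in> {..<m}" "s \<in> {..<b}"
    hence *: "p < m" "q < m" "r < b" "s < b" by auto
    show "Y $$ (p * b + r, q * b + s) * choi m b \<Gamma> $$ (q * b + s, p * b + r) = (\<Sum>\<nu>\<in>N. T \<nu> p q r s)"
      unfolding e[rule_format, OF *] choi_linear_index[OF L *(2,1,4,3)] by (simp add: T_def g_def sum_distrib_right)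
  qed
  also have "\<dots> = (\<Sum>(p, r, q, s, \<nu>)\<in>{..<m} \<times> {..<b} \<times> {..<m} \<times> {..<b} \<times> N. T \<nu> p q r s)"
    by (simp add: sum.cartesian_product)
  also have "\<dots> = (\<Sum>(\<nu>, s, r, q, p)\<in>N \<times> {..<b} \<times> {..<b} \<times> {..<m} \<times> {..<m}. T \<nu> p q r s)"
    by (rule sum.reindex_bij_witness[of _ "\<lambda>(\<nu>, s, r, q, p). (p, r, q, s, \<nu>)" "\<lambda>(p, r, q, s, \<nu>). (\<nu>, s, r, q, p)"]) auto
  also have "\<dots> = (\<Sum>\<nu>\<in>N. \<Sum>s<b. \<Sum>r<b. \<Sum>q<m. \<Sum>p<m. T \<nu> p q r s)"
    by (simp add: sum.cartesian_product)
  also have "\<dots> = (\<Sum>\<nu>\<in>N. \<Sum>s<b. \<Sum>r<b. cnj (y \<nu> s) * (\<Sum>q<m. \<Sum>p<m. cnj (x \<nu> q) * cnj (cnj (x \<nu> p)) * g q p s r) * y \<nu> r)"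
    by (intro sum.cong refl) (simp add: T_def sum_distrib_left sum_distrib_right mult_ac)
  also have "0 \<le> \<dots>"
    unfolding g_def by (intro sum_nonneg positive_map_quadratic_form[OF G])
  finally show ?thesis .
qed

text \<open>
  The adjoint of \<open>\<Gamma>\<close> for the bilinear pairing \<open>tr (A B)\<close>: the entry at \<open>(p, q)\<close> is \<open>tr (B \<Gamma>(E\<^bsub>qp\<^esub>))\<close>.
\<close>

definition dual_map :: "nat \<Rightarrow> nat \<Rightarrow> (complex mat \<Rightarrow> complex mat) \<Rightarrow> complex mat \<Rightarrow> complex mat" where
  "dual_map m b \<Gamma> B = mat m m (\<lambda>(p, q). \<Sum>r<b. \<Sum>s<b. B $$ (r, s) * \<Gamma> (mat_unit m q p) $$ (s, r))"

lemma positive_map_dual_map: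
  assumes G: "positive_map m b \<Gamma>"
  shows "positive_map b m (dual_map m b \<Gamma>)"
proof -
  have L: "linear_map b m (dual_map m b \<Gamma>)"
    unfolding linear_map_def
  proof (intro conjI ballI allI)
    fix X X' :: "complex mat" assume X: "X \<in> carrier_mat b b"
    show "dual_map m b \<Gamma> X \<in> carrier_mat m m" by (simp add: dual_map_def)
    show "dual_map m b \<Gamma> (c \<cdot>\<^sub>m X) = c \<cdot>\<^sub>m dual_map m b \<Gamma> X" for c
      using X by (intro eq_matI) (simp_all add: dual_map_def sum_distrib_left mult.assoc)
    assume X': "X' \<in> carrier_mat b b"
    show "dual_map m b \<Gamma> (X + X') = dual_map m b \<Gamma> X + dual_map m b \<Gamma> X'"
      using X X' by (intro eq_matI) (simp_all add: dual_map_def sum.distrib distrib_right)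
  qed
  have "psd m (dual_map m b \<Gamma> B)" if B: "psd b B" for B
    unfolding psd_iff_quadratic_form
  proof (intro conjI allI)
    show "dual_map m b \<Gamma> B \<in> carrier_mat m m" by (simp add: dual_map_def)
    fix f :: "nat \<Rightarrow> complex"
    obtain w where w: "\<forall>r<b. \<forall>s<b. B $$ (r, s) = (\<Sum>n<b. w n r * cnj (w n s))"
      using psd_gram_ex[OF B] by (elim exE)
    define T where "T n p q r s = cnj (f p) * (w n r * cnj (w n s) * \<Gamma> (mat_unit m q p) $$ (s, r)) * f q" for n p q r s
    have "(\<Sum>p<m. \<Sum>q<m. cnj (f p) * dual_map m b \<Gamma> B $$ (p, q) * f q) = (\<Sum>p<m. \<Sum>q<m. \<Sum>r<b. \<Sum>s<b. \<Sum>n<b. T n p q r s)"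
      using w by (intro sum.cong refl) (simp add: dual_map_def T_def sum_distrib_left sum_distrib_right)
    also have "\<dots> = (\<Sum>(p, q, r, s, n)\<in>{..<m} \<times> {..<m} \<times> {..<b} \<times> {..<b} \<times> {..<b}. T n p q r s)"
      by (simp add: sum.cartesian_product)
    also have "\<dots> = (\<Sum>(n, s, r, q, p)\<in>{..<b} \<times> {..<b} \<times> {..<b} \<times> {..<m} \<times> {..<m}. T n p q r s)"
      by (rule sum.reindex_bij_witness[of _ "\<lambda>(n, s, r, q, p). (p, q, r, s, n)" "\<lambda>(p, q, r, s, n). (n, s, r, q, p)"]) auto
    also have "\<dots> = (\<Sum>n<b. \<Sum>s<b. \<Sum>r<b. \<Sum>q<m. \<Sum>p<m. T n p q r s)"
      by (simp add: sum.cartesian_product)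
    also have "\<dots> = (\<Sum>n<b. \<Sum>s<b. \<Sum>r<b. cnj (w n s) * (\<Sum>q<m. \<Sum>p<m. f q * cnj (f p) * \<Gamma> (mat_unit m q p) $$ (s, r)) * w n r)"
      by (intro sum.cong refl) (simp add: T_def sum_distrib_left sum_distrib_right mult_ac)
    also have "0 \<le> \<dots>" by (intro sum_nonneg positive_map_quadratic_form[OF G])
    finally show "0 \<le> (\<Sum>p<m. \<Sum>q<m. cnj (f p) * dual_map m b \<Gamma> B $$ (p, q) * f q)" .
  qed
  thus ?thesis using L by (simp add: positive_map_def)
qed

text \<open>
  The pairing with a Choi matrix is the expectation of \<open>id \<otimes> dual_map \<Gamma>\<close> at the vector
  \<open>\<Sum>\<^sub>p e\<^sub>p \<otimes> e\<^sub>p\<close>, which turns a witness into a failure of positivity.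
\<close>

lemma trace_choi_eq_dual_map:
  assumes Y: "Y \<in> carrier_mat (m * b) (m * b)" and L: "linear_map m b \<Gamma>"
  shows "mat_trace (Y * choi m b \<Gamma>)
    = (\<Sum>p<m. \<Sum>q<m. id_tensor m b m (dual_map m b \<Gamma>) Y $$ (p * m + p, q * m + q))"
proof -
  have "mat_trace (Y * choi m b \<Gamma>)
      = (\<Sum>p<m. \<Sum>r<b. \<Sum>q<m. \<Sum>s<b. Y $$ (p * b + r, q * b + s) * choi m b \<Gamma> $$ (q * b + s, p * b + r))"
    unfolding mat_trace_mult[OF Y choi_carrier] sum_blocks ..
  also have "\<dots> = (\<Sum>p<m. \<Sum>q<m. \<Sum>r<b. \<Sum>s<b. Y $$ (p * b + r, q * b + s) * choi m b \<Gamma> $$ (q * b + s, p * b + r))"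
    by (intro sum.cong refl sum.swap)
  also have "\<dots> = (\<Sum>p<m. \<Sum>q<m. id_tensor m b m (dual_map m b \<Gamma>) Y $$ (p * m + p, q * m + q))"
    by (intro sum.cong refl) (simp add: id_tensor_index dual_map_def choi_linear_index[OF L])
  finally show ?thesis .
qed

text \<open>
  The quadratic form at \<open>\<Sum>\<^sub>p e\<^sub>p \<otimes> e\<^sub>p\<close>.
\<close>

lemma psd_maximally_entangled_nonneg:
  assumes "psd (m * m) M"
  shows "0 \<le> (\<Sum>p<m. \<Sum>q<m. M $$ (p * m + p, q * m + q))"
proof -
  define f where "f i = (if i div m = i mod m then 1 else 0 :: complex)" for i
  have "0 \<le> (\<Sum>i<m * m. \<Sum>j<m * m. cnj (f i) * M $$ (i, j) * f j)"
    using assms unfolding psd_iff_quadratic_form by blast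
  also have "\<dots> = (\<Sum>p<m. \<Sum>r<m. \<Sum>q<m. \<Sum>s<m. cnj (f (p * m + r)) * M $$ (p * m + r, q * m + s) * f (q * m + s))"
    unfolding sum_blocks ..
  also have "\<dots> = (\<Sum>p<m. \<Sum>r<m. \<Sum>q<m. \<Sum>s<m. if s = q then (if r = p then M $$ (p * m + p, q * m + q) else 0) else 0)"
    by (intro sum.cong refl) (auto simp: f_def)
  also have "\<dots> = (\<Sum>p<m. \<Sum>r<m. if r = p then (\<Sum>q<m. M $$ (p * m + p, q * m + q)) else 0)"
    by (intro sum.cong refl) auto
  finally show ?thesis by simp
qed

section \<open>Maps of bounded Kraus rank\<close>

lemma id_tensor_comp:
  assumes "linear_map a b \<Phi>"
  shows "id_tensor k a c (\<Gamma> \<circ> \<Phi>) X = id_tensor k b c \<Gamma> (id_tensor k a b \<Phi> X)"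
proof (rule block_eqI)
  fix p q r s assume *: "p < k" "q < k" "r < c" "s < c"
  have "mat_block b (id_tensor k a b \<Phi> X) p q = \<Phi> (mat_block a X p q)"
    using linear_map_carrier[OF assms mat_block_carrier, of X p q] * by (intro eq_matI) (auto simp: id_tensor_index)
  thus "id_tensor k a c (\<Gamma> \<circ> \<Phi>) X $$ (p * c + r, q * c + s)
      = id_tensor k b c \<Gamma> (id_tensor k a b \<Phi> X) $$ (p * c + r, q * c + s)"
    using * by (simp add: id_tensor_index)
qed simp_all

lemma k_positive_psd_choi:
  assumes K: "k_positive k a b \<Phi>" and Y: "Y \<in> carrier_mat k a"
  shows "psd (k * b) (choi k b (\<Phi> \<circ> Ad Y))"
proof -
  have L: "linear_map a b \<Phi>" using K by (simp add: k_positive_def)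
  show ?thesis unfolding choi_comp[OF L linear_map_Ad[OF Y]]
    using K psd_choi_Ad[OF Y] by (simp add: k_positive_def positive_map_def)
qed

lemma psd_separable: "separable m b X \<Longrightarrow> psd (m * b) X"
proof -
  assume S: "separable m b X"
  obtain N :: "(nat \<times> nat \<times> nat) set" and x y where e: "product_vectors m b X N x y"
    using separable_ex_product_vectors[OF S] by (elim exE conjE) (rule that)
  show ?thesis
    by (rule psd_blockI[OF separable_carrier[OF S], where N = N and w = "\<lambda>\<nu> p r. x \<nu> p * y \<nu> r"]) (rule e[rule_format])
qed

lemma choi_comp_kraus_sum:
  assumes F: "linear_map a b \<Phi>" and P: "linear_map m a \<Psi>" and V: "\<And>i. i < n \<Longrightarrow> V i \<in> carrier_mat m a"
    and e: "\<And>X. X \<in> carrier_mat m m \<Longrightarrow> \<Psi> X = mat_sum a a (\<lambda>i. Ad (V i) X) {..<n::nat}"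
  shows "choi m b (\<Phi> \<circ> \<Psi>) = mat_sum (m * b) (m * b) (\<lambda>i. choi m b (\<Phi> \<circ> Ad (V i))) {..<n}"
proof (rule block_eqI)
  fix p q r s assume *: "p < m" "q < m" "r < b" "s < b"
  have "choi m b (\<Phi> \<circ> \<Psi>) $$ (p * b + r, q * b + s) = \<Phi> (mat_sum a a (\<lambda>i. Ad (V i) (mat_unit m p q)) {..<n}) $$ (r, s)"
    using choi_linear_index[OF linear_map_comp[OF F P] *] by (simp add: e)
  also have "\<Phi> (mat_sum a a (\<lambda>i. Ad (V i) (mat_unit m p q)) {..<n}) = mat_sum b b (\<lambda>i. \<Phi> (Ad (V i) (mat_unit m p q))) {..<n}"
    by (rule linear_map_mat_sum[OF F]) (simp_all add: Ad_carrier[OF V mat_unit_carrier])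
  also have "\<dots> $$ (r, s) = (\<Sum>i<n. choi m b (\<Phi> \<circ> Ad (V i)) $$ (p * b + r, q * b + s))"
    using * by (simp, intro sum.cong refl) (simp add: choi_linear_index[OF linear_map_comp[OF F linear_map_Ad[OF V]]])
  finally show "choi m b (\<Phi> \<circ> \<Psi>) $$ (p * b + r, q * b + s)
      = mat_sum (m * b) (m * b) (\<lambda>i. choi m b (\<Phi> \<circ> Ad (V i))) {..<n} $$ (p * b + r, q * b + s)"
    unfolding mat_sum_index[OF block_index_less[OF *(1,3)] block_index_less[OF *(2,4)]] .
qed simp_all

lemma k_PEB_Ad:
  assumes V: "V \<in> carrier_mat m a" and r: "vec_space.rank m V \<le> k"
  shows "k_PEB k m a (Ad V)"
proof -
  have "\<forall>X\<in>carrier_mat m m. Ad V X = mat_sum a a (\<lambda>i. Ad V X) {..<1::nat}"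
  proof
    fix X :: "complex mat" assume "X \<in> carrier_mat m m"
    hence "Ad V X \<in> carrier_mat a a" by (rule Ad_carrier[OF V])
    thus "Ad V X = mat_sum a a (\<lambda>i. Ad V X) {..<1::nat}" by (intro eq_matI) auto
  qed
  thus ?thesis using completely_positive_Ad[OF V] V r unfolding k_PEB_def
    by (intro conjI, simp, rule_tac exI[of _ 1], rule_tac exI[of _ "\<lambda>_. V"]) simp
qed

lemma mat_trace_mult_mat_sum:
  assumes A: "A \<in> carrier_mat n n" and B: "\<And>i. i \<in> I \<Longrightarrow> B i \<in> carrier_mat n n"
  shows "mat_trace (A * mat_sum n n B I) = (\<Sum>i\<in>I. mat_trace (A * B i))"
proof -
  have "mat_trace (A * mat_sum n n B I) = (\<Sum>p<n. \<Sum>q<n. \<Sum>i\<in>I. A $$ (p, q) * B i $$ (q, p))"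
    unfolding mat_trace_mult[OF A mat_sum_carrier] by (simp add: sum_distrib_left)
  also have "\<dots> = (\<Sum>p<n. \<Sum>i\<in>I. \<Sum>q<n. A $$ (p, q) * B i $$ (q, p))"
    by (intro sum.cong refl sum.swap)
  also have "\<dots> = (\<Sum>i\<in>I. \<Sum>p<n. \<Sum>q<n. A $$ (p, q) * B i $$ (q, p))" by (rule sum.swap)
  also have "\<dots> = (\<Sum>i\<in>I. mat_trace (A * B i))"
    by (intro sum.cong refl) (simp add: mat_trace_mult[OF A B])
  finally show ?thesis .
qed

lemma few_rows_factorization:
  fixes V :: "complex mat"
  assumes V: "V \<in> carrier_mat m a" and mk: "m \<le> k"
  shows "factors_through k m a V"
proof (intro bexI)
  show "V = mat m k (\<lambda>(p, t). if t = p then 1 else 0) * mat k a (\<lambda>(t, r). V $$ (t, r))"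
  proof (rule eq_matI)
    fix p r assume "p < dim_row (mat m k (\<lambda>(p, t). if t = p then 1 else 0) * mat k a (\<lambda>(t, r). V $$ (t, r)))"
      "r < dim_col (mat m k (\<lambda>(p, t). if t = p then 1 else 0) * mat k a (\<lambda>(t, r). V $$ (t, r)))"
    hence pr: "p < m" "r < a" by auto
    have "(mat m k (\<lambda>(p, t). if t = p then 1 else 0) * mat k a (\<lambda>(t, r). V $$ (t, r))) $$ (p, r)
        = (\<Sum>t<k. (if t = p then 1 else 0) * V $$ (t, r))"
      using pr by (simp add: scalar_prod_def atLeast0LessThan)
    also have "\<dots> = (\<Sum>t<k. if t = p then V $$ (p, r) else 0)" by (intro sum.cong) auto
    also have "\<dots> = V $$ (p, r)" using pr mk by simp
    finally show "V $$ (p, r) = (mat m k (\<lambda>(p, t). if t = p then 1 else 0) * mat k a (\<lambda>(t, r). V $$ (t, r))) $$ (p, r)" ..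
  qed (use V in auto)
qed auto

section \<open>The equivalences\<close>

text \<open>
  The condition at the centre of all equivalences: \<open>\<Phi> \<circ> Ad V\<close> has a separable Choi matrix for every \<open>V\<close> of
  rank at most \<open>k\<close>, with any number \<open>m\<close> of rows. Such \<open>V\<close> are described by their factorizations.
\<close>

definition breaks_kraus_rank :: "nat \<Rightarrow> nat \<Rightarrow> nat \<Rightarrow> (complex mat \<Rightarrow> complex mat) \<Rightarrow> bool" where
  "breaks_kraus_rank k a b \<Phi> \<longleftrightarrow> (\<forall>m X Y. X \<in> carrier_mat m k \<longrightarrow> Y \<in> carrier_mat k a \<longrightarrow>
     separable m b (choi m b (\<Phi> \<circ> Ad (X * Y))))"

lemma breaks_kraus_rankD:
  assumes "breaks_kraus_rank k a b \<Phi>" "factors_through k m a V"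
  shows "separable m b (choi m b (\<Phi> \<circ> Ad V))"
  using assms unfolding breaks_kraus_rank_def by blast

lemma breaks_kraus_rankI:
  assumes "linear_map a b \<Phi>" "\<And>V. V \<in> carrier_mat k a \<Longrightarrow> separable k b (choi k b (\<Phi> \<circ> Ad V))"
  shows "breaks_kraus_rank k a b \<Phi>"
  unfolding breaks_kraus_rank_def using separable_choi_comp_Ad_mult[OF assms(1)] assms(2) by simp

text \<open>
  Positive semidefinite matrices on \<open>\<complex>\<^sup>k \<otimes> \<complex>\<^sup>a\<close> are sums of Choi matrices of maps \<open>Ad V\<close> where \<open>V\<close> has \<open>k\<close>
  rows; all matrices of rank at most \<open>k\<close> arise from these by multiplication from the left.
\<close>

lemma k_entanglement_breaking_iff_breaks_kraus_rank:
  assumes K: "k_positive k a b \<Phi>"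
  shows "k_entanglement_breaking k a b \<Phi> \<longleftrightarrow> breaks_kraus_rank k a b \<Phi>"
proof
  have L: "linear_map a b \<Phi>" using K by (simp add: k_positive_def)
  {
    assume E: "k_entanglement_breaking k a b \<Phi>"
    show "breaks_kraus_rank k a b \<Phi>"
    proof (rule breaks_kraus_rankI[OF L])
      fix V :: "complex mat" assume V: "V \<in> carrier_mat k a"
      show "separable k b (choi k b (\<Phi> \<circ> Ad V))"
        using E psd_choi_Ad[OF V] unfolding choi_comp[OF L linear_map_Ad[OF V]]
        by (simp add: k_entanglement_breaking_def)
    qed
  }
  assume S: "breaks_kraus_rank k a b \<Phi>"
  have "separable k b (id_tensor k a b \<Phi> X)" if X: "psd (k * a) X" for X
  proof -
    obtain \<xi> where \<xi>: "\<forall>i<k * a. \<xi> i \<in> carrier_vec (k * a)"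
      and Xe: "X = mat_sum (k * a) (k * a) (\<lambda>i. outer (\<xi> i) (\<xi> i)) {..<k * a}"
      using psd_eq_sum_outer[OF X] by blast
    have "id_tensor k a b \<Phi> X = mat_sum (k * b) (k * b) (\<lambda>i. choi k b (\<Phi> \<circ> Ad (kraus_mat k a (\<xi> i)))) {..<k * a}"
      unfolding Xe by (rule id_tensor_sum_outer[OF L]) (use \<xi> in auto)
    also have "separable k b \<dots>"
      by (intro separable_mat_sum breaks_kraus_rankD[OF S] few_rows_factorization[OF _ order_refl]) auto
    finally show ?thesis .
  qed
  thus "k_entanglement_breaking k a b \<Phi>" using K by (simp add: k_entanglement_breaking_def)
qed

text \<open>
  This closes the circles of implications: a matrix \<open>V = X * Y\<close> of rank at most \<open>k\<close> satisfies \<open>V = V * P\<close> for a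
  projection \<open>P\<close> of rank \<open>min k a\<close>, so that \<open>V\<close> is covered by \<open>P\<close>.
\<close>

lemma breaks_kraus_rank_if_projections:
  assumes L: "linear_map a b \<Phi>"
    and P: "\<And>P. orth_projection a P \<Longrightarrow> vec_space.rank a P = min k a \<Longrightarrow> separable a b (choi a b (\<Phi> \<circ> Ad P))"
  shows "breaks_kraus_rank k a b \<Phi>"
  unfolding breaks_kraus_rank_def
proof (intro allI impI)
  fix m and X Y :: "complex mat" assume X: "X \<in> carrier_mat m k" and Y: "Y \<in> carrier_mat k a"
  obtain P where P': "orth_projection a P" "vec_space.rank a P = min k a" and YP: "Y * P = Y"
    using projection_fixing_rows[OF Y] by (elim exE conjE)
  have Pc: "P \<in> carrier_mat a a" using P' by (simp add: orth_projection_def)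
  have "X * Y = X * Y * P" using assoc_mult_mat[OF X Y Pc] YP by simp
  moreover have "separable m b (choi m b (\<Phi> \<circ> Ad (X * Y * P)))"
    by (rule separable_choi_comp_Ad_mult[OF L mult_carrier_mat[OF X Y] Pc P[OF P']])
  ultimately show "separable m b (choi m b (\<Phi> \<circ> Ad (X * Y)))" by simp
qed

lemma orth_projectionD:
  assumes "orth_projection a P" "vec_space.rank a P = min k a"
  shows "P \<in> carrier_mat a a" "vec_space.rank a P \<le> k" "mat_adjoint P = P"
    "factors_through k a a P"
  using assms rank_factorization[of P a a k] by (auto simp: orth_projection_def)

text \<open>
  A \<open>k\<close>-positive map is completely positive as far as Kraus operators of rank at most \<open>k\<close> are concerned.
  Here it makes Hermitian the matrices to which witnesses are applied.
\<close>

lemma psd_choi_comp_Ad_factor: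
  assumes K: "k_positive k a b \<Phi>" and V: "factors_through k m a V"
  shows "psd (m * b) (choi m b (\<Phi> \<circ> Ad V))"
proof -
  have L: "linear_map a b \<Phi>" using K by (simp add: k_positive_def)
  obtain X Y where X: "X \<in> carrier_mat m k" and Y: "Y \<in> carrier_mat k a" and XY: "V = X * Y" using V by (elim bexE)
  show ?thesis unfolding XY by (rule psd_choi_comp_Ad_mult[OF L X Y k_positive_psd_choi[OF K Y]])
qed

text \<open>
  The Choi matrix of \<open>\<Psi>\<close> provides Kraus operators, and these have \<open>m \<le> k\<close> rows.
\<close>

lemma breaks_completely_positive:
  assumes K: "linear_map a b \<Phi>" and S: "breaks_kraus_rank k a b \<Phi>"
    and m: "1 \<le> m" "m \<le> k" and CP: "completely_positive m a \<Psi>"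
  shows "entanglement_breaking m b (\<Phi> \<circ> \<Psi>)"
proof -
  have LP: "linear_map m a \<Psi>" using CP by (simp add: completely_positive_def)
  have "psd (m * a) (id_tensor m m a \<Psi> (choi m m (Ad (1\<^sub>m m))))"
    using CP m psd_choi_Ad[of "1\<^sub>m m" m m] by (simp add: completely_positive_def k_positive_def positive_map_def)
  also have "id_tensor m m a \<Psi> (choi m m (Ad (1\<^sub>m m))) = choi m a (\<Psi> \<circ> Ad (1\<^sub>m m))"
    by (rule choi_comp[OF LP linear_map_Ad, symmetric]) simp
  also have "\<dots> = choi m a \<Psi>" by (rule choi_cong) (simp add: Ad_one)
  finally obtain \<xi> where \<xi>: "\<forall>i<m * a. \<xi> i \<in> carrier_vec (m * a)"
    and e: "choi m a \<Psi> = mat_sum (m * a) (m * a) (\<lambda>i. outer (\<xi> i) (\<xi> i)) {..<m * a}"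
    using psd_eq_sum_outer[of "m * a" "choi m a \<Psi>"] by blast
  have "choi m b (\<Phi> \<circ> \<Psi>) = id_tensor m a b \<Phi> (mat_sum (m * a) (m * a) (\<lambda>i. outer (\<xi> i) (\<xi> i)) {..<m * a})"
    unfolding e[symmetric] by (rule choi_comp[OF K LP])
  also have "\<dots> = mat_sum (m * b) (m * b) (\<lambda>i. choi m b (\<Phi> \<circ> Ad (kraus_mat m a (\<xi> i)))) {..<m * a}"
    by (rule id_tensor_sum_outer[OF K]) (use \<xi> in auto)
  also have "separable m b \<dots>"
    by (intro separable_mat_sum breaks_kraus_rankD[OF S] few_rows_factorization[OF _ m(2)]) auto
  finally show ?thesis using linear_map_comp[OF K LP] by (simp add: entanglement_breaking_iff_choi[OF m(1)])
qed

lemma k_PEB_factorE: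
  assumes "k_PEB k m a \<Psi>"
  shows "linear_map m a \<Psi> \<and> (\<exists>(n::nat) V. (\<forall>i<n. V i \<in> carrier_mat m a) \<and>
    (\<forall>i<n. factors_through k m a (V i)) \<and>
    (\<forall>X\<in>carrier_mat m m. \<Psi> X = mat_sum a a (\<lambda>i. Ad (V i) X) {..<n}))"
proof
  show "linear_map m a \<Psi>" using assms by (simp add: k_PEB_def completely_positive_def)
  obtain n :: nat and V where V: "\<forall>i<n. V i \<in> carrier_mat m a \<and> vec_space.rank m (V i) \<le> k"
    and e: "\<forall>X\<in>carrier_mat m m. \<Psi> X = mat_sum a a (\<lambda>i. Ad (V i) X) {..<n}"
    using assms unfolding k_PEB_def by (elim conjE exE)
  show "\<exists>(n::nat) V. (\<forall>i<n. V i \<in> carrier_mat m a) \<and>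
    (\<forall>i<n. factors_through k m a (V i)) \<and>
    (\<forall>X\<in>carrier_mat m m. \<Psi> X = mat_sum a a (\<lambda>i. Ad (V i) X) {..<n})"
  proof (rule exI[of _ n], rule exI[of _ V], intro conjI allI impI)
    fix i assume "i < n"
    thus "V i \<in> carrier_mat m a" using V by blast
    show "factors_through k m a (V i)"
      using V \<open>i < n\<close> by (intro rank_factorization) auto
  qed (rule e)
qed

lemma breaks_k_PEB:
  assumes L: "linear_map a b \<Phi>" and S: "breaks_kraus_rank k a b \<Phi>"
    and m: "1 \<le> m" and P: "k_PEB k m a \<Psi>"
  shows "entanglement_breaking m b (\<Phi> \<circ> \<Psi>)"
proof -
  obtain n :: nat and V where LP: "linear_map m a \<Psi>" and V: "\<forall>i<n. V i \<in> carrier_mat m a"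
    and f: "\<forall>i<n. factors_through k m a (V i)"
    and e: "\<forall>X\<in>carrier_mat m m. \<Psi> X = mat_sum a a (\<lambda>i. Ad (V i) X) {..<n}"
    using k_PEB_factorE[OF P] by (elim conjE exE)
  have "choi m b (\<Phi> \<circ> \<Psi>) = mat_sum (m * b) (m * b) (\<lambda>i. choi m b (\<Phi> \<circ> Ad (V i))) {..<n}"
    by (rule choi_comp_kraus_sum[OF L LP]) (use V e in auto)
  also have "separable m b \<dots>"
    by (intro separable_mat_sum breaks_kraus_rankD[OF S]) (use f in auto)
  finally show ?thesis using linear_map_comp[OF L LP] by (simp add: entanglement_breaking_iff_choi[OF m])
qed

lemma breaks_schmidt_number:
  assumes L: "linear_map a b \<Phi>" and S: "breaks_kraus_rank k a b \<Phi>"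
    and X: "psd (m * a) X" and k: "schmidt_number m a X \<le> k"
  shows "schmidt_number m b (id_tensor m a b \<Phi> X) = 1"
proof -
  obtain n \<xi> where d: "pure_decomposition (m * a) X n \<xi>" and r: "max_schmidt_rank m a n \<xi> = schmidt_number m a X"
    using schmidt_number_attained[OF X] by (elim exE conjE)
  have \<xi>: "\<xi> i \<in> carrier_vec (m * a)" "schmidt_rank m a (\<xi> i) \<le> k" if "i < n" for i
    using d max_schmidt_rank_le_iff[of m a n \<xi> k] r k that by (auto simp: pure_decomposition_def)
  have "X = mat_sum (m * a) (m * a) (\<lambda>i. outer (\<xi> i) (\<xi> i)) {..<n}"
    using d by (simp add: pure_decomposition_def)
  hence "id_tensor m a b \<Phi> X = mat_sum (m * b) (m * b) (\<lambda>i. choi m b (\<Phi> \<circ> Ad (kraus_mat m a (\<xi> i)))) {..<n}"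
    using id_tensor_sum_outer[OF L, of "{..<n}" \<xi> m] \<xi> by simp
  also have "separable m b \<dots>"
    by (intro separable_mat_sum breaks_kraus_rankD[OF S] kraus_mat_factorization) (use \<xi> in auto)
  finally show ?thesis using schmidt_number_eq_1_iff[OF psd_separable] by blast
qed

text \<open>
  The hypothesis on Schmidt numbers is applied to the Choi matrix of \<open>Ad P\<close>.
\<close>

lemma separable_if_schmidt_number:
  assumes K: "k_positive k a b \<Phi>" and k: "1 \<le> k"
    and sn: "\<And>X. psd (a * a) X \<Longrightarrow> schmidt_number a a X \<le> k \<Longrightarrow> schmidt_number a b (id_tensor a a b \<Phi> X) = 1"
    and P: "P \<in> carrier_mat a a" and f: "factors_through k a a P"
  shows "separable a b (choi a b (\<Phi> \<circ> Ad P))"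
proof -
  have L: "linear_map a b \<Phi>" using K by (simp add: k_positive_def)
  have e: "choi a b (\<Phi> \<circ> Ad P) = id_tensor a a b \<Phi> (choi a a (Ad P))" by (rule choi_comp[OF L linear_map_Ad[OF P]])
  obtain X Y where XY: "X \<in> carrier_mat a k" "Y \<in> carrier_mat k a" "P = X * Y" using f by (elim bexE)
  have "schmidt_rank a a (kraus_vec P) \<le> k" using schmidt_rank_kraus_vec[OF XY(1,2)] XY(3) by simp
  moreover have "choi a a (Ad P) = mat_sum (a * a) (a * a) (\<lambda>i. outer (kraus_vec P) (kraus_vec P)) {..<1::nat}"
    unfolding choi_Ad[OF P] using outer_carrier[OF kraus_vec_carrier[OF P] kraus_vec_carrier[OF P]]
    by (intro eq_matI) auto
  ultimately have "schmidt_number a a (choi a a (Ad P)) \<le> k"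
    using k kraus_vec_carrier[OF P]
    by (intro schmidt_number_leI[of _ _ _ 1 "\<lambda>_. kraus_vec P"]) (auto simp: pure_decomposition_def max_schmidt_rank_le_iff)
  hence "schmidt_number a b (choi a b (\<Phi> \<circ> Ad P)) = 1" unfolding e by (rule sn[OF psd_choi_Ad[OF P]])
  thus ?thesis using schmidt_number_eq_1_iff[OF psd_choi_comp_Ad_factor[OF K f]] by simp
qed

lemma k_positive_comp_positive:
  assumes E: "k_entanglement_breaking k a b \<Phi>" and G: "positive_map b m \<Gamma>"
  shows "k_positive k a m (\<Gamma> \<circ> \<Phi>)"
proof -
  have L: "linear_map a b \<Phi>" using E by (simp add: k_entanglement_breaking_def k_positive_def)
  have LG: "linear_map a m (\<Gamma> \<circ> \<Phi>)" using G by (intro linear_map_comp[OF _ L]) (simp add: positive_map_def)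
  have "psd (k * m) (id_tensor k a m (\<Gamma> \<circ> \<Phi>) X)" if "psd (k * a) X" for X
    unfolding id_tensor_comp[OF L] using E that
    by (intro psd_id_tensor_separable[OF G]) (simp add: k_entanglement_breaking_def)
  thus ?thesis using LG linear_map_id_tensor[OF LG] by (simp add: k_positive_def positive_map_def)
qed

text \<open>
  If the Choi matrix of \<open>\<Phi> \<circ> Ad P\<close> had a witness \<open>\<Gamma>\<close>, the dual map of \<open>\<Gamma>\<close> would compose with \<open>\<Phi>\<close> to a map which
  is not \<open>k\<close>-positive.
\<close>

lemma separable_if_dual_k_positive:
  assumes K: "k_positive k a b \<Phi>"
    and d: "\<And>\<Gamma>. positive_map b a \<Gamma> \<Longrightarrow> k_positive k a a (\<Gamma> \<circ> \<Phi>)"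
    and P: "P \<in> carrier_mat a a" and f: "factors_through k a a P"
  shows "separable a b (choi a b (\<Phi> \<circ> Ad P))"
proof (rule ccontr)
  assume ns: "\<not> separable a b (choi a b (\<Phi> \<circ> Ad P))"
  have L: "linear_map a b \<Phi>" using K by (simp add: k_positive_def)
  have LP: "linear_map a b (\<Phi> \<circ> Ad P)" by (rule linear_map_comp[OF L linear_map_Ad[OF P]])
  obtain \<Gamma> where G: "positive_map a b \<Gamma>" and neg: "\<not> 0 \<le> mat_trace (choi a b (\<Phi> \<circ> Ad P) * choi a b \<Gamma>)"
    using entanglement_witness[OF choi_carrier psd_hermitian[OF psd_choi_comp_Ad_factor[OF K f]] ns] by (elim exE conjE)
  have LG: "linear_map a b \<Gamma>" using G by (simp add: positive_map_def)
  define \<Delta> where "\<Delta> = dual_map a b \<Gamma>"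
  have D: "positive_map b a \<Delta>" unfolding \<Delta>_def by (rule positive_map_dual_map[OF G])
  have LD: "linear_map b a \<Delta>" using D by (simp add: positive_map_def)
  have "psd (a * a) (choi a a (\<Delta> \<circ> \<Phi> \<circ> Ad P))" by (rule psd_choi_comp_Ad_factor[OF d[OF D] f])
  also have "choi a a (\<Delta> \<circ> \<Phi> \<circ> Ad P) = id_tensor a b a \<Delta> (choi a b (\<Phi> \<circ> Ad P))"
    unfolding comp_assoc by (rule choi_comp[OF LD LP])
  finally have "0 \<le> mat_trace (choi a b (\<Phi> \<circ> Ad P) * choi a b \<Gamma>)"
    unfolding trace_choi_eq_dual_map[OF choi_carrier LG] \<Delta>_def by (rule psd_maximally_entangled_nonneg)
  thus False using neg by simp
qed

text \<open>
  The Kraus operators move to the side of \<open>\<Phi>\<close>; the adjoint of \<open>X * Y\<close> factors through \<open>\<complex>\<^sup>k\<close> as well.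
\<close>

lemma trace_nonneg_if_breaks:
  assumes L: "linear_map a b \<Phi>" and S: "breaks_kraus_rank k a b \<Phi>"
    and P: "k_PEB k a a \<Psi>" and G: "positive_map a b \<Gamma>"
  shows "0 \<le> mat_trace (choi a b \<Phi> * choi a b (\<Gamma> \<circ> \<Psi>))"
proof -
  have LG: "linear_map a b \<Gamma>" using G by (simp add: positive_map_def)
  obtain n :: nat and V where LP: "linear_map a a \<Psi>" and V: "\<forall>i<n. V i \<in> carrier_mat a a"
    and f: "\<forall>i<n. factors_through k a a (V i)"
    and e: "\<forall>X\<in>carrier_mat a a. \<Psi> X = mat_sum a a (\<lambda>i. Ad (V i) X) {..<n}"
    using k_PEB_factorE[OF P] by (elim conjE exE)
  have "choi a b (\<Gamma> \<circ> \<Psi>) = mat_sum (a * b) (a * b) (\<lambda>i. choi a b (\<Gamma> \<circ> Ad (V i))) {..<n}"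
    by (rule choi_comp_kraus_sum[OF LG LP]) (use V e in auto)
  hence "mat_trace (choi a b \<Phi> * choi a b (\<Gamma> \<circ> \<Psi>)) = (\<Sum>i<n. mat_trace (choi a b \<Phi> * choi a b (\<Gamma> \<circ> Ad (V i))))"
    by (simp add: mat_trace_mult_mat_sum)
  also have "0 \<le> \<dots>"
  proof (rule sum_nonneg)
    fix i assume "i \<in> {..<n}"
    hence Vi: "V i \<in> carrier_mat a a" and "factors_through k a a (V i)"
      using V f by auto
    then obtain X Y where XY: "X \<in> carrier_mat a k" "Y \<in> carrier_mat k a" "V i = X * Y" by (elim bexE)
    have "separable a b (choi a b (\<Phi> \<circ> Ad (mat_adjoint (V i))))"
      unfolding XY(3) mat_adjoint_mult[OF XY(1,2)]
      by (rule S[unfolded breaks_kraus_rank_def, rule_format, OF mat_adjoint_carrier[OF XY(2)] mat_adjoint_carrier[OF XY(1)]])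
    thus "0 \<le> mat_trace (choi a b \<Phi> * choi a b (\<Gamma> \<circ> Ad (V i)))"
      unfolding trace_choi_comp_Ad[OF L LG Vi] by (rule trace_separable_choi_nonneg[OF _ G])
  qed
  finally show ?thesis .
qed

text \<open>
  A witness \<open>\<Gamma>\<close> for \<open>\<Phi> \<circ> Ad P\<close> would make the pairing of \<open>\<Phi>\<close> with \<open>\<Gamma> \<circ> Ad P\<close> negative, as \<open>P\<close> is its own adjoint.
\<close>

lemma separable_if_trace_nonneg:
  assumes K: "k_positive k a b \<Phi>"
    and t: "\<And>\<Psi> \<Gamma>. k_PEB k a a \<Psi> \<Longrightarrow> positive_map a b \<Gamma> \<Longrightarrow> 0 \<le> mat_trace (choi a b \<Phi> * choi a b (\<Gamma> \<circ> \<Psi>))"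
    and P: "P \<in> carrier_mat a a" and r: "vec_space.rank a P \<le> k" and adj: "mat_adjoint P = P"
  shows "separable a b (choi a b (\<Phi> \<circ> Ad P))"
proof (rule ccontr)
  assume ns: "\<not> separable a b (choi a b (\<Phi> \<circ> Ad P))"
  have L: "linear_map a b \<Phi>" using K by (simp add: k_positive_def)
  obtain \<Gamma> where G: "positive_map a b \<Gamma>" and neg: "\<not> 0 \<le> mat_trace (choi a b (\<Phi> \<circ> Ad P) * choi a b \<Gamma>)"
    using entanglement_witness[OF choi_carrier psd_hermitian[OF psd_choi_comp_Ad_factor[OF K rank_factorization[OF P r]]] ns]
    by (elim exE conjE)
  have LG: "linear_map a b \<Gamma>" using G by (simp add: positive_map_def)
  have "0 \<le> mat_trace (choi a b \<Phi> * choi a b (\<Gamma> \<circ> Ad P))" by (rule t[OF k_PEB_Ad[OF P r] G])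
  thus False using neg unfolding trace_choi_comp_Ad[OF L LG P] adj by simp
qed

theorem theorem3p5:
  fixes d1 d2 k :: nat and \<Phi> :: "complex mat \<Rightarrow> complex mat"
  assumes "1 \<le> d1" and "1 \<le> d2" and "1 < k"
    and "k_positive k d1 d2 \<Phi>"
  shows
    "(k_entanglement_breaking k d1 d2 \<Phi> \<longleftrightarrow>
        (\<forall>\<Psi>. completely_positive k d1 \<Psi> \<longrightarrow> entanglement_breaking k d2 (\<Phi> \<circ> \<Psi>))) \<and>
     (k_entanglement_breaking k d1 d2 \<Phi> \<longleftrightarrow>
        (\<forall>m \<Psi>. 1 \<le> m \<and> m \<le> k \<and> completely_positive m d1 \<Psi> \<longrightarrow>
           entanglement_breaking m d2 (\<Phi> \<circ> \<Psi>))) \<and>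
     (k_entanglement_breaking k d1 d2 \<Phi> \<longleftrightarrow>
        (\<forall>\<Psi>. k_PEB k d1 d1 \<Psi> \<longrightarrow> entanglement_breaking d1 d2 (\<Phi> \<circ> \<Psi>))) \<and>
     (k_entanglement_breaking k d1 d2 \<Phi> \<longleftrightarrow>
        (\<forall>m \<Psi>. 1 \<le> m \<and> k_PEB k m d1 \<Psi> \<longrightarrow> entanglement_breaking m d2 (\<Phi> \<circ> \<Psi>))) \<and>
     (k_entanglement_breaking k d1 d2 \<Phi> \<longleftrightarrow>
        (\<forall>P. orth_projection d1 P \<and> vec_space.rank d1 P = min k d1 \<longrightarrow>
           entanglement_breaking d1 d2 (\<Phi> \<circ> Ad P))) \<and>
     (k_entanglement_breaking k d1 d2 \<Phi> \<longleftrightarrow>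
        (\<forall>m X. 1 \<le> m \<and> psd (m * d1) X \<and> schmidt_number m d1 X \<le> k \<longrightarrow>
           schmidt_number m d2 (id_tensor m d1 d2 \<Phi> X) = 1)) \<and>
     (k_entanglement_breaking k d1 d2 \<Phi> \<longleftrightarrow>
        (\<forall>X. psd (d1 * d1) X \<and> schmidt_number d1 d1 X \<le> k \<longrightarrow>
           schmidt_number d1 d2 (id_tensor d1 d1 d2 \<Phi> X) = 1)) \<and>
     (k_entanglement_breaking k d1 d2 \<Phi> \<longleftrightarrow>
        (\<forall>m \<Gamma>. 1 \<le> m \<and> positive_map d2 m \<Gamma> \<longrightarrow> k_positive k d1 m (\<Gamma> \<circ> \<Phi>))) \<and>
     (k_entanglement_breaking k d1 d2 \<Phi> \<longleftrightarrow>
        (\<forall>\<Gamma>. positive_map d2 d1 \<Gamma> \<longrightarrow> k_positive k d1 d1 (\<Gamma> \<circ> \<Phi>))) \<and>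
     (k_entanglement_breaking k d1 d2 \<Phi> \<longleftrightarrow>
        (\<forall>\<Psi> \<Gamma>. k_PEB k d1 d1 \<Psi> \<and> positive_map d1 d2 \<Gamma> \<longrightarrow>
           0 \<le> mat_trace (choi d1 d2 \<Phi> * choi d1 d2 (\<Gamma> \<circ> \<Psi>))))"
    (is "(?i \<longleftrightarrow> ?ii) \<and> (_ \<longleftrightarrow> ?iii) \<and> (_ \<longleftrightarrow> ?iv) \<and> (_ \<longleftrightarrow> ?v) \<and> (_ \<longleftrightarrow> ?vi) \<and>
      (_ \<longleftrightarrow> ?vii) \<and> (_ \<longleftrightarrow> ?viii) \<and> (_ \<longleftrightarrow> ?ix) \<and> (_ \<longleftrightarrow> ?x) \<and> (_ \<longleftrightarrow> ?xi)")
proof -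
  note K = assms(4)
  have k: "1 \<le> k" using assms(3) by simp
  have L: "linear_map d1 d2 \<Phi>" using K by (simp add: k_positive_def)
  \<comment> \<open>Each circle of implications starts at \<open>?S\<close>, passes through some of the conditions and returns to \<open>?S\<close>, mostly by way of \<open>?proj\<close>.\<close>
  let ?S = "breaks_kraus_rank k d1 d2 \<Phi>"
  let ?proj = "\<forall>P. orth_projection d1 P \<longrightarrow> vec_space.rank d1 P = min k d1 \<longrightarrow> separable d1 d2 (choi d1 d2 (\<Phi> \<circ> Ad P))"
  have iS: "?i \<longleftrightarrow> ?S" by (rule k_entanglement_breaking_iff_breaks_kraus_rank[OF K])
  have projS: "?proj \<Longrightarrow> ?S" using breaks_kraus_rank_if_projections[OF L] by blast
  have ii_S: ?S if ?ii
  proof (rule breaks_kraus_rankI[OF L])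
    fix V :: "complex mat" assume "V \<in> carrier_mat k d1"
    thus "separable k d2 (choi k d2 (\<Phi> \<circ> Ad V))"
      using that completely_positive_Ad entanglement_breaking_iff_choi[OF k] by blast
  qed
  have S_iii: "?S \<Longrightarrow> ?iii" using breaks_completely_positive[OF L] by blast
  have iii_ii: "?iii \<Longrightarrow> ?ii" using k by blast
  have S_v: "?S \<Longrightarrow> ?v" using breaks_k_PEB[OF L] by blast
  have v_iv: "?v \<Longrightarrow> ?iv" using assms(1) by blast
  have iv_vi: "?iv \<Longrightarrow> ?vi" using k_PEB_Ad orth_projectionD(1,2) by blast
  have vi_proj: "?vi \<Longrightarrow> ?proj" using entanglement_breaking_iff_choi[OF assms(1)] by blast
  have S_vii: "?S \<Longrightarrow> ?vii" using breaks_schmidt_number[OF L] by blast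
  have vii_viii: "?vii \<Longrightarrow> ?viii" using assms(1) by blast
  have viii_proj: ?proj if ?viii
  proof (intro allI impI)
    fix P assume P: "orth_projection d1 P" "vec_space.rank d1 P = min k d1"
    show "separable d1 d2 (choi d1 d2 (\<Phi> \<circ> Ad P))"
      by (rule separable_if_schmidt_number[OF K k _ orth_projectionD(1,4)[OF P]]) (use that in simp)
  qed
  have i_ix: "?i \<Longrightarrow> ?ix" using k_positive_comp_positive by blast
  have ix_x: "?ix \<Longrightarrow> ?x" using assms(1) by blast
  have x_proj: ?proj if ?x
  proof (intro allI impI)
    fix P assume P: "orth_projection d1 P" "vec_space.rank d1 P = min k d1"
    show "separable d1 d2 (choi d1 d2 (\<Phi> \<circ> Ad P))"
      by (rule separable_if_dual_k_positive[OF K _ orth_projectionD(1,4)[OF P]]) (use that in simp)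
  qed
  have S_xi: "?S \<Longrightarrow> ?xi" using trace_nonneg_if_breaks[OF L] by blast
  have xi_proj: ?proj if ?xi
  proof (intro allI impI)
    fix P assume P: "orth_projection d1 P" "vec_space.rank d1 P = min k d1"
    show "separable d1 d2 (choi d1 d2 (\<Phi> \<circ> Ad P))"
      by (rule separable_if_trace_nonneg[OF K _ orth_projectionD(1,2,3)[OF P]]) (use that in simp)
  qed
  have "?i \<longleftrightarrow> ?ii" using iS ii_S S_iii iii_ii by argo
  moreover have "?i \<longleftrightarrow> ?iii" using iS ii_S S_iii iii_ii by argo
  moreover have "?i \<longleftrightarrow> ?iv" using iS S_v v_iv iv_vi vi_proj projS by argo
  moreover have "?i \<longleftrightarrow> ?v" using iS S_v v_iv iv_vi vi_proj projS by argo
  moreover have "?i \<longleftrightarrow> ?vi" using iS S_v v_iv iv_vi vi_proj projS by argo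
  moreover have "?i \<longleftrightarrow> ?vii" using iS S_vii vii_viii viii_proj projS by argo
  moreover have "?i \<longleftrightarrow> ?viii" using iS S_vii vii_viii viii_proj projS by argo
  moreover have "?i \<longleftrightarrow> ?ix" using iS i_ix ix_x x_proj projS by argo
  moreover have "?i \<longleftrightarrow> ?x" using iS i_ix ix_x x_proj projS by argo
  moreover have "?i \<longleftrightarrow> ?xi" using iS S_xi xi_proj projS by argo
  ultimately show ?thesis by (intro conjI)
qed

end
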